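(* Let $K$ be an algebraically closed field, $\Lambda = KQ/\langle\text{all paths of length } L+1\rangle$ a truncated path algebra of Loewy length $L+1$ ($Q$ a finite quiver), and $\mathbf{d}$ a dimension vector. Then the irreducible components of $\mathbf{Rep}_{\mathbf{d}}(\Lambda)$ are precisely those closures $\overline{\mathbf{Rep}\,\mathbb{S}}$, $\mathbb{S}$ a semisimple sequence with dimension vector $\mathbf{d}$, on which the map $\Gamma_\bullet: x\mapsto\Gamma(M_x)$ attains the value $1$. In other words, $\overline{\mathbf{Rep}\,\mathbb{S}}$ is maximal among the irreducible subsets of $\mathbf{Rep}_{\mathbf{d}}(\Lambda)$ if and only if there exists a module $N$ in $\mathbf{Rep}\,\mathbb{S}$ (i.e., a $\mathbf{d}$-dimensional module $N$ with radical layering $\mathbb{S}$) such that $N\supseteq JN\supseteq\cdots\supseteq J^{L+1}N$ is the only filtration of $N$ which is governed by a realizable semisimple sequence.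
   Context: Modules are finite dimensional left modules. $J$ is the Jacobson radical of $\Lambda$; $L$ is the maximal length of a path in $Q$ that is nonzero in $\Lambda$, equivalently $L$ is minimal with $J^{L+1}=0$. Denote by $e_1,\dots,e_n$ the vertices of $Q$ and by $Q_1$ the set of arrows. Isomorphic semisimple modules are identified. For $\mathbf{d}=(d_1,\dots,d_n)$, $\mathbf{Rep}_{\mathbf{d}}(\Lambda)$ is the affine variety of all tuples $(x_\alpha)_{\alpha\in Q_1} \in \prod_{\alpha\in Q_1}\mathrm{Hom}_K(K^{d_{\mathrm{start}(\alpha)}},K^{d_{\mathrm{end}(\alpha)}})$ for which all compositions along paths of length $L+1$ vanish (Zariski topology). A point $x$ determines the $\Lambda$-module $M_x = \bigoplus_i K^{d_i}$ on which each arrow $\alpha$ acts by $x_\alpha$. A semisimple sequence with dimension vector $\mathbf{d}$ is a sequence $\mathbb{S}=(\mathbb{S}_0,\dots,\mathbb{S}_L)$ of (isomorphism classes of) semisimple $\Lambda$-modules with $\sum_{l=0}^L\underline{\dim}\,\mathbb{S}_l=\mathbf{d}$. The radical layering of a module $M$ is $\mathbb{S}(M) = (J^lM/J^{l+1}M)_{0\le l\le L}$. $\mathbf{Rep}\,\mathbb{S}$ is the locally closed subvariety of $\mathbf{Rep}_{\mathbf{d}}(\Lambda)$ consisting of the points $x$ with $\mathbb{S}(M_x)=\mathbb{S}$; overlines denote closures in $\mathbf{Rep}_{\mathbf{d}}(\Lambda)$. The sequence $\mathbb{S}$ is realizable if $\mathbf{Rep}\,\mathbb{S}\neq\varnothing$.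 A filtration of $M$ governed by $\mathbb{S}$ is a chain of submodules $M=M_0\supseteq M_1\supseteq\cdots\supseteq M_{L+1}=0$ with $M_l/M_{l+1}\cong\mathbb{S}_l$ for $0\le l\le L$. $\Gamma(M)$ is the number of realizable semisimple sequences that govern at least one filtration of $M$. *)

theory Defs
  imports
    "HOL-Computational_Algebra.Polynomial"
    "HOL-Algebra.Generated_Groups"
    "HOL-Algebra.Ideal_Product"
    "HOL-Algebra.QuotRing"
    "HOL-Analysis.Abstract_Topology"
    "Graph_Theory.Arc_Walk"
    "Jordan_Normal_Form.Matrix"
begin

section \<open>Modules over a not necessarily commutative ring\<close>

text \<open>
  The locale \<open>module\<close> of HOL-Algebra assumes a commutative ring of scalars, but its
  record type and its locale \<open>submodule\<close> do not, and are used here.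
  All modules are left modules; the ring fields \<open>mult\<close> and \<open>one\<close> of a
  module record are irrelevant.
\<close>

definition left_ideal :: "('r, 'x) ring_scheme \<Rightarrow> 'r set \<Rightarrow> bool" where
  "left_ideal R I \<longleftrightarrow>
     subgroup I (add_monoid R) \<and> (\<forall>a\<in>carrier R. \<forall>x\<in>I. a \<otimes>\<^bsub>R\<^esub> x \<in> I)"

definition maximal_left_ideal :: "('r, 'x) ring_scheme \<Rightarrow> 'r set \<Rightarrow> bool" where
  "maximal_left_ideal R I \<longleftrightarrow>
     left_ideal R I \<and> I \<noteq> carrier R \<and>
     (\<forall>I'. left_ideal R I' \<and> I \<subseteq> I' \<longrightarrow> I' = I \<or> I' = carrier R)"

definition jacobson_radical :: "('r, 'x) ring_scheme \<Rightarrow> 'r set" where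
  "jacobson_radical R = carrier R \<inter> \<Inter>{I. maximal_left_ideal R I}"

primrec ideal_power :: "('r, 'x) ring_scheme \<Rightarrow> 'r set \<Rightarrow> nat \<Rightarrow> 'r set" where
  "ideal_power R I 0 = carrier R"
| "ideal_power R I (Suc n) = ideal_prod R I (ideal_power R I n)"

definition ideal_times_module :: "'r set \<Rightarrow> ('r, 'm) module \<Rightarrow> 'm set" where
  "ideal_times_module I M =
     generate (add_monoid M) {a \<odot>\<^bsub>M\<^esub> m | a m. a \<in> I \<and> m \<in> carrier M}"

definition radical_power :: "('r, 'x) ring_scheme \<Rightarrow> ('r, 'm) module \<Rightarrow> nat \<Rightarrow> 'm set" where
  "radical_power R M l = ideal_times_module (ideal_power R (jacobson_radical R) l) M"

text \<open>\<open>U / W\<close> for submodules \<open>W \<subseteq> U\<close> of \<open>M\<close>, with cosets as elements.\<close>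

definition quotient_module ::
    "('r, 'm) module \<Rightarrow> 'm set \<Rightarrow> 'm set \<Rightarrow> ('r, 'm set) module" where
  "quotient_module M U W =
     \<lparr>carrier = (\<lambda>m. W +>\<^bsub>M\<^esub> m) ` U, mult = undefined, one = undefined,
      zero = W, add = set_add M,
      smult = (\<lambda>a A. \<Union>m\<in>A. W +>\<^bsub>M\<^esub> (a \<odot>\<^bsub>M\<^esub> m))\<rparr>"

definition module_isomorphic ::
    "('r, 'x) ring_scheme \<Rightarrow> ('r, 'm) module \<Rightarrow> ('r, 'n) module \<Rightarrow> bool" where
  "module_isomorphic R M N \<longleftrightarrow>
     (\<exists>h. bij_betw h (carrier M) (carrier N) \<and>
          (\<forall>m\<in>carrier M. \<forall>m'\<in>carrier M. h (m \<oplus>\<^bsub>M\<^esub> m') = h m \<oplus>\<^bsub>N\<^esub> h m') \<and>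
          (\<forall>a\<in>carrier R. \<forall>m\<in>carrier M. h (a \<odot>\<^bsub>M\<^esub> m) = a \<odot>\<^bsub>N\<^esub> h m))"


section \<open>Truncated path algebras\<close>

text \<open>
  Quivers are digraphs with multiple arcs and loops allowed; an arc \<open>a\<close> starts in
  \<open>tail Q a\<close> and ends in \<open>head Q a\<close>.  A path is its start vertex together with the list
  of its arcs in order of traversal; \<open>(u, [])\<close> is the path of length 0 at \<open>u\<close>.
\<close>

type_synonym ('v, 'a) path = "'v \<times> 'a list"

definition paths :: "('v, 'a) pre_digraph \<Rightarrow> ('v, 'a) path set" where
  "paths Q = {(u, p). \<exists>v. pre_digraph.awalk Q u p v}"

text \<open>
  A product \<open>q p\<close> of paths means "first \<open>p\<close>, then \<open>q\<close>", so that an arc \<open>a\<close> maps the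
  component at \<open>tail Q a\<close> of a left module to the component at \<open>head Q a\<close>.  The product is
  the corresponding convolution over all ways to cut a path in two.
\<close>

definition path_algebra :: "('v, 'a) pre_digraph \<Rightarrow> (('v, 'a) path \<Rightarrow> 'k::field) ring" where
  "path_algebra Q =
     \<lparr>carrier = {f. finite {p. f p \<noteq> 0} \<and> {p. f p \<noteq> 0} \<subseteq> paths Q},
      mult = (\<lambda>f g (u, p). \<Sum>k\<le>length p.
                f (pre_digraph.awlast Q u (take k p), drop k p) * g (u, take k p)),
      one = (\<lambda>(u, p). if u \<in> verts Q \<and> p = [] then 1 else 0),
      zero = (\<lambda>p. 0),
      add = (\<lambda>f g p. f p + g p)\<rparr>"

definition path_element :: "('v, 'a) path \<Rightarrow> ('v, 'a) path \<Rightarrow> 'k::field" where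
  "path_element p = (\<lambda>q. if q = p then 1 else 0)"

definition truncated_path_algebra ::
    "('v, 'a) pre_digraph \<Rightarrow> nat \<Rightarrow> (('v, 'a) path \<Rightarrow> 'k::field) set ring" where
  "truncated_path_algebra Q L =
     path_algebra Q Quot
       genideal (path_algebra Q)
         {path_element (u, p) | u p. (u, p) \<in> paths Q \<and> length p = Suc L}"


section \<open>The variety of representations and its modules\<close>

text \<open>Dimension vectors are functions of which only the values on \<open>verts Q\<close> matter.\<close>

definition path_matrix :: "('a \<Rightarrow> 'k::field mat) \<Rightarrow> nat \<Rightarrow> 'a list \<Rightarrow> 'k mat" where
  "path_matrix x n p = fold (\<lambda>a A. x a * A) p (1\<^sub>m n)"

definition rep_variety ::
    "('v, 'a) pre_digraph \<Rightarrow> nat \<Rightarrow> ('v \<Rightarrow> nat) \<Rightarrow> ('a \<Rightarrow> 'k::field mat) set" where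
  "rep_variety Q L d =
     {x \<in> (\<Pi>\<^sub>E a\<in>arcs Q. carrier_mat (d (head Q a)) (d (tail Q a))).
        \<forall>u p v. pre_digraph.awalk Q u p v \<and> length p = Suc L \<longrightarrow>
          path_matrix x (d u) p = 0\<^sub>m (d v) (d u)}"

text \<open>The action of \<open>KQ\<close> on \<open>\<Oplus>\<^sub>i K^d\<^sub>i\<close> given by a tuple of matrices.\<close>

definition path_action ::
    "('v, 'a) pre_digraph \<Rightarrow> ('v \<Rightarrow> nat) \<Rightarrow> ('a \<Rightarrow> 'k::field mat) \<Rightarrow>
     (('v, 'a) path \<Rightarrow> 'k) \<Rightarrow> ('v \<Rightarrow> 'k vec) \<Rightarrow> 'v \<Rightarrow> 'k vec" where
  "path_action Q d x f m =
     (\<lambda>v\<in>verts Q. vec (d v) (\<lambda>r.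
        \<Sum>(u, p)\<in>{(u, p). f (u, p) \<noteq> 0 \<and> pre_digraph.awlast Q u p = v}.
          f (u, p) * (path_matrix x (d u) p *\<^sub>v m u) $ r))"

text \<open>
  The module \<open>M\<^sub>x\<close>.  For \<open>x\<close> in \<open>rep_variety Q L d\<close> all representatives of an element of the
  truncated path algebra act in the same way, whence \<open>the_elem\<close>.
\<close>

definition rep_module ::
    "('v, 'a) pre_digraph \<Rightarrow> ('v \<Rightarrow> nat) \<Rightarrow> ('a \<Rightarrow> 'k::field mat) \<Rightarrow>
     ((('v, 'a) path \<Rightarrow> 'k) set, 'v \<Rightarrow> 'k vec) module" where
  "rep_module Q d x =
     \<lparr>carrier = (\<Pi>\<^sub>E v\<in>verts Q. carrier_vec (d v)), mult = undefined, one = undefined,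
      zero = (\<lambda>v\<in>verts Q. 0\<^sub>v (d v)),
      add = (\<lambda>m m'. \<lambda>v\<in>verts Q. m v + m' v),
      smult = (\<lambda>A m. the_elem ((\<lambda>f. path_action Q d x f m) ` A))\<rparr>"


section \<open>The Zariski topology\<close>

text \<open>
  Regular functions are represented as functions rather than as formal polynomials; this
  gives the same zero sets.
\<close>

inductive_set polynomial_functions ::
    "('v, 'a) pre_digraph \<Rightarrow> ('v \<Rightarrow> nat) \<Rightarrow> (('a \<Rightarrow> 'k::field mat) \<Rightarrow> 'k) set"
  for Q :: "('v, 'a) pre_digraph" and d :: "'v \<Rightarrow> nat" where
  const: "(\<lambda>x. c) \<in> polynomial_functions Q d"
| coordinate: "a \<in> arcs Q \<Longrightarrow> i < d (head Q a) \<Longrightarrow> j < d (tail Q a) \<Longrightarrow>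
    (\<lambda>x. x a $$ (i, j)) \<in> polynomial_functions Q d"
| add: "f \<in> polynomial_functions Q d \<Longrightarrow> g \<in> polynomial_functions Q d \<Longrightarrow>
    (\<lambda>x. f x + g x) \<in> polynomial_functions Q d"
| mult: "f \<in> polynomial_functions Q d \<Longrightarrow> g \<in> polynomial_functions Q d \<Longrightarrow>
    (\<lambda>x. f x * g x) \<in> polynomial_functions Q d"

definition zariski_open ::
    "('v, 'a) pre_digraph \<Rightarrow> nat \<Rightarrow> ('v \<Rightarrow> nat) \<Rightarrow> ('a \<Rightarrow> 'k::field mat) set \<Rightarrow> bool" where
  "zariski_open Q L d U \<longleftrightarrow>
     (\<exists>F \<subseteq> polynomial_functions Q d. U = {x \<in> rep_variety Q L d. \<exists>f\<in>F. f x \<noteq> 0})"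

definition zariski ::
    "('v, 'a) pre_digraph \<Rightarrow> nat \<Rightarrow> ('v \<Rightarrow> nat) \<Rightarrow> ('a \<Rightarrow> 'k::field mat) topology" where
  "zariski Q L d = topology (zariski_open Q L d)"

lemma istopology_zariski_open:
  "istopology (zariski_open Q L d :: ('a \<Rightarrow> 'k::field mat) set \<Rightarrow> bool)"
  unfolding istopology_def
proof (intro conjI allI impI)
  fix S T :: "('a \<Rightarrow> 'k mat) set"
  assume "zariski_open Q L d S" "zariski_open Q L d T"
  then obtain F G where F: "F \<subseteq> polynomial_functions Q d"
      "S = {x \<in> rep_variety Q L d. \<exists>f\<in>F. f x \<noteq> 0}"
    and G: "G \<subseteq> polynomial_functions Q d"
      "T = {x \<in> rep_variety Q L d. \<exists>g\<in>G. g x \<noteq> 0}"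
    unfolding zariski_open_def by blast
  let ?H = "{(\<lambda>x. f x * g x) | f g. f \<in> F \<and> g \<in> G}"
  have "?H \<subseteq> polynomial_functions Q d"
    using F(1) G(1) by (auto intro: polynomial_functions.mult)
  moreover have "S \<inter> T = {x \<in> rep_variety Q L d. \<exists>h\<in>?H. h x \<noteq> 0}"
  proof (intro equalityI subsetI)
    fix x assume "x \<in> S \<inter> T"
    then obtain f g where "x \<in> rep_variety Q L d" "f \<in> F" "g \<in> G" "f x * g x \<noteq> 0"
      unfolding F(2) G(2) by auto
    then show "x \<in> {x \<in> rep_variety Q L d. \<exists>h\<in>?H. h x \<noteq> 0}"
      by (intro CollectI conjI bexI[of _ "\<lambda>x. f x * g x"]) blast+
  next
    fix x assume "x \<in> {x \<in> rep_variety Q L d. \<exists>h\<in>?H. h x \<noteq> 0}"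
    then obtain f g where "x \<in> rep_variety Q L d" "f \<in> F" "g \<in> G" "f x * g x \<noteq> 0"
      by blast
    moreover from this have "f x \<noteq> 0" "g x \<noteq> 0" by auto
    ultimately show "x \<in> S \<inter> T" unfolding F(2) G(2) by blast
  qed
  ultimately show "zariski_open Q L d (S \<inter> T)"
    unfolding zariski_open_def by blast
next
  fix \<K> :: "('a \<Rightarrow> 'k mat) set set"
  assume "\<forall>K\<in>\<K>. zariski_open Q L d K"
  let ?F = "{f \<in> polynomial_functions Q d. \<forall>x \<in> rep_variety Q L d. f x \<noteq> 0 \<longrightarrow> x \<in> \<Union>\<K>}"
  have "\<Union>\<K> = {x \<in> rep_variety Q L d. \<exists>f\<in>?F. f x \<noteq> 0}"
  proof (intro equalityI subsetI)
    fix x assume "x \<in> \<Union>\<K>"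
    then obtain K where K: "K \<in> \<K>" "x \<in> K" by (rule UnionE)
    with \<open>\<forall>K\<in>\<K>. zariski_open Q L d K\<close> obtain F where
      F: "F \<subseteq> polynomial_functions Q d" "K = {x \<in> rep_variety Q L d. \<exists>f\<in>F. f x \<noteq> 0}"
      unfolding zariski_open_def by meson
    from K(2) F(2) obtain f where f: "x \<in> rep_variety Q L d" "f \<in> F" "f x \<noteq> 0" by auto
    have "f \<in> ?F"
    proof (intro CollectI conjI ballI impI)
      show "f \<in> polynomial_functions Q d" using F(1) f(2) by (rule subsetD)
    next
      fix y assume "y \<in> rep_variety Q L d" "f y \<noteq> 0"
      then have "y \<in> K" using F(2) f(2) by auto
      then show "y \<in> \<Union>\<K>" using K(1) by (rule UnionI[rotated])
    qed
    then show "x \<in> {x \<in> rep_variety Q L d. \<exists>f\<in>?F. f x \<noteq> 0}" using f(1,3) by auto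
  next
    fix x assume "x \<in> {x \<in> rep_variety Q L d. \<exists>f\<in>?F. f x \<noteq> 0}"
    then show "x \<in> \<Union>\<K>" by auto
  qed
  then show "zariski_open Q L d (\<Union>\<K>)"
    unfolding zariski_open_def by (intro exI[of _ ?F] conjI) auto
qed

definition irreducible_in :: "'b topology \<Rightarrow> 'b set \<Rightarrow> bool" where
  "irreducible_in X S \<longleftrightarrow>
     S \<noteq> {} \<and> S \<subseteq> topspace X \<and>
     (\<forall>A B. closedin X A \<and> closedin X B \<and> S \<subseteq> A \<union> B \<longrightarrow> S \<subseteq> A \<or> S \<subseteq> B)"

definition irreducible_component :: "'b topology \<Rightarrow> 'b set \<Rightarrow> bool" where
  "irreducible_component X C \<longleftrightarrow>
     irreducible_in X C \<and> (\<forall>D. irreducible_in X D \<and> C \<subseteq> D \<longrightarrow> D = C)"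


section \<open>Semisimple sequences and filtrations governed by them\<close>

text \<open>
  Up to isomorphism, the simple modules over the truncated path algebra are the
  one-dimensional \<open>S\<^sub>i\<close>, one for each vertex \<open>i\<close>, on which all arcs act as zero.  The
  isomorphism class of the semisimple module \<open>\<Oplus>\<^sub>i S\<^sub>i^s\<^sub>i\<close> is encoded by its dimension vector
  \<open>s\<close>, and this module is the one given by the tuple of zero matrices.
\<close>

definition semisimple_module ::
    "('v, 'a) pre_digraph \<Rightarrow> ('v \<Rightarrow> nat) \<Rightarrow>
     ((('v, 'a) path \<Rightarrow> 'k::field) set, 'v \<Rightarrow> 'k vec) module" where
  "semisimple_module Q s =
     rep_module Q s (\<lambda>a\<in>arcs Q. 0\<^sub>m (s (head Q a)) (s (tail Q a)))"

text \<open>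
  Sequences \<open>(S\<^sub>0, \<dots>, S\<^sub>L)\<close> with dimension vector \<open>d\<close>.  Extensionality makes different
  functions denote different sequences of isomorphism classes.
\<close>

definition semisimple_sequences ::
    "('v, 'a) pre_digraph \<Rightarrow> nat \<Rightarrow> ('v \<Rightarrow> nat) \<Rightarrow> (nat \<Rightarrow> 'v \<Rightarrow> nat) set" where
  "semisimple_sequences Q L d =
     {S \<in> {..L} \<rightarrow>\<^sub>E (verts Q \<rightarrow>\<^sub>E UNIV). \<forall>v\<in>verts Q. (\<Sum>l\<le>L. S l v) = d v}"

definition has_radical_layering ::
    "('v, 'a) pre_digraph \<Rightarrow> nat \<Rightarrow>
     ((('v, 'a) path \<Rightarrow> 'k::field) set, 'm) module \<Rightarrow> (nat \<Rightarrow> 'v \<Rightarrow> nat) \<Rightarrow> bool" where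
  "has_radical_layering Q L M S \<longleftrightarrow>
     (let \<Lambda> = truncated_path_algebra Q L in
      \<forall>l\<le>L. module_isomorphic \<Lambda>
        (quotient_module M (radical_power \<Lambda> M l) (radical_power \<Lambda> M (Suc l)))
        (semisimple_module Q (S l)))"

definition rep_layer ::
    "('v, 'a) pre_digraph \<Rightarrow> nat \<Rightarrow> ('v \<Rightarrow> nat) \<Rightarrow> (nat \<Rightarrow> 'v \<Rightarrow> nat) \<Rightarrow>
     ('a \<Rightarrow> 'k::field mat) set" where
  "rep_layer Q L d S = {x \<in> rep_variety Q L d. has_radical_layering Q L (rep_module Q d x) S}"

text \<open>The type argument is the ground field.\<close>

definition realizable ::
    "'k::field itself \<Rightarrow> ('v, 'a) pre_digraph \<Rightarrow> nat \<Rightarrow> (nat \<Rightarrow> 'v \<Rightarrow> nat) \<Rightarrow> bool" where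
  "realizable K Q L S \<longleftrightarrow>
     (\<exists>d. S \<in> semisimple_sequences Q L d \<and> (rep_layer Q L d S :: ('a \<Rightarrow> 'k mat) set) \<noteq> {})"

definition governed_filtration ::
    "('v, 'a) pre_digraph \<Rightarrow> nat \<Rightarrow>
     ((('v, 'a) path \<Rightarrow> 'k::field) set, 'm) module \<Rightarrow> (nat \<Rightarrow> 'v \<Rightarrow> nat) \<Rightarrow>
     (nat \<Rightarrow> 'm set) \<Rightarrow> bool" where
  "governed_filtration Q L M S U \<longleftrightarrow>
     (let \<Lambda> = truncated_path_algebra Q L in
      U 0 = carrier M \<and> U (Suc L) = {\<zero>\<^bsub>M\<^esub>} \<and>
      (\<forall>l\<le>Suc L. submodule (U l) \<Lambda> M) \<and>
      (\<forall>l\<le>L. U (Suc l) \<subseteq> U l \<and>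
         module_isomorphic \<Lambda> (quotient_module M (U l) (U (Suc l))) (semisimple_module Q (S l))))"

definition Gamma ::
    "('v, 'a) pre_digraph \<Rightarrow> nat \<Rightarrow>
     ((('v, 'a) path \<Rightarrow> 'k::field) set, 'm) module \<Rightarrow> nat" where
  "Gamma Q L M =
     card {S. realizable TYPE('k) Q L S \<and> (\<exists>U. governed_filtration Q L M S U)}"

end

theory Submission
  imports Defs "HOL-Library.Function_Algebras" "Jordan_Normal_Form.Determinant"
begin

text \<open>
  For a realizable sequence \<open>S\<close>, the closure of the stratum of \<open>S\<close> consists exactly of the
  points whose module has a filtration governed by \<open>S\<close>.  Such points lie in the closure because a
  basis adapted to the filtration can be joined to one for a point with radical layering \<open>S\<close> by a
  polynomial curve that meets the stratum at all but finitely many parameters; the same curves show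
  that the stratum is irreducible.  Conversely, having a governed filtration is a closed condition.
  This is usually deduced from properness of flag varieties; here an ultrafilter on the stratum
  is extended to a place with residue field \<open>K\<close>, the bases adapted to the radical filtrations
  are brought to echelon form over its valuation ring, and the echelon form is specialised.

  Hence \<open>\<Gamma>\<close> counts the closures of nonempty strata through a point.  Distinct realizable
  sequences have distinct closures, since the dimensions of the modules \<open>J\<^sup>l M\<close> can only drop under
  specialisation, and the components are the maximal ones among these finitely many irreducible
  closed sets.
\<close>

section \<open>Places over an ultrafilter\<close>

text \<open>Filtrations of the required kind become linear data once bases are chosen: in adapted
  bases the matrices of the arrows only have to vanish outside a staircase (\<open>flagc\<close>),
  and this already forces the relations of the variety. That the filtration is the radical one is,
  in addition, the nonvanishing of certain minors (\<open>genc\<close>), an open condition. So the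
  points with a governed filtration are the image of an irreducible space of pairs of bases and
  structure constants, in which the preimage of a nonempty stratum is open and dense. Segments in
  this space give the curves. The converse is a limit argument, with two obstacles: bases over the
  stratum need not converge at a boundary point, and a limit of a renormalised basis might need a
  larger field. A maximal place removes both. Of finitely many functions that do not all vanish one
  divides all the others, so pivots exist; and residues lie in the given field because it is
  algebraically closed.\<close>

definition ultrafilter :: "'z filter \<Rightarrow> bool" where
  "ultrafilter F \<longleftrightarrow> F \<noteq> bot \<and> (\<forall>P. eventually P F \<or> eventually (\<lambda>z. \<not> P z) F)"

text \<open>Zorn's lemma for proper filters below \<open>F0\<close>. Finer filters are smaller, so
  the bound of a chain is its infimum.\<close>

lemma ultrafilter_exists:
  assumes "F0 \<noteq> bot"
  shows "\<exists>F \<le> F0. ultrafilter F"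
proof -
  let ?A = "{F. F \<noteq> bot \<and> F \<le> F0}"
  let ?P = "\<lambda>F F' :: 'a filter. F' \<le> F"
  have "\<exists>m\<in>?A. \<forall>a\<in>?A. ?P m a \<longrightarrow> a = m"
  proof (rule predicate_Zorn)
    show "partial_order_on ?A (relation_of ?P ?A)"
      by (rule partial_order_on_relation_ofI) auto
    fix C assume C: "C \<in> Chains (relation_of ?P ?A)"
    then have CA: "C \<subseteq> ?A"
      by (auto simp: Chains_def relation_of_def)
    have tot: "F \<le> F' \<or> F' \<le> F" if "F \<in> C" "F' \<in> C" for F F'
      using C that by (auto simp: Chains_def relation_of_def)
    show "\<exists>u\<in>?A. \<forall>a\<in>C. ?P a u"
    proof (cases "C = {}")
      case True
      then show ?thesis using assms by auto
    next
      case False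
      \<comment> \<open>A finite part of a chain attains its infimum, which is thus a member of the
        chain and proper. This is the finite intersection property that makes \<open>Inf C\<close>
        proper.\<close>
      have "\<exists>F\<in>X. Inf X = F" if "finite X" "X \<noteq> {}" "X \<subseteq> C" for X
        using that
      proof (induction X rule: finite_ne_induct)
        case (insert x X)
        then have "Inf X \<in> X" by auto
        then have "x \<le> Inf X \<or> Inf X \<le> x" using tot[of x "Inf X"] insert.prems by auto
        then have "inf x (Inf X) = x \<or> inf x (Inf X) = Inf X"
          by (auto simp: inf.absorb1 inf.absorb2)
        then show ?case using \<open>Inf X \<in> X\<close> by auto
      qed auto
      note fin = this
      have "Inf C \<noteq> bot"
      proof (rule Inf_filter_not_bot)
        fix X assume X: "X \<subseteq> C" "finite X"
        show "Inf X \<noteq> bot"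
        proof (cases "X = {}")
          case True
          have "F0 \<le> Inf X" unfolding True by simp
          then show ?thesis using assms bot.extremum_uniqueI[of F0] by auto
        next
          case False
          then show ?thesis using fin[OF X(2)] X(1) CA by auto
        qed
      qed
      moreover have "Inf C \<le> F0"
      proof -
        obtain F where "F \<in> C" using False by auto
        then show ?thesis using CA Inf_lower[of F C] by (auto intro: order_trans)
      qed
      ultimately show ?thesis
        by (intro bexI[of _ "Inf C"]) (auto intro: Inf_lower)
    qed
  qed
  then obtain F where F: "F \<noteq> bot" "F \<le> F0" and max: "\<And>F'. F' \<noteq> bot \<Longrightarrow> F' \<le> F0 \<Longrightarrow> F' \<le> F \<Longrightarrow> F' = F"
    by auto
  have "eventually P F \<or> eventually (\<lambda>z. \<not> P z) F" for P
  \<comment> \<open>Either the complement of \<open>P\<close> already belongs to \<open>F\<close>,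
    or restricting \<open>F\<close> to \<open>P\<close> gives a proper filter below
    \<open>F\<close>, which minimality identifies with \<open>F\<close>.\<close>
  proof (cases "inf F (principal {z. P z}) = bot")
    case True
    then have "eventually (\<lambda>z. \<not> P z) F"
      by (simp add: trivial_limit_def eventually_inf_principal)
    then show ?thesis ..
  next
    case False
    then have "inf F (principal {z. P z}) = F"
      using F(2) by (intro max) (auto intro: le_infI1)
    then have "eventually P F"
      using eventually_inf_principal[of P F "{z. P z}"] by simp
    then show ?thesis ..
  qed
  with F show ?thesis
    unfolding ultrafilter_def by blast
qed

lemma ultrafilter_finite_disj:
  assumes "ultrafilter F" "eventually (\<lambda>z. \<exists>i<n::nat. P i z) F"
  shows "\<exists>i<n. eventually (P i) F"
proof (rule ccontr)
  assume "\<not> ?thesis"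
  then have "\<forall>i<n. eventually (\<lambda>z. \<not> P i z) F"
    using assms(1) by (auto simp: ultrafilter_def)
  then have "eventually (\<lambda>z. \<forall>i\<in>{..<n}. \<not> P i z) F"
    by (intro eventually_ball_finite) auto
  with assms(2) have "eventually (\<lambda>z. False) F"
    by eventually_elim auto
  with assms(1) show False
    by (auto simp: ultrafilter_def trivial_limit_def)
qed

text \<open>\<open>G\<close> is the graph of a homomorphism to the field from a ring of functions
  taken modulo \<open>F\<close>; \<open>null\<close> is its well-definedness. A relation instead of
  a function lets the domain grow by inclusion, so that a chain is bounded by its union.\<close>

locale pre_place =
  fixes F :: "'z filter" and G :: "(('z \<Rightarrow> 'k::alg_closed_field) \<times> 'k) set"
  assumes const: "(\<lambda>_. c, c) \<in> G"
    and add: "(f, c) \<in> G \<Longrightarrow> (g, d) \<in> G \<Longrightarrow> (\<lambda>z. f z + g z, c + d) \<in> G"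
    and mult: "(f, c) \<in> G \<Longrightarrow> (g, d) \<in> G \<Longrightarrow> (\<lambda>z. f z * g z, c * d) \<in> G"
    and null: "(f, c) \<in> G \<Longrightarrow> eventually (\<lambda>z. f z = 0) F \<Longrightarrow> c = 0"
begin

lemma uminus: "(f, c) \<in> G \<Longrightarrow> (\<lambda>z. - f z, - c) \<in> G"
  using mult[OF const[of "-1"]] by fastforce

lemma diff: "(f, c) \<in> G \<Longrightarrow> (g, d) \<in> G \<Longrightarrow> (\<lambda>z. f z - g z, c - d) \<in> G"
  using add[OF _ uminus] by fastforce

lemma sum: "(\<And>i. i \<in> I \<Longrightarrow> (f i, c i) \<in> G) \<Longrightarrow> (\<lambda>z. \<Sum>i\<in>I. f i z, \<Sum>i\<in>I. c i) \<in> G"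
proof (induction I rule: infinite_finite_induct)
  case (insert x I)
  then show ?case using add[of "f x" "c x"] by fastforce
qed (auto simp: const)

lemma unique: "(f, c) \<in> G \<Longrightarrow> (g, d) \<in> G \<Longrightarrow> eventually (\<lambda>z. f z = g z) F \<Longrightarrow> c = d"
  using null[OF diff, of f c g d] by (simp add: eventually_mono)

end

text \<open>An element of least degree generates the ideal, and it is not constant, so it has a
  root. This step keeps the residue field of a place equal to the base field.\<close>

lemma poly_ideal_root:
  fixes I :: "'k::alg_closed_field poly set"
  assumes add: "\<And>p q. p \<in> I \<Longrightarrow> q \<in> I \<Longrightarrow> p + q \<in> I"
    and mult: "\<And>p q. p \<in> I \<Longrightarrow> q * p \<in> I"
    and one: "1 \<notin> I"
  shows "\<exists>t. \<forall>p\<in>I. poly p t = 0"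
proof (cases "I \<subseteq> {0}")
  case True
  then show ?thesis by (intro exI[of _ 0]) auto
next
  case False
  then have ex: "\<exists>p. p \<in> I \<and> p \<noteq> 0" by auto
  define p where "p = (ARG_MIN degree p. p \<in> I \<and> p \<noteq> 0)"
  have p: "p \<in> I" "p \<noteq> 0" and min: "\<And>q. q \<in> I \<Longrightarrow> q \<noteq> 0 \<Longrightarrow> degree p \<le> degree q"
    using arg_min_nat_lemma[of "\<lambda>p. p \<in> I \<and> p \<noteq> 0" _ degree] ex
    unfolding p_def by blast+
  have "degree p > 0"
  proof (rule ccontr)
    assume "\<not> degree p > 0"
    then obtain c where c: "p = [:c:]" by (auto elim: degree_eq_zeroE)
    then have "[:1/c:] * p = 1" using p by (simp add: one_pCons)
    with mult[OF p(1), of "[:1/c:]"] one show False by simp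
  qed
  then obtain t where t: "poly p t = 0"
    using alg_closed_imp_poly_has_root by blast
  have "poly q t = 0" if "q \<in> I" for q
  proof -
    have "q mod p = q + (- (q div p)) * p"
      by (simp add: minus_div_mult_eq_mod[symmetric])
    then have "q mod p \<in> I" using add[OF that mult[OF p(1), of "- (q div p)"]] by metis
    then have "q mod p = 0"
      using min[of "q mod p"] degree_mod_less[of p q] p(2) by force
    then have "p dvd q" by (simp add: dvd_eq_mod_eq_0)
    with t show ?thesis by (auto simp: dvd_def)
  qed
  then show ?thesis by blast
qed

text \<open>
  Chevalley's extension argument: a maximal specialisation behaves like the residue map
  of a valuation ring of the ultrapower, with residue field \<open>K\<close> because \<open>K\<close> is
  algebraically closed.
\<close>

locale place = pre_place F G
  for F :: "'z filter" and G :: "(('z \<Rightarrow> 'k::alg_closed_field) \<times> 'k) set" +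
  assumes ultra: "ultrafilter F"
    and maximal: "pre_place F G' \<Longrightarrow> G \<subseteq> G' \<Longrightarrow> G' = G"
begin

text \<open>Closing \<open>G\<close> under equality modulo \<open>F\<close> gives such a
  homomorphism again, so a maximal \<open>G\<close> is already closed.\<close>

lemma cong:
  assumes "(f, c) \<in> G" "eventually (\<lambda>z. f z = g z) F"
  shows "(g, c) \<in> G"
proof -
  let ?G = "{(g, c). \<exists>f. (f, c) \<in> G \<and> eventually (\<lambda>z. f z = g z) F}"
  have sub: "G \<subseteq> ?G" by auto
  have "pre_place F ?G"
  proof (unfold_locales, goal_cases)
    case 1
    then show ?case using const sub by blast
  next
    case (2 f c g d)
    then obtain f' g' where *: "(f', c) \<in> G" "(g', d) \<in> G"
      "eventually (\<lambda>z. f' z = f z) F" "eventually (\<lambda>z. g' z = g z) F" by auto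
    from *(3,4) have "eventually (\<lambda>z. f' z + g' z = f z + g z) F"
      by eventually_elim auto
    then show ?case using add[OF *(1,2)] by auto
  next
    case (3 f c g d)
    then obtain f' g' where *: "(f', c) \<in> G" "(g', d) \<in> G"
      "eventually (\<lambda>z. f' z = f z) F" "eventually (\<lambda>z. g' z = g z) F" by auto
    from *(3,4) have "eventually (\<lambda>z. f' z * g' z = f z * g z) F"
      by eventually_elim auto
    then show ?case using mult[OF *(1,2)] by auto
  next
    case (4 f c)
    then obtain f' where *: "(f', c) \<in> G" "eventually (\<lambda>z. f' z = f z) F" by auto
    from *(2) 4(2) have "eventually (\<lambda>z. f' z = 0) F" by eventually_elim auto
    then show ?case using null[OF *(1)] by auto
  qed
  with maximal[OF _ sub] show ?thesis using assms by auto
qed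

text \<open>\<open>p\<close> is the residue of a polynomial \<open>P\<close> whose coefficients are
  finite, that is, lie in the domain of \<open>G\<close>.\<close>

definition lifts :: "('z \<Rightarrow> 'k) poly \<Rightarrow> 'k poly \<Rightarrow> bool" where
  "lifts P p \<longleftrightarrow> (\<forall>i. (coeff P i, coeff p i) \<in> G)"

lemma lifts_add: "lifts P p \<Longrightarrow> lifts Q q \<Longrightarrow> lifts (P + Q) (p + q)"
  unfolding lifts_def coeff_add plus_fun_def by (auto intro: add)

lemma sum_fun_eq: "(\<Sum>i\<in>A. f i) = (\<lambda>z. \<Sum>i\<in>A. f i z)" for f :: "'i \<Rightarrow> 'z \<Rightarrow> 'k"
  by (induction A rule: infinite_finite_induct) (auto simp: fun_eq_iff)

lemma lifts_mult: "lifts P p \<Longrightarrow> lifts Q q \<Longrightarrow> lifts (P * Q) (p * q)"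
  unfolding lifts_def coeff_mult sum_fun_eq times_fun_def by (auto intro!: sum mult)

lemma lifts_const: "lifts (map_poly (\<lambda>c _. c) p) p"
  unfolding lifts_def by (subst coeff_map_poly) (auto simp: const fun_eq_iff)

text \<open>The homomorphism extends to the ring obtained by adjoining \<open>h\<close>, with value
  \<open>t\<close> there, as soon as every relation satisfied by \<open>h\<close> reduces to one
  satisfied by \<open>t\<close>. By maximality the extension is \<open>G\<close> itself.\<close>

lemma adjoin:
  assumes "\<And>P p. lifts P p \<Longrightarrow> eventually (\<lambda>z. poly P h z = 0) F \<Longrightarrow> poly p t = 0"
  shows "(h, t) \<in> G"
proof -
  let ?G = "{(poly P h, poly p t) | P p. lifts P p}"
  have "pre_place F ?G"
  proof (unfold_locales, goal_cases)
    case (1 c)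
    have "lifts [:\<lambda>_. c:] [:c:]"
      using const[of 0] const[of c] by (auto simp: lifts_def coeff_pCons zero_fun_def split: nat.split)
    then show ?case by (force intro!: exI[of _ "[:\<lambda>_. c:]"] exI[of _ "[:c:]"])
  next
    case (2 f c g d)
    then obtain P p Q q where "lifts P p" "f = poly P h" "c = poly p t"
        "lifts Q q" "g = poly Q h" "d = poly q t" by auto
    then show ?case
      using lifts_add[of P p Q q]
      by (intro CollectI exI[of _ "P + Q"] exI[of _ "p + q"]) (simp add: plus_fun_def)
  next
    case (3 f c g d)
    then obtain P p Q q where "lifts P p" "f = poly P h" "c = poly p t"
        "lifts Q q" "g = poly Q h" "d = poly q t" by auto
    then show ?case
      using lifts_mult[of P p Q q]
      by (intro CollectI exI[of _ "P * Q"] exI[of _ "p * q"]) (simp add: times_fun_def)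
  next
    case (4 f c)
    then show ?case using assms by auto
  qed
  moreover have "G \<subseteq> ?G"
  proof
    fix x assume "x \<in> G"
    moreover obtain f c where "x = (f, c)" by (cases x)
    moreover have "lifts [:f:] [:c:]" if "(f, c) \<in> G"
      using const[of 0] that by (auto simp: lifts_def coeff_pCons zero_fun_def split: nat.split)
    ultimately show "x \<in> ?G" by (force intro!: exI[of _ "[:f:]"] exI[of _ "[:c:]"])
  qed
  ultimately have "?G = G" by (rule maximal)
  moreover have "lifts [:0, 1:] [:0, 1:]"
    using const[of 0] const[of 1]
    by (auto simp: lifts_def coeff_pCons zero_fun_def one_fun_def split: nat.split)
  then have "(h, t) \<in> ?G"
    by (force intro!: exI[of _ "[:0,1:]"])
  ultimately show ?thesis by simp
qed

text \<open>Up to sign this writes 1 as a polynomial in \<open>h\<close> whose coefficients have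
  residue 0: the maximal ideal generates the unit ideal once \<open>h\<close> is adjoined. It is the
  obstruction to a finite value of \<open>h\<close>.\<close>

definition unit_relation :: "nat \<Rightarrow> ('z \<Rightarrow> 'k) \<Rightarrow> bool" where
  "unit_relation n h \<longleftrightarrow>
     (\<exists>a. (\<forall>i. (a i, if i = 0 then 1 else 0) \<in> G) \<and> eventually (\<lambda>z. (\<Sum>i\<le>n. a i z * h z ^ i) = 0) F)"

text \<open>The residues of the relations satisfied by \<open>h\<close> form an ideal in the
  polynomial ring over the field. If it is proper, a common root is a consistent value for
  \<open>h\<close>; if it contains 1, the relation behind this 1 is a unit relation.\<close>

lemma finite_or_unit_relation: "(\<exists>t. (h, t) \<in> G) \<or> (\<exists>n. unit_relation n h)"
proof -
  let ?I = "{p. \<exists>P. lifts P p \<and> eventually (\<lambda>z. poly P h z = 0) F}"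
  show ?thesis
  proof (cases "1 \<in> ?I")
    case True
    then obtain P where P: "lifts P 1" "eventually (\<lambda>z. poly P h z = 0) F" by auto
    have "poly P h z = (\<Sum>i\<le>degree P. coeff P i z * h z ^ i)" for z
    proof -
      have "(h ^ i) z = h z ^ i" for i by (induction i) auto
      then show ?thesis by (simp add: poly_altdef sum_fun_eq)
    qed
    moreover have "(coeff P i, if i = 0 then 1 else 0) \<in> G" for i
      using P(1) by (cases i) (auto simp: lifts_def dest: spec[of _ i])
    ultimately have "unit_relation (degree P) h"
      using P(2) unfolding unit_relation_def by (intro exI[of _ "coeff P"]) auto
    then show ?thesis by blast
  next
    case False
    have "\<exists>t. \<forall>p\<in>?I. poly p t = 0"
    proof (rule poly_ideal_root)
      fix p q assume "p \<in> ?I" "q \<in> ?I"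
      then obtain P Q where *: "lifts P p" "lifts Q q" "eventually (\<lambda>z. poly P h z = 0) F"
        "eventually (\<lambda>z. poly Q h z = 0) F" by auto
      from *(3,4) have "eventually (\<lambda>z. poly (P + Q) h z = 0) F" by eventually_elim auto
      then show "p + q \<in> ?I" using lifts_add[OF *(1,2)] by auto
    next
      fix p q assume "p \<in> ?I"
      then obtain P where *: "lifts P p" "eventually (\<lambda>z. poly P h z = 0) F" by auto
      from *(2) have "eventually (\<lambda>z. poly (map_poly (\<lambda>c _. c) q * P) h z = 0) F"
        by eventually_elim auto
      then show "q * p \<in> ?I" using lifts_mult[OF lifts_const *(1)] by blast
    qed (use False in auto)
    then show ?thesis using adjoin[of h] by blast
  qed
qed

text \<open>Padding with zero coefficients brings the relations of a function and of its inverse to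
  a common degree.\<close>

lemma unit_relation_mono:
  assumes "unit_relation m h" "m \<le> n"
  shows "unit_relation n h"
proof -
  obtain a where a: "\<And>i. (a i, if i = 0 then 1 else 0) \<in> G"
    "eventually (\<lambda>z. (\<Sum>i\<le>m. a i z * h z ^ i) = 0) F"
    using assms(1) by (auto simp: unit_relation_def)
  let ?b = "\<lambda>i. if i \<le> m then a i else (\<lambda>_. 0)"
  have "(\<Sum>i\<le>n. ?b i z * h z ^ i) = (\<Sum>i\<le>m. a i z * h z ^ i)" for z
    using assms(2) by (intro sum.mono_neutral_cong_right) auto
  moreover have "(?b i, if i = 0 then 1 else 0) \<in> G" for i
    using a(1)[of i] const[of 0] by auto
  ultimately show ?thesis
    using a(2) unfolding unit_relation_def by (intro exI[of _ ?b]) auto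
qed

lemma not_unit_relation_0: "\<not> unit_relation 0 h"
proof
  assume "unit_relation 0 h"
  then obtain a where a: "\<forall>i. (a i, if i = 0 then 1 else 0 :: 'k) \<in> G"
    "eventually (\<lambda>z. (\<Sum>i\<le>0. a i z * h z ^ i) = 0) F"
    unfolding unit_relation_def by blast
  then show False using null[of "a 0" 1] spec[OF a(1), of 0] by simp
qed

text \<open>Multiplied by \<open>h z ^ Suc n\<close>, the relation of the inverse expresses
  \<open>b 0 z * h z ^ Suc n\<close> by lower powers of \<open>h\<close>. Substituting this into
  \<open>b 0\<close> times the relation of \<open>h\<close> removes the top term.\<close>

lemma unit_relation_reduce:
  assumes h: "unit_relation (Suc n) h" and h': "unit_relation (Suc n) h'"
    and inv: "eventually (\<lambda>z. h z * h' z = 1) F"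
  shows "unit_relation n h"
proof -
  let ?\<delta> = "\<lambda>i::nat. if i = 0 then 1 else 0 :: 'k"
  obtain a where a: "\<And>i. (a i, ?\<delta> i) \<in> G"
    "eventually (\<lambda>z. (\<Sum>i\<le>Suc n. a i z * h z ^ i) = 0) F"
    using h by (auto simp: unit_relation_def)
  obtain b where b: "\<And>i. (b i, ?\<delta> i) \<in> G"
    "eventually (\<lambda>z. (\<Sum>i\<le>Suc n. b i z * h' z ^ i) = 0) F"
    using h' by (auto simp: unit_relation_def)
  \<comment> \<open>The residues keep the pattern 1, 0, 0, ... because \<open>b 0\<close> has
    residue 1 and the correction carries the factor \<open>a (Suc n)\<close> of residue 0.\<close>
  let ?c = "\<lambda>i z. b 0 z * a i z - (if i \<le> n then a (Suc n) z * b (Suc n - i) z else 0)"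
  have "(?c i, ?\<delta> i) \<in> G" for i
  proof (cases "i \<le> n")
    case True
    have "(\<lambda>z. b 0 z * a i z - a (Suc n) z * b (Suc n - i) z, ?\<delta> 0 * ?\<delta> i - ?\<delta> (Suc n) * ?\<delta> (Suc n - i)) \<in> G"
      by (intro diff mult a b)
    then show ?thesis using True by simp
  next
    case False
    have "(\<lambda>z. b 0 z * a i z - 0, ?\<delta> 0 * ?\<delta> i - 0) \<in> G"
      by (intro diff mult a b const)
    then show ?thesis using False by simp
  qed
  moreover have "eventually (\<lambda>z. (\<Sum>i\<le>n. ?c i z * h z ^ i) = 0) F"
    using a(2) b(2) inv
  proof eventually_elim
    case (elim z)
    have "0 = h z ^ Suc n * (\<Sum>i\<le>Suc n. b i z * h' z ^ i)" using elim by simp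
    also have "\<dots> = (\<Sum>i\<le>Suc n. b i z * h z ^ (Suc n - i))"
      unfolding sum_distrib_left
    proof (intro sum.cong refl)
      fix i assume "i \<in> {..Suc n}"
      then have "h z ^ Suc n = h z ^ (Suc n - i) * h z ^ i"
        by (simp add: power_add[symmetric] del: power_Suc)
      then have "h z ^ Suc n * (b i z * h' z ^ i) = b i z * h z ^ (Suc n - i) * (h z * h' z) ^ i"
        by (simp only: power_mult_distrib ac_simps)
      then show "h z ^ Suc n * (b i z * h' z ^ i) = b i z * h z ^ (Suc n - i)"
        using elim by simp
    qed
    also have "\<dots> = b 0 z * h z ^ Suc n + (\<Sum>i\<le>n. b (Suc i) z * h z ^ (n - i))"
      by (subst sum.atMost_Suc_shift) simp
    also have "(\<Sum>i\<le>n. b (Suc i) z * h z ^ (n - i)) = (\<Sum>i\<le>n. b (Suc n - i) z * h z ^ i)"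
      by (rule sum.reindex_bij_witness[of _ "\<lambda>i. n - i" "\<lambda>i. n - i"]) (auto simp: Suc_diff_le)
    finally have 1: "(\<Sum>i\<le>n. b (Suc n - i) z * h z ^ i) = - b 0 z * h z ^ Suc n"
      by (simp add: eq_neg_iff_add_eq_0 add.commute)
    have "(\<Sum>i\<le>n. ?c i z * h z ^ i) =
        b 0 z * (\<Sum>i\<le>n. a i z * h z ^ i) - a (Suc n) z * (\<Sum>i\<le>n. b (Suc n - i) z * h z ^ i)"
      by (simp add: sum_distrib_left sum_subtractf[symmetric] algebra_simps)
    also have "\<dots> = b 0 z * (\<Sum>i\<le>Suc n. a i z * h z ^ i)"
      unfolding 1 by (simp add: algebra_simps)
    finally show ?case using elim by simp
  qed
  ultimately show ?thesis
    unfolding unit_relation_def by (intro exI[of _ ?c]) auto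
qed

text \<open>If neither value were finite, both functions would satisfy unit relations. With both
  degrees least possible and the shorter relation padded, \<open>unit_relation_reduce\<close> would
  shorten the longer one.\<close>

lemma valuation:
  assumes "eventually (\<lambda>z. h z * h' z = 1) F"
  shows "(\<exists>t. (h, t) \<in> G) \<or> (\<exists>t. (h', t) \<in> G)"
proof (rule ccontr)
  assume "\<not> ?thesis"
  then have ex: "\<exists>n. unit_relation n h" "\<exists>n. unit_relation n h'"
    using finite_or_unit_relation by blast+
  define n m where "n = (LEAST n. unit_relation n h)" and "m = (LEAST n. unit_relation n h')"
  have n: "unit_relation n h" "\<And>k. k < n \<Longrightarrow> \<not> unit_relation k h"
    and m: "unit_relation m h'" "\<And>k. k < m \<Longrightarrow> \<not> unit_relation k h'"
    using LeastI_ex[OF ex(1)] LeastI_ex[OF ex(2)] not_less_Least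
    unfolding n_def m_def by auto
  have "n \<noteq> 0" using n(1) not_unit_relation_0[of h] by (cases n) auto
  have "m \<noteq> 0" using m(1) not_unit_relation_0[of h'] by (cases m) auto
  have inv': "eventually (\<lambda>z. h' z * h z = 1) F"
    using assms by (simp add: mult.commute)
  show False
  proof (cases "m \<le> n")
    case True
    then show False
      using unit_relation_reduce[of "n - 1" h h'] unit_relation_mono[OF m(1) True] n assms \<open>n \<noteq> 0\<close>
      by simp
  next
    case False
    then show False
      using unit_relation_reduce[of "m - 1" h' h] unit_relation_mono[OF n(1), of m] m inv' \<open>m \<noteq> 0\<close>
      by simp
  qed
qed

lemma finite_total_preorder_min:
  assumes "finite J" "J \<noteq> {}"
    and tot: "\<And>i j. i \<in> J \<Longrightarrow> j \<in> J \<Longrightarrow> R i j \<or> R j i"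
    and trans: "\<And>i j k. i \<in> J \<Longrightarrow> j \<in> J \<Longrightarrow> k \<in> J \<Longrightarrow> R i j \<Longrightarrow> R j k \<Longrightarrow> R i k"
  shows "\<exists>i\<in>J. \<forall>j\<in>J. R i j"
  using assms
proof (induction J rule: finite_ne_induct)
  case (singleton x)
  show ?case using singleton.prems(1)[of x x] by simp
next
  case (insert x J)
  have "\<exists>i\<in>J. \<forall>j\<in>J. R i j"
  proof (rule insert.IH)
    show "R i j \<or> R j i" if "i \<in> J" "j \<in> J" for i j
      using insert.prems(1)[of i j] that by auto
    show "R i k" if "i \<in> J" "j \<in> J" "k \<in> J" "R i j" "R j k" for i j k
      using insert.prems(2)[of i j k] that by auto
  qed
  then obtain i where i: "i \<in> J" "\<forall>j\<in>J. R i j" by auto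
  have "R x x" using insert.prems(1)[of x x] by auto
  show ?case
  proof (cases "R i x")
    case True
    then show ?thesis using i by auto
  next
    case False
    then have "R x i" using insert.prems(1)[of x i] i by auto
    then have "R x j" if "j \<in> J" for j
      using insert.prems(2)[of x i j] i that by auto
    then show ?thesis using \<open>R x x\<close> by auto
  qed
qed

text \<open>Divisibility in a valuation ring is total, so among finitely many entries one of least
  valuation divides all others. Entries that vanish modulo \<open>F\<close> are set aside first,
  since they cannot serve as denominators.\<close>

lemma pivot:
  fixes a :: "nat \<Rightarrow> 'z \<Rightarrow> 'k"
  assumes "eventually (\<lambda>z. \<exists>i<n. a i z \<noteq> 0) F"
  shows "\<exists>i<n. eventually (\<lambda>z. a i z \<noteq> 0) F \<and> (\<forall>j<n. \<exists>c. (\<lambda>z. a j z / a i z, c) \<in> G)"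
proof -
  let ?J = "{i. i < n \<and> eventually (\<lambda>z. a i z \<noteq> 0) F}"
  have ne: "?J \<noteq> {}" using ultrafilter_finite_disj[OF ultra assms] by auto
  have fin: "finite ?J" by simp
  have "\<exists>i\<in>?J. \<forall>j\<in>?J. \<exists>c. (\<lambda>z. a j z / a i z, c) \<in> G"
  proof (rule finite_total_preorder_min[where R = "\<lambda>i j. \<exists>c. (\<lambda>z. a j z / a i z, c) \<in> G", OF fin ne])
    fix i j assume "i \<in> ?J" "j \<in> ?J"
    then have "eventually (\<lambda>z. a i z \<noteq> 0) F" "eventually (\<lambda>z. a j z \<noteq> 0) F" by auto
    then have "eventually (\<lambda>z. (a j z / a i z) * (a i z / a j z) = 1) F"
      by eventually_elim auto
    then show "(\<exists>c. (\<lambda>z. a j z / a i z, c) \<in> G) \<or> (\<exists>c. (\<lambda>z. a i z / a j z, c) \<in> G)"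
      by (rule valuation)
  next
    fix i j k assume "i \<in> ?J" "j \<in> ?J" "k \<in> ?J"
      "\<exists>c. (\<lambda>z. a j z / a i z, c) \<in> G" "\<exists>c. (\<lambda>z. a k z / a j z, c) \<in> G"
    then obtain c d where *: "eventually (\<lambda>z. a j z \<noteq> 0) F" "(\<lambda>z. a j z / a i z, c) \<in> G" "(\<lambda>z. a k z / a j z, d) \<in> G"
      by auto
    from *(1) have "eventually (\<lambda>z. (a j z / a i z) * (a k z / a j z) = a k z / a i z) F"
      by eventually_elim auto
    from cong[OF mult[OF *(2,3)] this] show "\<exists>c. (\<lambda>z. a k z / a i z, c) \<in> G" by blast
  qed
  then obtain i where i: "i < n" "eventually (\<lambda>z. a i z \<noteq> 0) F" "\<forall>j\<in>?J. \<exists>c. (\<lambda>z. a j z / a i z, c) \<in> G"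
    by auto
  have "\<exists>c. (\<lambda>z. a j z / a i z, c) \<in> G" if "j < n" for j
  proof (cases "j \<in> ?J")
    case False
    then have "eventually (\<lambda>z. a j z = 0) F"
      using ultra that by (auto simp: ultrafilter_def)
    then have "eventually (\<lambda>z. 0 = a j z / a i z) F" by eventually_elim auto
    then have "(\<lambda>z. a j z / a i z, 0) \<in> G" by (rule cong[OF const])
    then show ?thesis ..
  qed (use i in auto)
  with i show ?thesis by auto
qed

end

lemma place_exists:
  assumes "ultrafilter F" "pre_place F G0"
  shows "\<exists>G. G0 \<subseteq> G \<and> place F G"
proof -
  let ?A = "{G. pre_place F G \<and> G0 \<subseteq> G}"
  have "\<exists>M\<in>?A. \<forall>X\<in>?A. M \<subseteq> X \<longrightarrow> X = M"
  proof (rule subset_Zorn_nonempty)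
    show "?A \<noteq> {}" using assms by auto
    fix C assume C: "C \<noteq> {}" "subset.chain ?A C"
    have PP: "pre_place F X" if "X \<in> C" for X
      using C(2) that by (auto simp: subset.chain_def)
    have tot: "X \<subseteq> Y \<or> Y \<subseteq> X" if "X \<in> C" "Y \<in> C" for X Y
      using subset.chain_total[OF C(2) that] by blast
    have two: "\<exists>X\<in>C. p \<in> X \<and> q \<in> X" if "p \<in> \<Union>C" "q \<in> \<Union>C" for p q
    proof -
      from that obtain X Y where XY: "X \<in> C" "Y \<in> C" "p \<in> X" "q \<in> Y" by blast
      show ?thesis
      proof (cases "X \<subseteq> Y")
        case True
        then show ?thesis using XY by auto
      next
        case False
        then show ?thesis using tot[OF XY(1,2)] XY by auto
      qed
    qed
    have "pre_place F (\<Union>C)"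
    proof (unfold_locales, goal_cases)
      case (1 c)
      obtain X where "X \<in> C" using C(1) by auto
      then show ?case using pre_place.const[OF PP] by blast
    next
      case (2 f c g d)
      then obtain X where "X \<in> C" "(f, c) \<in> X" "(g, d) \<in> X"
        using two[of "(f, c)" "(g, d)"] by auto
      then show ?case using pre_place.add[OF PP] by blast
    next
      case (3 f c g d)
      then obtain X where "X \<in> C" "(f, c) \<in> X" "(g, d) \<in> X"
        using two[of "(f, c)" "(g, d)"] by auto
      then show ?case using pre_place.mult[OF PP] by blast
    next
      case (4 f c)
      then show ?case using pre_place.null[OF PP] by blast
    qed
    moreover have "G0 \<subseteq> \<Union>C"
    proof -
      obtain X where "X \<in> C" using C(1) by auto
      moreover have "G0 \<subseteq> X" using C(2) \<open>X \<in> C\<close> unfolding subset.chain_def by auto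
      ultimately show ?thesis by auto
    qed
    ultimately show "\<Union>C \<in> ?A" by auto
  qed
  then obtain M where M: "pre_place F M" "G0 \<subseteq> M" "\<And>X. pre_place F X \<Longrightarrow> G0 \<subseteq> X \<Longrightarrow> M \<subseteq> X \<Longrightarrow> X = M"
    by auto
  interpret pre_place F M by (rule M)
  have "place F M"
    using assms(1) M(2,3) by unfold_locales (auto)
  with M(2) show ?thesis by blast
qed

section \<open>Linear algebra of finitely supported sequences\<close>

text \<open>
  These rules also rewrite the eta-expanded form of \<open>f + g\<close> that the \<open>induction\<close> method
  produces, and so destroy sums of functions.
\<close>

declare plus_fun_apply [simp del] zero_fun_apply [simp del] minus_apply [simp del] uminus_apply [simp del]

lemmas fun_apply = plus_fun_apply zero_fun_apply minus_apply uminus_apply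

definition fscale :: "'k::field \<Rightarrow> (nat \<Rightarrow> 'k) \<Rightarrow> nat \<Rightarrow> 'k" where
  "fscale c f = (\<lambda>i. c * f i)"

lemma fscale_apply: "fscale c f i = c * f i"
  by (simp add: fscale_def)

interpretation fs: vector_space "fscale :: 'k::field \<Rightarrow> (nat \<Rightarrow> 'k) \<Rightarrow> nat \<Rightarrow> 'k"
  by unfold_locales (auto simp: fun_eq_iff algebra_simps fscale_apply fun_apply)

interpretation fsp: vector_space_pair "fscale :: 'k::field \<Rightarrow> (nat \<Rightarrow> 'k) \<Rightarrow> nat \<Rightarrow> 'k"
  "fscale :: 'k::field \<Rightarrow> (nat \<Rightarrow> 'k) \<Rightarrow> nat \<Rightarrow> 'k" ..

abbreviation flinear :: "((nat \<Rightarrow> 'k::field) \<Rightarrow> nat \<Rightarrow> 'k) \<Rightarrow> bool" where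
  "flinear \<equiv> Vector_Spaces.linear fscale fscale"

lemma sum_fun_apply: "(\<Sum>i\<in>A. f i) z = (\<Sum>i\<in>A. f i z)"
  by (induction A rule: infinite_finite_induct) (auto simp: fun_apply)

text \<open>The space K^n inside the space of all sequences: vector spaces of all dimensions then
  share one type and one notion of span.\<close>

definition cspace :: "nat \<Rightarrow> (nat \<Rightarrow> 'k::field) set" where
  "cspace n = {f. \<forall>i\<ge>n. f i = 0}"

definition unit_fun :: "nat \<Rightarrow> nat \<Rightarrow> 'k::field" where
  "unit_fun i = (\<lambda>j. if j = i then 1 else 0)"

text \<open>Comparing each vector with its predecessors includes injectivity and passes to initial
  segments, the form in which filtrations will occur.\<close>

definition indep_fam :: "nat \<Rightarrow> (nat \<Rightarrow> nat \<Rightarrow> 'k::field) \<Rightarrow> bool" where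
  "indep_fam m b \<longleftrightarrow> (\<forall>j<m. b j \<notin> fs.span (b ` {..<j}))"

definition frame :: "nat \<Rightarrow> (nat \<Rightarrow> nat \<Rightarrow> 'k::field) \<Rightarrow> bool" where
  "frame n b \<longleftrightarrow> indep_fam n b \<and> (\<forall>j<n. b j \<in> cspace n)"

lemma subspace_cspace: "fs.subspace (cspace n)"
  by (auto simp: fs.subspace_def cspace_def fscale_apply fun_apply)

lemma unit_fun_in_cspace: "i < n \<Longrightarrow> unit_fun i \<in> cspace n"
  by (auto simp: cspace_def unit_fun_def)

lemma cspace_expand: "f \<in> cspace n \<Longrightarrow> f = (\<Sum>i<n. fscale (f i) (unit_fun i))"
  by (auto simp: fun_eq_iff sum_fun_apply unit_fun_def cspace_def fscale_apply if_distrib cong: if_cong)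

lemma span_unit_fun: "fs.span (unit_fun ` {..<n}) = (cspace n :: (nat \<Rightarrow> 'k::field) set)"
proof
  show "fs.span (unit_fun ` {..<n}) \<subseteq> (cspace n :: (nat \<Rightarrow> 'k) set)"
    by (intro fs.span_minimal subspace_cspace) (auto intro: unit_fun_in_cspace)
  show "(cspace n :: (nat \<Rightarrow> 'k) set) \<subseteq> fs.span (unit_fun ` {..<n})"
  proof
    fix f :: "nat \<Rightarrow> 'k" assume "f \<in> cspace n"
    then have f: "f = (\<Sum>i<n. fscale (f i) (unit_fun i))" by (rule cspace_expand)
    show "f \<in> fs.span (unit_fun ` {..<n})"
      by (subst f, intro fs.span_sum fs.span_scale fs.span_base) auto
  qed
qed

lemma indep_fam_Suc: "indep_fam (Suc m) b \<longleftrightarrow> indep_fam m b \<and> b m \<notin> fs.span (b ` {..<m})"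
  unfolding indep_fam_def by (auto simp: less_Suc_eq)

lemma indep_fam_mono: "indep_fam n b \<Longrightarrow> m \<le> n \<Longrightarrow> indep_fam m b"
  unfolding indep_fam_def by auto

lemma indep_fam_cong: "indep_fam n b \<Longrightarrow> (\<And>j. j < n \<Longrightarrow> b' j = b j) \<Longrightarrow> indep_fam n b'"
  unfolding indep_fam_def by (metis (mono_tags, lifting) image_cong lessThan_iff order_less_trans)

lemma indep_fam_independent:
  assumes "indep_fam m b"
  shows "fs.independent (b ` {..<m}) \<and> inj_on b {..<m} \<and> fs.dim (fs.span (b ` {..<m})) = m"
proof -
  have "fs.independent (b ` {..<m}) \<and> card (b ` {..<m}) = m"
    using assms
  proof (induction m)
    case 0
    then show ?case by (simp add: fs.independent_empty)
  next
    case (Suc m)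
    then have IH: "fs.independent (b ` {..<m})" "card (b ` {..<m}) = m" "b m \<notin> fs.span (b ` {..<m})"
      by (auto simp: indep_fam_Suc)
    have "b m \<notin> b ` {..<m}" using IH(3) fs.span_superset[of "b ` {..<m}"] by (rule contra_subsetD[rotated])
    with IH show ?case
      by (simp add: lessThan_Suc fs.independent_insert)
  qed
  then show ?thesis
    by (auto simp: fs.dim_eq_card_independent eq_card_imp_inj_on)
qed

lemma indep_fam_coeffs:
  assumes "indep_fam m b" "(\<Sum>j<m. fscale (c j) (b j)) = 0" "j < m"
  shows "c j = 0"
  using assms
proof (induction m arbitrary: j)
  case (Suc m)
  have "c m = 0"
  proof (rule ccontr)
    assume nz: "c m \<noteq> 0"
    have "fscale (c m) (b m) = - (\<Sum>j<m. fscale (c j) (b j))"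
      using Suc.prems(2) unfolding sum.lessThan_Suc by (metis add.commute eq_neg_iff_add_eq_0)
    also have "\<dots> \<in> fs.span (b ` {..<m})"
      by (intro fs.span_neg fs.span_sum fs.span_scale fs.span_base) auto
    finally have "fscale (1 / c m) (fscale (c m) (b m)) \<in> fs.span (b ` {..<m})"
      by (rule fs.span_scale)
    with nz have "b m \<in> fs.span (b ` {..<m})" by simp
    with Suc.prems(1) show False by (simp add: indep_fam_Suc)
  qed
  moreover have "(\<Sum>j<m. fscale (c j) (b j)) = 0"
    using Suc.prems(2) \<open>c m = 0\<close> unfolding sum.lessThan_Suc
    by (metis add.right_neutral fs.scale_zero_left)
  ultimately show ?case
    using Suc.IH[of j] Suc.prems by (auto simp: indep_fam_Suc less_Suc_eq)
qed simp

lemma span_image_coeffs: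
  "v \<in> fs.span (b ` {..<m::nat}) \<Longrightarrow> \<exists>c. v = (\<Sum>j<m. fscale (c j) (b j))"
proof (induction m arbitrary: v)
  case (Suc m v)
  then obtain k where "v - fscale k (b m) \<in> fs.span (b ` {..<m})"
    unfolding lessThan_Suc image_insert fs.span_insert by blast
  then obtain c where c: "v - fscale k (b m) = (\<Sum>j<m. fscale (c j) (b j))" using Suc.IH by blast
  have "(\<Sum>j<m. fscale ((c(m := k)) j) (b j)) = (\<Sum>j<m. fscale (c j) (b j))"
    by (intro sum.cong) auto
  then have "v = (\<Sum>j<Suc m. fscale ((c(m := k)) j) (b j))"
    unfolding sum.lessThan_Suc c[symmetric] by simp
  then show ?case by blast
qed simp

lemma span_image_lessThan: "v \<in> fs.span (b ` {..<m::nat}) \<longleftrightarrow> (\<exists>c. v = (\<Sum>j<m. fscale (c j) (b j)))"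
proof
  assume "\<exists>c. v = (\<Sum>j<m. fscale (c j) (b j))"
  then obtain c where "v = (\<Sum>j<m. fscale (c j) (b j))" ..
  then show "v \<in> fs.span (b ` {..<m})"
    by (auto intro!: fs.span_sum intro: fs.span_scale[OF fs.span_base])
qed (rule span_image_coeffs)

lemma finite_independent_cspace:
  assumes "fs.independent B" "B \<subseteq> cspace n"
  shows "finite B" "card B \<le> n"
proof -
  have "B \<subseteq> fs.span (unit_fun ` {..<n})" using assms span_unit_fun by auto
  from fs.independent_span_bound[OF _ assms(1) this] show "finite B" "card B \<le> n"
    using card_image_le[of "{..<n}" unit_fun] by (auto intro: order_trans)
qed

lemma subspace_basis:
  assumes "fs.subspace W" "W \<subseteq> cspace n"
  obtains B where "finite B" "fs.independent B" "fs.span B = W" "card B = fs.dim W" "B \<subseteq> W"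
proof -
  obtain B where B: "B \<subseteq> W" "fs.independent B" "W \<subseteq> fs.span B" "card B = fs.dim W"
    using fs.basis_exists by blast
  moreover have "fs.span B = W" using B assms fs.span_minimal by blast
  moreover have "finite B" using finite_independent_cspace[OF B(2)] B(1) assms by blast
  ultimately show thesis using that by blast
qed

text \<open>The space of all sequences has infinite dimension; the bound by \<open>cspace n\<close>
  supplies the finite bases on which both claims rest.\<close>

lemma dim_cspace_le: 
  assumes "fs.subspace V" "V \<subseteq> W" "fs.subspace W" "W \<subseteq> cspace n"
  shows "fs.dim V \<le> fs.dim W" "fs.dim V = fs.dim W \<Longrightarrow> V = W"
proof -
  obtain B where B: "finite B" "fs.independent B" "fs.span B = V" "card B = fs.dim V" "B \<subseteq> V"
    using subspace_basis[of V n] assms by auto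
  obtain C where C: "finite C" "fs.independent C" "fs.span C = W" "card C = fs.dim W" "C \<subseteq> W"
    using subspace_basis[of W n] assms by auto
  have sub: "B \<subseteq> fs.span C" using B C assms by auto
  show "fs.dim V \<le> fs.dim W"
    using fs.independent_span_bound[OF C(1) B(2) sub] B C by simp
  assume eq: "fs.dim V = fs.dim W"
  show "V = W"
  proof (rule ccontr)
    assume "V \<noteq> W"
    then obtain w where w: "w \<in> W" "w \<notin> V" using assms by auto
    then have "fs.independent (insert w B)"
      using B by (simp add: fs.independent_insert)
    moreover have "insert w B \<subseteq> fs.span C" using w sub C by auto
    ultimately have "card (insert w B) \<le> card C"
      using fs.independent_span_bound[OF C(1)] by blast
    moreover have "w \<notin> B" using w B by auto
    ultimately show False using B C eq by simp
  qed
qed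

lemma indep_fam_unit_fun: "indep_fam n (unit_fun :: nat \<Rightarrow> nat \<Rightarrow> 'k::field)"
  unfolding indep_fam_def
proof (intro allI impI)
  fix j assume "j < n"
  have "unit_fun j j \<noteq> (0::'k)" by (simp add: unit_fun_def)
  then show "(unit_fun j :: nat \<Rightarrow> 'k) \<notin> fs.span (unit_fun ` {..<j})"
    unfolding span_unit_fun by (auto simp: cspace_def)
qed

lemma dim_cspace: "fs.dim (cspace n :: (nat \<Rightarrow> 'k::field) set) = n"
  using indep_fam_independent[OF indep_fam_unit_fun[where 'k = 'k, of n]] by (simp add: span_unit_fun)

lemma frame_span:
  fixes b :: "nat \<Rightarrow> nat \<Rightarrow> 'k::field"
  assumes "frame n b"
  shows "fs.span (b ` {..<n}) = cspace n"
proof (rule dim_cspace_le(2)[of _ _ n])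
  show "fs.span (b ` {..<n}) \<subseteq> cspace n"
    using assms by (intro fs.span_minimal subspace_cspace) (auto simp: frame_def)
  have "fs.dim (fs.span (b ` {..<n})) = n"
    using assms indep_fam_independent[of n b] unfolding frame_def by metis
  then show "fs.dim (fs.span (b ` {..<n})) = fs.dim (cspace n :: (nat \<Rightarrow> 'k) set)"
    by (simp only: dim_cspace)
qed (auto intro: subspace_cspace)

text \<open>New vectors are appended and the old ones keep their places. This lets one basis serve
  all members of a chain.\<close>

lemma extend_indep_fam:
  assumes "fs.subspace W" "W \<subseteq> cspace n" "indep_fam m b" "fs.span (b ` {..<m}) \<subseteq> W"
  shows "\<exists>b'. (\<forall>j<m. b' j = b j) \<and> indep_fam (fs.dim W) b' \<and> fs.span (b' ` {..<fs.dim W}) = W"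
  using assms(3,4)
proof (induction "fs.dim W - m" arbitrary: m b)
  case 0
  have "m = fs.dim (fs.span (b ` {..<m}))" using indep_fam_independent[OF 0(2)] by simp
  also have "\<dots> \<le> fs.dim W" by (rule dim_cspace_le(1)[OF fs.subspace_span 0(3) assms(1,2)])
  finally have "m = fs.dim W" using 0 by simp
  moreover have "fs.span (b ` {..<m}) = W"
    using dim_cspace_le(2)[OF fs.subspace_span 0(3) assms(1,2)]
      \<open>m = fs.dim (fs.span (b ` {..<m}))\<close> calculation by metis
  ultimately show ?case using 0 by (intro exI[of _ b]) auto
next
  case (Suc k)
  have "fs.dim (fs.span (b ` {..<m})) = m" using indep_fam_independent[OF Suc(3)] by simp
  then have "fs.span (b ` {..<m}) \<noteq> W" using Suc(2) by auto
  then obtain w where w: "w \<in> W" "w \<notin> fs.span (b ` {..<m})" using Suc(4) by blast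
  let ?b = "b(m := w)"
  have im: "?b ` {..<m} = b ` {..<m}" by (intro image_cong) auto
  have ind: "indep_fam (Suc m) ?b"
    using indep_fam_cong[OF Suc(3), of ?b] w im by (auto simp: indep_fam_Suc)
  have "?b ` {..<Suc m} \<subseteq> W"
    using w Suc(4) fs.span_superset[of "b ` {..<m}"] by (auto simp: lessThan_Suc)
  then have "fs.span (?b ` {..<Suc m}) \<subseteq> W" using assms(1) by (rule fs.span_minimal)
  then have "\<exists>b'. (\<forall>j<Suc m. b' j = ?b j) \<and> indep_fam (fs.dim W) b' \<and> fs.span (b' ` {..<fs.dim W}) = W"
    using Suc(2) by (intro Suc(1) ind) auto
  then obtain b' where "\<forall>j<Suc m. b' j = ?b j" "indep_fam (fs.dim W) b'" "fs.span (b' ` {..<fs.dim W}) = W"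
    by blast
  then show ?case by (intro exI[of _ b'] conjI allI impI) simp_all
qed

text \<open>Smaller indices of an adapted basis lie deeper in the chain.\<close>

lemma adapted_basis:
  fixes W :: "nat \<Rightarrow> (nat \<Rightarrow> 'k::field) set"
  assumes sub: "\<And>l. l \<le> M \<Longrightarrow> fs.subspace (W l)" "W 0 = cspace n"
    and dec: "\<And>l. l < M \<Longrightarrow> W (Suc l) \<subseteq> W l"
  shows "\<exists>b. frame n b \<and> (\<forall>l\<le>M. fs.span (b ` {..<fs.dim (W l)}) = W l)"
proof -
  have anti: "W l' \<subseteq> W l" if "l \<le> l'" "l' \<le> M" for l l'
    using that
  proof (induction rule: dec_induct)
    case (step i)
    then show ?case using dec[of i] by auto
  qed auto
  \<comment> \<open>The induction climbs from the deepest member \<open>W M\<close> outwards,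
    because an extension appends vectors to the basis of a smaller space.\<close>
  have "k \<le> M \<Longrightarrow> \<exists>b. indep_fam (fs.dim (W (M - k))) b \<and>
      (\<forall>l\<le>M. M - k \<le> l \<longrightarrow> fs.span (b ` {..<fs.dim (W l)}) = W l)" for k
  proof (induction k)
    case 0
    have "W M \<subseteq> cspace n" using anti[of 0 M] sub by simp
    moreover have "indep_fam 0 (\<lambda>_. 0 :: nat \<Rightarrow> 'k)" by (simp add: indep_fam_def)
    moreover have "fs.span ((\<lambda>_. 0) ` {..<0::nat}) \<subseteq> W M"
      using fs.subspace_0[OF sub(1)[of M]] by simp
    ultimately obtain b where "indep_fam (fs.dim (W M)) b" "fs.span (b ` {..<fs.dim (W M)}) = W M"
      using extend_indep_fam[OF sub(1)[of M], of n 0 "\<lambda>_. 0"] by auto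
    then show ?case by (intro exI[of _ b]) auto
  next
    case (Suc k)
    then obtain b where b: "indep_fam (fs.dim (W (M - k))) b"
      "\<And>l. l \<le> M \<Longrightarrow> M - k \<le> l \<Longrightarrow> fs.span (b ` {..<fs.dim (W l)}) = W l" by auto
    let ?l = "M - Suc k"
    have l: "Suc ?l = M - k" "?l \<le> M" using Suc.prems by auto
    have Wn: "W l \<subseteq> cspace n" if "l \<le> M" for l using anti[of 0 l] sub that by simp
    from extend_indep_fam[OF sub(1)[OF l(2)] Wn[OF l(2)] b(1)] b(2)[of "M - k"] anti[of ?l "M - k"]
    obtain b' where b': "\<forall>j<fs.dim (W (M - k)). b' j = b j" "indep_fam (fs.dim (W ?l)) b'"
      "fs.span (b' ` {..<fs.dim (W ?l)}) = W ?l" using l by auto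
    have "fs.span (b' ` {..<fs.dim (W l)}) = W l" if "l \<le> M" "?l \<le> l" for l
    proof (cases "l = ?l")
      case False
      then have l2: "M - k \<le> l" using that by linarith
      then have "fs.dim (W l) \<le> fs.dim (W (M - k))"
        using dim_cspace_le(1)[OF sub(1) anti sub(1) Wn, of l "M - k"] that by auto
      then have "b' ` {..<fs.dim (W l)} = b ` {..<fs.dim (W l)}"
        using b'(1) by (intro image_cong) auto
      then show ?thesis using b(2)[OF that(1) l2] by simp
    qed (use b' in simp)
    with b' show ?case by (intro exI[of _ b']) auto
  qed
  from this[of M] obtain b where b: "indep_fam n b" "\<And>l. l \<le> M \<Longrightarrow> fs.span (b ` {..<fs.dim (W l)}) = W l"
    using sub(2) by (auto simp: dim_cspace)
  moreover have "b j \<in> cspace n" if "j < n" for j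
    using b(2)[of 0] sub(2) that fs.span_base[of "b j" "b ` {..<n}"] by (auto simp: dim_cspace)
  ultimately show ?thesis by (auto simp: frame_def)
qed

lemma mat_mult_vec_columns:
  assumes "i < n"
  shows "(mat n m (\<lambda>(i, j). b j i) *\<^sub>v vec m c) $ i = (\<Sum>j<m. fscale (c j) (b j)) i"
  using assms by (simp add: scalar_prod_def sum_fun_apply fscale_apply mult.commute lessThan_atLeast0)

text \<open>Turns independence into the nonvanishing of a polynomial in the entries, the form in
  which it persists along a curve.\<close>

lemma det_columns:
  assumes "\<And>j. j < r \<Longrightarrow> b j \<in> cspace r"
  shows "det (mat r r (\<lambda>(i, j). b j i)) \<noteq> (0::'k::field) \<longleftrightarrow> indep_fam r b"
proof -
  let ?A = "mat r r (\<lambda>(i, j). b j i)"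
  have A: "?A \<in> carrier_mat r r" by simp
  have zero: "?A *\<^sub>v vec r c = 0\<^sub>v r \<longleftrightarrow> (\<Sum>j<r. fscale (c j) (b j)) = 0" for c
  proof
    assume *: "?A *\<^sub>v vec r c = 0\<^sub>v r"
    show "(\<Sum>j<r. fscale (c j) (b j)) = 0"
    proof
      fix i
      show "(\<Sum>j<r. fscale (c j) (b j)) i = 0 i"
      proof (cases "i < r")
        case True
        then show ?thesis using mat_mult_vec_columns[OF True, of r b c] * by (simp add: fun_apply)
      next
        case False
        then show ?thesis using assms by (auto simp: sum_fun_apply cspace_def fscale_apply fun_apply intro!: sum.neutral)
      qed
    qed
  next
    assume *: "(\<Sum>j<r. fscale (c j) (b j)) = 0"
    show "?A *\<^sub>v vec r c = 0\<^sub>v r"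
      using mat_mult_vec_columns[of _ r r b c] * by (intro eq_vecI) (auto simp: fun_apply)
  qed
  have vec: "\<exists>c. v = vec r c" if "v \<in> carrier_vec r" for v :: "'k vec"
    using that by (intro exI[of _ "\<lambda>i. v $ i"]) auto
  show ?thesis
  proof
    assume det: "det ?A \<noteq> 0"
    have "indep_fam m b" if "m \<le> r" for m
      using that
    proof (induction m)
      case (Suc m)
      have "b m \<notin> fs.span (b ` {..<m})"
      proof
        assume "b m \<in> fs.span (b ` {..<m})"
        then obtain c where c: "b m = (\<Sum>j<m. fscale (c j) (b j))"
          using span_image_lessThan by blast
        \<comment> \<open>The dependency of \<open>b m\<close> on its predecessors as a null vector
          of the matrix; the entry -1 makes it nonzero.\<close>
        let ?c = "\<lambda>j. if j < m then c j else if j = m then -1 else 0"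
        have "(\<Sum>j<r. fscale (?c j) (b j)) = (\<Sum>j<Suc m. fscale (?c j) (b j))"
          using Suc.prems by (intro sum.mono_neutral_right) auto
        also have "\<dots> = 0" unfolding sum.lessThan_Suc by (simp add: c[symmetric])
        finally have "?A *\<^sub>v vec r ?c = 0\<^sub>v r" using zero by blast
        moreover have "vec r ?c \<noteq> 0\<^sub>v r"
        proof
          assume "vec r ?c = 0\<^sub>v r"
          then have "vec r ?c $ m = 0\<^sub>v r $ m" by simp
          then show False using Suc.prems by simp
        qed
        ultimately show False using det det_0_iff_vec_prod_zero_field[OF A] by (metis vec_carrier)
      qed
      with Suc show ?case by (simp add: indep_fam_Suc)
    qed (simp add: indep_fam_def)
    then show "indep_fam r b" by simp
  next
    assume ind: "indep_fam r b"
    show "det ?A \<noteq> 0"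
    proof
      assume "det ?A = 0"
      then obtain v where v: "v \<in> carrier_vec r" "v \<noteq> 0\<^sub>v r" "?A *\<^sub>v v = 0\<^sub>v r"
        using det_0_iff_vec_prod_zero_field[OF A] by auto
      obtain c where c: "v = vec r c" using vec[OF v(1)] by blast
      then have "\<forall>j<r. c j = 0" using v(3) zero indep_fam_coeffs[OF ind] by blast
      then have "v = 0\<^sub>v r" by (intro eq_vecI) (auto simp: c)
      with v show False by simp
    qed
  qed
qed

text \<open>A greedy choice: as long as fewer than \<open>r\<close> vectors are chosen, the
  dimension of their span is too small for it to contain \<open>X\<close>. This later picks the
  columns of a nonvanishing minor.\<close>

lemma spanning_set_selection:
  assumes "fs.span X = cspace r"
  shows "\<exists>b. (\<forall>j<r. b j \<in> X) \<and> indep_fam r b"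
proof -
  have "\<exists>b. (\<forall>j<m. b j \<in> X) \<and> indep_fam m b" if "m \<le> r" for m
    using that
  proof (induction m)
    case (Suc m)
    then obtain b where b: "\<forall>j<m. b j \<in> X" "indep_fam m b" by auto
    have "\<not> X \<subseteq> fs.span (b ` {..<m})"
    proof
      assume "X \<subseteq> fs.span (b ` {..<m})"
      then have "cspace r \<subseteq> fs.span (b ` {..<m})"
        using fs.span_minimal[of X "fs.span (b ` {..<m})"] assms by auto
      moreover have "fs.span (b ` {..<m}) \<subseteq> cspace r"
        using b(1) unfolding assms[symmetric] by (intro fs.span_mono) auto
      ultimately have "fs.span (b ` {..<m}) = cspace r" by blast
      with indep_fam_independent[OF b(2)] have "fs.dim (cspace r :: (nat \<Rightarrow> 'a) set) = m"
        by metis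
      with dim_cspace[of r, where 'k = 'a] Suc.prems show False by simp
    qed
    then obtain x where x: "x \<in> X" "x \<notin> fs.span (b ` {..<m})" by blast
    let ?b = "b(m := x)"
    have im: "?b ` {..<m} = b ` {..<m}" by (intro image_cong) auto
    have "indep_fam (Suc m) ?b"
      using indep_fam_cong[OF b(2), of ?b] x im by (auto simp: indep_fam_Suc)
    moreover have "\<forall>j<Suc m. ?b j \<in> X" using b x by (auto simp: less_Suc_eq)
    ultimately show ?case by blast
  qed (simp add: indep_fam_def)
  then show ?thesis by simp
qed

lemma frame_coeffs:
  assumes "frame n b" "v \<in> cspace n"
  shows "\<exists>c. v = (\<Sum>j<n. fscale (c j) (b j))"
  using assms frame_span span_image_lessThan by blast

lemma coeffs_in_initial_span:
  assumes "frame n b" "(\<Sum>j<n. fscale (c j) (b j)) \<in> fs.span (b ` {..<m})" "m \<le> n" "m \<le> j" "j < n"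
  shows "c j = 0"
proof -
  obtain c' where c': "(\<Sum>j<n. fscale (c j) (b j)) = (\<Sum>j<m. fscale (c' j) (b j))"
    using assms(2) span_image_lessThan by blast
  let ?c = "\<lambda>j. if j < m then c' j else 0"
  have "(\<Sum>j<m. fscale (c' j) (b j)) = (\<Sum>j<n. fscale (?c j) (b j))"
    using assms(3) by (intro sum.mono_neutral_cong_left) (auto simp: fun_eq_iff)
  with c' have "(\<Sum>j<n. fscale (c j - ?c j) (b j)) = 0"
    by (simp add: fs.scale_left_diff_distrib sum_subtractf)
  then have "c j - ?c j = 0"
    using indep_fam_coeffs[of n b "\<lambda>j. c j - ?c j" j] assms by (simp add: frame_def)
  then show ?thesis using assms(4) by simp
qed

section \<open>The truncated path algebra\<close>

locale quiver = fin_digraph Q for Q :: "('v, 'a) pre_digraph"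
begin

section \<open>The path algebra as a ring, and its ideals of long paths\<close>

abbreviation KQ :: "(('v, 'a) path \<Rightarrow> 'k::field) ring" where
  "KQ \<equiv> path_algebra Q"

lemma KQ_simps:
  "f \<in> carrier KQ \<longleftrightarrow> finite {p. f p \<noteq> 0} \<and> {p. f p \<noteq> 0} \<subseteq> paths Q"
  "mult KQ f g (u, p) = (\<Sum>k\<le>length p. f (awlast u (take k p), drop k p) * g (u, take k p))"
  "\<one>\<^bsub>KQ\<^esub> = (\<lambda>(u, p). if u \<in> verts Q \<and> p = [] then 1 else 0)"
  "\<zero>\<^bsub>KQ\<^esub> = (\<lambda>p. 0)"
  "f \<oplus>\<^bsub>KQ\<^esub> g = (\<lambda>p. f p + g p)"
  by (auto simp: path_algebra_def)

lemma paths_iff: "(u, p) \<in> paths Q \<longleftrightarrow> awalk u p (awlast u p)"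
  by (auto simp: paths_def)

lemma paths_append: "(u, p @ q) \<in> paths Q \<longleftrightarrow> (u, p) \<in> paths Q \<and> (awlast u p, q) \<in> paths Q"
  by (simp add: paths_iff awlast_append)

lemma paths_Nil: "(u, []) \<in> paths Q \<longleftrightarrow> u \<in> verts Q"
  by (simp add: paths_iff awalk_Nil_iff)

lemma paths_take_drop:
  "(u, p) \<in> paths Q \<Longrightarrow> (u, take k p) \<in> paths Q \<and> (awlast u (take k p), drop k p) \<in> paths Q"
  using paths_append[of u "take k p" "drop k p"] by simp

definition single :: "'k::field \<Rightarrow> ('v, 'a) path \<Rightarrow> ('v, 'a) path \<Rightarrow> 'k" where
  "single c q = (\<lambda>x. if x = q then c else 0)"

lemma single_carrier: "q \<in> paths Q \<Longrightarrow> single c q \<in> carrier KQ"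
proof -
  assume "q \<in> paths Q"
  moreover have "{x. single c q x \<noteq> 0} \<subseteq> {q}" by (auto simp: single_def)
  ultimately show ?thesis by (auto simp: KQ_simps intro: finite_subset)
qed

lemma mult_support:
  assumes "mult KQ f g (u, p) \<noteq> 0"
  shows "\<exists>q r. p = q @ r \<and> f (awlast u q, r) \<noteq> 0 \<and> g (u, q) \<noteq> 0"
proof -
  obtain k where "f (awlast u (take k p), drop k p) * g (u, take k p) \<noteq> 0"
    using assms unfolding KQ_simps by (meson sum.neutral)
  then show ?thesis by (intro exI[of _ "take k p"] exI[of _ "drop k p"]) auto
qed

lemma mult_carrier:
  assumes f: "f \<in> carrier KQ" and g: "g \<in> carrier KQ"
  shows "mult KQ f g \<in> carrier KQ"
proof -
  let ?S = "(\<lambda>((w, r), (u, q)). (u, q @ r)) ` ({p. f p \<noteq> 0} \<times> {p. g p \<noteq> 0})"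
  have "{p. mult KQ f g p \<noteq> 0} \<subseteq> ?S"
  proof (clarify)
    fix u p assume "mult KQ f g (u, p) \<noteq> 0"
    then obtain q r where "p = q @ r" "f (awlast u q, r) \<noteq> 0" "g (u, q) \<noteq> 0"
      using mult_support by blast
    then show "(u, p) \<in> ?S"
      by (intro image_eqI[of _ _ "((awlast u q, r), (u, q))"]) auto
  qed
  moreover have "finite ?S" using f g by (auto simp: KQ_simps)
  moreover have "(u, p) \<in> paths Q" if nz: "mult KQ f g (u, p) \<noteq> 0" for u p
  proof -
    from mult_support[OF nz] obtain q r where "p = q @ r" "f (awlast u q, r) \<noteq> 0" "g (u, q) \<noteq> 0" by blast
    then show ?thesis using f g by (auto simp: KQ_simps paths_append)
  qed
  ultimately show ?thesis
    unfolding KQ_simps(1) using finite_subset by auto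
qed

text \<open>Both products sum over the ways to cut a path into three consecutive pieces.\<close>

lemma mult_assoc: "mult KQ (mult KQ f g) h = mult KQ f (mult KQ g h)"
proof
  fix x :: "('v, 'a) path"
  obtain u p where x: "x = (u, p)" by (cases x)
  let ?n = "length p"
  \<comment> \<open>\<open>k\<close> and \<open>j\<close> are the lengths of the first and the
    second piece.\<close>
  let ?F = "\<lambda>k j. f (awlast u (take (k + j) p), drop (j + k) p) *
      g (awlast u (take k p), take j (drop k p)) * h (u, take k p)"
  have "mult KQ (mult KQ f g) h (u, p) = (\<Sum>k\<le>?n. \<Sum>j\<le>?n - k. ?F k j)"
    unfolding KQ_simps
  proof (rule sum.cong[OF refl])
    fix k assume "k \<in> {..?n}"
    then show "(\<Sum>j\<le>length (drop k p). f (awlast (awlast u (take k p)) (take j (drop k p)), drop j (drop k p)) *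
        g (awlast u (take k p), take j (drop k p))) * h (u, take k p) = (\<Sum>j\<le>?n - k. ?F k j)"
      by (simp add: sum_distrib_right awlast_append[symmetric] take_add)
  qed
  also have "\<dots> = (\<Sum>(k, j)\<in>{(k, j). k + j \<le> ?n}. ?F k j)"
    by (subst sum.Sigma) (auto intro!: sum.cong)
  also have "\<dots> = (\<Sum>m\<le>?n. \<Sum>k\<le>m. ?F k (m - k))"
    by (rule sum.triangle_reindex_eq)
  also have "\<dots> = mult KQ f (mult KQ g h) (u, p)"
    unfolding KQ_simps
  proof (rule sum.cong[OF refl])
    fix m assume m: "m \<in> {..?n}"
    have "(\<Sum>k\<le>m. ?F k (m - k)) = (\<Sum>k\<le>m. f (awlast u (take m p), drop m p) *
       (g (awlast u (take k (take m p)), drop k (take m p)) * h (u, take k (take m p))))"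
      by (intro sum.cong) (auto simp: drop_take min_absorb1 mult.assoc)
    then show "(\<Sum>k\<le>m. ?F k (m - k)) = f (awlast u (take m p), drop m p) *
       (\<Sum>k\<le>length (take m p). g (awlast u (take k (take m p)), drop k (take m p)) * h (u, take k (take m p)))"
      using m by (simp add: sum_distrib_left)
  qed
  finally show "mult KQ (mult KQ f g) h x = mult KQ f (mult KQ g h) x" using x by simp
qed

lemma one_carrier: "\<one>\<^bsub>KQ\<^esub> \<in> carrier (KQ :: (('v, 'a) path \<Rightarrow> 'k::field) ring)"
proof -
  have "{p. \<one>\<^bsub>KQ\<^esub> p \<noteq> (0::'k)} \<subseteq> (\<lambda>u. (u, [])) ` verts Q"
    by (auto simp: KQ_simps split: if_splits)
  moreover have "(\<lambda>u. (u, [])) ` verts Q \<subseteq> paths Q" by (auto simp: paths_Nil)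
  ultimately show ?thesis
    unfolding KQ_simps(1) by (meson finite_imageI finite_subset finite_verts order_trans)
qed

lemma one_mult:
  assumes "f \<in> carrier KQ"
  shows "mult KQ \<one>\<^bsub>KQ\<^esub> f = f"
proof
  fix x :: "('v, 'a) path"
  obtain u p where x: "x = (u, p)" by (cases x)
  have "mult KQ \<one>\<^bsub>KQ\<^esub> f (u, p) = (\<Sum>k\<in>{length p}. \<one>\<^bsub>KQ\<^esub> (awlast u (take k p), drop k p) * f (u, take k p))"
    unfolding KQ_simps(2) by (rule sum.mono_neutral_right) (auto simp: KQ_simps)
  also have "\<dots> = f (u, p)"
  proof (cases "f (u, p) = 0")
    case False
    then have "(u, p) \<in> paths Q" using assms by (auto simp: KQ_simps)
    then have "awlast u p \<in> verts Q" unfolding paths_iff by (rule awalk_last_in_verts)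
    then show ?thesis by (simp add: KQ_simps)
  qed simp
  finally show "mult KQ \<one>\<^bsub>KQ\<^esub> f x = f x" using x by simp
qed

lemma mult_one:
  assumes "f \<in> carrier KQ"
  shows "mult KQ f \<one>\<^bsub>KQ\<^esub> = f"
proof
  fix x :: "('v, 'a) path"
  obtain u p where x: "x = (u, p)" by (cases x)
  have "mult KQ f \<one>\<^bsub>KQ\<^esub> (u, p) = (\<Sum>k\<in>{0}. f (awlast u (take k p), drop k p) * \<one>\<^bsub>KQ\<^esub> (u, take k p))"
    unfolding KQ_simps(2) by (rule sum.mono_neutral_right) (auto simp: KQ_simps)
  also have "\<dots> = f (u, p)"
  proof (cases "f (u, p) = 0")
    case False
    then have "(u, p) \<in> paths Q" using assms by (auto simp: KQ_simps)
    then have "u \<in> verts Q" unfolding paths_iff by (rule awalk_hd_in_verts)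
    then show ?thesis by (simp add: KQ_simps)
  qed simp
  finally show "mult KQ f \<one>\<^bsub>KQ\<^esub> x = f x" using x by simp
qed

lemma add_carrier:
  assumes "f \<in> carrier KQ" "g \<in> carrier KQ"
  shows "(\<lambda>p. f p + g p) \<in> carrier KQ"
proof -
  have "{p. f p + g p \<noteq> 0} \<subseteq> {p. f p \<noteq> 0} \<union> {p. g p \<noteq> 0}" by auto
  with assms show ?thesis
    unfolding KQ_simps(1) by (meson finite_UnI finite_subset le_supI order_trans)
qed

lemma scale_carrier:
  assumes "f \<in> carrier KQ"
  shows "(\<lambda>p. c * f p) \<in> carrier KQ"
proof -
  have "{p. c * f p \<noteq> 0} \<subseteq> {p. f p \<noteq> 0}" by auto
  with assms show ?thesis
    unfolding KQ_simps(1) by (meson finite_subset order_trans)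
qed

lemma ring_KQ: "ring (KQ :: (('v, 'a) path \<Rightarrow> 'k::field) ring)"
proof (rule ringI)
  show "abelian_group (KQ :: (('v, 'a) path \<Rightarrow> 'k) ring)"
  proof (rule abelian_groupI, goal_cases)
    case (6 f)
    have "(\<lambda>p. (- 1) * f p) \<in> carrier KQ" using scale_carrier[OF 6] .
    then show ?case by (rule bexI[rotated]) (simp add: KQ_simps)
  qed (auto simp: KQ_simps(4,5) add_carrier add.assoc add.commute, auto simp: KQ_simps)
  show "monoid (KQ :: (('v, 'a) path \<Rightarrow> 'k) ring)"
    by (rule monoidI) (auto simp: mult_carrier mult_assoc one_carrier one_mult mult_one)
qed (auto simp: fun_eq_iff KQ_simps(2,5) sum.distrib algebra_simps)

end

sublocale quiver \<subseteq> KQ: ring "path_algebra Q :: (('v, 'a) path \<Rightarrow> 'k::field) ring"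
  by (rule ring_KQ)

context quiver
begin

lemma KQ_minus: 
  assumes "f \<in> carrier (KQ :: (('v, 'a) path \<Rightarrow> 'k::field) ring)"
  shows "\<ominus>\<^bsub>KQ\<^esub> f = (\<lambda>p. - f p)"
proof (rule KQ.minus_equality)
  show "(\<lambda>p. - f p) \<oplus>\<^bsub>KQ\<^esub> f = \<zero>\<^bsub>KQ\<^esub>" by (simp add: KQ_simps)
  show "(\<lambda>p. - f p) \<in> carrier KQ" using scale_carrier[OF assms, of "-1"] by simp
qed (rule assms)

lemma single_mult_single:
  assumes "awlast u q = w"
  shows "mult KQ (single c (w, r)) (single c' (u, q)) = single (c * c') (u, q @ r)"
proof
  fix x :: "('v, 'a) path"
  obtain u' p where x: "x = (u', p)" by (cases x)
  have "mult KQ (single c (w, r)) (single c' (u, q)) (u', p) =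
      (\<Sum>k\<le>length p. if u' = u \<and> k = length q \<and> p = q @ r then c * c' else 0)"
    unfolding KQ_simps
  proof (rule sum.cong[OF refl])
    fix k assume k: "k \<in> {..length p}"
    have "take k p = q \<and> drop k p = r \<longleftrightarrow> k = length q \<and> p = q @ r"
      using k append_take_drop_id[of k p] by (auto simp: min_absorb2)
    then show "single c (w, r) (awlast u' (take k p), drop k p) * single c' (u, q) (u', take k p) =
        (if u' = u \<and> k = length q \<and> p = q @ r then c * c' else 0)"
      using assms by (auto simp: single_def)
  qed
  also have "\<dots> = single (c * c') (u, q @ r) (u', p)"
    by (auto simp: single_def if_distrib cong: if_cong)
  finally show "mult KQ (single c (w, r)) (single c' (u, q)) x = single (c * c') (u, q @ r) x"
    using x by simp
qed

lemma support_induct: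
  fixes f :: "('v, 'a) path \<Rightarrow> 'k::field"
  assumes "f \<in> carrier KQ"
    and zero: "P (\<lambda>_. 0)"
    and single: "\<And>q. f q \<noteq> 0 \<Longrightarrow> q \<in> paths Q \<Longrightarrow> P (single (f q) q)"
    and add: "\<And>g h. g \<in> carrier KQ \<Longrightarrow> h \<in> carrier KQ \<Longrightarrow> P g \<Longrightarrow> P h \<Longrightarrow> P (\<lambda>p. g p + h p)"
  shows "P f"
proof -
  let ?S = "{p. f p \<noteq> 0}"
  have S: "finite ?S" "?S \<subseteq> paths Q" using assms(1) by (auto simp: KQ_simps)
  have "(\<lambda>p. if p \<in> A then f p else 0) \<in> carrier KQ \<and> P (\<lambda>p. if p \<in> A then f p else 0)"
    if "finite A" "A \<subseteq> ?S" for A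
    using that
  proof (induction A rule: finite_induct)
    case empty
    then show ?case using zero KQ.zero_closed by (simp add: KQ_simps(4))
  next
    case (insert q A)
    have eq: "(\<lambda>p. if p \<in> insert q A then f p else 0) =
        (\<lambda>p. single (f q) q p + (if p \<in> A then f p else 0))"
      using insert.hyps by (auto simp: single_def fun_eq_iff)
    have "q \<in> paths Q" "f q \<noteq> 0" using insert.prems S by auto
    then show ?case
      unfolding eq using insert.IH insert.prems single[of q]
        add[OF single_carrier[of q "f q"], of "\<lambda>p. if p \<in> A then f p else 0"]
        add_carrier[OF single_carrier[of q "f q"], of "\<lambda>p. if p \<in> A then f p else 0"]
      by auto
  qed
  from this[OF S(1)] have "P (\<lambda>p. if p \<in> ?S then f p else 0)" by simp
  moreover have "(\<lambda>p. if p \<in> ?S then f p else 0) = f" by auto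
  ultimately show ?thesis by simp
qed

text \<open>The power of the arrow ideal with exponent \<open>l\<close>, described by supports
  instead of generators.\<close>

definition long_ideal :: "nat \<Rightarrow> (('v, 'a) path \<Rightarrow> 'k::field) set" where
  "long_ideal l = {f \<in> carrier KQ. \<forall>u p. f (u, p) \<noteq> 0 \<longrightarrow> l \<le> length p}"

lemma long_ideal_mult:
  assumes "f \<in> long_ideal l" "g \<in> long_ideal m"
  shows "mult KQ f g \<in> long_ideal (l + m)"
  unfolding long_ideal_def
proof (intro CollectI conjI allI impI)
  show "mult KQ f g \<in> carrier KQ" using assms by (intro mult_carrier) (auto simp: long_ideal_def)
  fix u p assume "mult KQ f g (u, p) \<noteq> 0"
  then obtain q r where "p = q @ r" "f (awlast u q, r) \<noteq> 0" "g (u, q) \<noteq> 0"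
    using mult_support by blast
  then have "l \<le> length r" "m \<le> length q" using assms by (auto simp: long_ideal_def)
  then show "l + m \<le> length p" using \<open>p = q @ r\<close> by simp
qed

lemma long_ideal_0: "long_ideal 0 = carrier KQ"
  by (auto simp: long_ideal_def)

lemma long_ideal_scale: "f \<in> long_ideal l \<Longrightarrow> (\<lambda>p. c * f p) \<in> long_ideal l"
  unfolding long_ideal_def by (auto intro: scale_carrier)

lemma long_ideal_add: "f \<in> long_ideal l \<Longrightarrow> g \<in> long_ideal l \<Longrightarrow> (\<lambda>p. f p + g p) \<in> long_ideal l"
  unfolding long_ideal_def by (auto intro: add_carrier) (metis add.right_neutral)

lemma zero_long_ideal: "(\<lambda>_. 0) \<in> long_ideal l"
  using KQ.zero_closed by (simp add: long_ideal_def KQ_simps(4))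

lemma ideal_long_ideal: "ideal (long_ideal l :: (('v, 'a) path \<Rightarrow> 'k::field) set) KQ"
proof (rule idealI[OF ring_KQ])
  show "subgroup (long_ideal l :: (('v, 'a) path \<Rightarrow> 'k) set) (add_monoid KQ)"
  proof (rule group.subgroupI, goal_cases)
    case 1
    then show ?case by (rule KQ.a_group)
  next
    case 2
    then show ?case by (auto simp: long_ideal_def)
  next
    case 3
    then show ?case using zero_long_ideal by blast
  next
    case (4 f)
    then have f: "f \<in> carrier KQ" by (auto simp: long_ideal_def)
    have "(\<lambda>p. - f p) \<in> long_ideal l"
      using 4 scale_carrier[OF f, of "-1"] by (auto simp: long_ideal_def)
    then show ?case using KQ_minus[OF f] by (simp add: a_inv_def)
  next
    case (5 f g)
    then show ?case using long_ideal_add[of f l g] by (simp add: KQ_simps(5))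
  qed
next
  fix f g :: "('v, 'a) path \<Rightarrow> 'k"
  assume f: "f \<in> long_ideal l" and g: "g \<in> carrier KQ"
  then have g0: "g \<in> long_ideal 0" by (simp add: long_ideal_0)
  show "mult KQ g f \<in> long_ideal l" using long_ideal_mult[OF g0 f] by simp
  show "mult KQ f g \<in> long_ideal l" using long_ideal_mult[OF f g0] by simp
qed

text \<open>A path of length at least \<open>m\<close> is a left multiple of its initial segment of
  length \<open>m\<close>, so the paths of length exactly \<open>m\<close> generate all longer
  ones.\<close>

lemma genideal_eq:
  "genideal KQ {path_element (u, p) | u p. (u, p) \<in> paths Q \<and> length p = m} =
     (long_ideal m :: (('v, 'a) path \<Rightarrow> 'k::field) set)"
proof
  let ?S = "{path_element (u, p) :: ('v, 'a) path \<Rightarrow> 'k | u p. (u, p) \<in> paths Q \<and> length p = m}"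
  have pe: "path_element q = (single 1 q :: ('v, 'a) path \<Rightarrow> 'k)" for q
    by (simp add: path_element_def single_def)
  have S: "?S \<subseteq> long_ideal m"
    by (auto simp: pe long_ideal_def single_carrier) (auto simp: single_def split: if_splits)
  then show "genideal KQ ?S \<subseteq> long_ideal m"
    by (intro KQ.genideal_minimal ideal_long_ideal)
  have SC: "?S \<subseteq> carrier KQ" using S by (auto simp: long_ideal_def)
  interpret I: ideal "genideal KQ ?S" KQ by (rule KQ.genideal_ideal[OF SC])
  show "long_ideal m \<subseteq> genideal KQ ?S"
  proof
    fix f :: "('v, 'a) path \<Rightarrow> 'k" assume f: "f \<in> long_ideal m"
    then have "f \<in> carrier KQ" by (auto simp: long_ideal_def)
    then show "f \<in> genideal KQ ?S"
    proof (rule support_induct)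
      show "(\<lambda>_. 0) \<in> genideal KQ ?S" using I.zero_closed by (simp add: KQ_simps)
      show "(\<lambda>p. g p + h p) \<in> genideal KQ ?S" if "g \<in> genideal KQ ?S" "h \<in> genideal KQ ?S" for g h
        using I.a_closed[OF that] by (simp add: KQ_simps)
      fix q :: "('v, 'a) path" assume q: "f q \<noteq> 0" "q \<in> paths Q"
      obtain u p where up: "q = (u, p)" by (cases q)
      have len: "m \<le> length p" using f q up by (auto simp: long_ideal_def)
      have P: "(u, take m p) \<in> paths Q" "(awlast u (take m p), drop m p) \<in> paths Q"
        using paths_take_drop q up by auto
      have "path_element (u, take m p) \<in> ?S" using P len by (auto intro!: exI[of _ u] exI[of _ "take m p"])
      then have "path_element (u, take m p) \<in> genideal KQ ?S" using KQ.genideal_self[OF SC] by blast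
      then have "mult KQ (single (f q) (awlast u (take m p), drop m p)) (path_element (u, take m p)) \<in> genideal KQ ?S"
        by (intro I.I_l_closed single_carrier P)
      then show "single (f q) q \<in> genideal KQ ?S"
        unfolding pe by (subst (asm) single_mult_single) (auto simp: up)
    qed
  qed
qed

lemma truncated_eq:
  "truncated_path_algebra Q L = (KQ Quot long_ideal (Suc L) :: (('v, 'a) path \<Rightarrow> 'k::field) set ring)"
  unfolding truncated_path_algebra_def genideal_eq ..

end

locale trunc = quiver Q for Q :: "('v, 'a) pre_digraph" + fixes L :: nat
begin

section \<open>The truncated quotient and its Jacobson radical\<close>

abbreviation \<Lambda> :: "(('v, 'a) path \<Rightarrow> 'k::field) set ring" where
  "\<Lambda> \<equiv> truncated_path_algebra Q L"

definition cls :: "(('v, 'a) path \<Rightarrow> 'k::field) \<Rightarrow> (('v, 'a) path \<Rightarrow> 'k) set" where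
  "cls f = long_ideal (Suc L) +>\<^bsub>KQ\<^esub> f"

lemma cls_hom: "cls \<in> Ring.ring_hom (KQ :: (('v, 'a) path \<Rightarrow> 'k::field) ring) \<Lambda>"
  using ideal.rcos_ring_hom[OF ideal_long_ideal[of "Suc L"]]
  unfolding truncated_eq cls_def[abs_def] .

lemma ring_\<Lambda>: "ring (\<Lambda> :: (('v, 'a) path \<Rightarrow> 'k::field) set ring)"
  unfolding truncated_eq by (rule ideal.quotient_is_ring[OF ideal_long_ideal])

lemma carrier_\<Lambda>: "carrier \<Lambda> = cls ` carrier KQ"
  unfolding truncated_eq FactRing_simps cls_def by auto

lemma cls_mult: "f \<in> carrier KQ \<Longrightarrow> g \<in> carrier KQ \<Longrightarrow> cls f \<otimes>\<^bsub>\<Lambda>\<^esub> cls g = cls (mult KQ f g)"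
  by (rule ring_hom_mult[OF cls_hom, symmetric])

lemma cls_add: "f \<in> carrier KQ \<Longrightarrow> g \<in> carrier KQ \<Longrightarrow> cls f \<oplus>\<^bsub>\<Lambda>\<^esub> cls g = cls (\<lambda>p. f p + g p)"
  using ring_hom_add[OF cls_hom, of f g] by (simp add: KQ_simps(5))

lemma cls_zero: "cls (\<lambda>_. 0) = \<zero>\<^bsub>\<Lambda>\<^esub>"
  using ring_hom_zero[OF cls_hom ring_KQ ring_\<Lambda>] by (simp add: KQ_simps(4))

lemma mem_cls: "g \<in> cls f \<longleftrightarrow> (\<exists>h\<in>long_ideal (Suc L). g = (\<lambda>p. h p + f p))"
  by (auto simp: cls_def a_r_coset_def' KQ_simps)

lemma cls_self: "f \<in> cls f"
  unfolding mem_cls using zero_long_ideal by (intro bexI[of _ "\<lambda>_. 0"]) auto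

lemma cls_eqI:
  assumes "h \<in> long_ideal (Suc L)" "f = (\<lambda>p. h p + g p)"
  shows "cls f = cls g"
proof (intro equalityI subsetI)
  fix x assume "x \<in> cls f"
  then obtain k where "k \<in> long_ideal (Suc L)" "x = (\<lambda>p. k p + f p)" by (auto simp: mem_cls)
  then show "x \<in> cls g"
    unfolding mem_cls using assms long_ideal_add[of k "Suc L" h]
    by (intro bexI[of _ "\<lambda>p. k p + h p"]) (auto simp: add.assoc)
next
  fix x assume "x \<in> cls g"
  then obtain k where "k \<in> long_ideal (Suc L)" "x = (\<lambda>p. k p + g p)" by (auto simp: mem_cls)
  then show "x \<in> cls f"
    unfolding mem_cls using assms long_ideal_add[of k "Suc L" "\<lambda>p. (- 1) * h p"] long_ideal_scale[of h "Suc L" "- 1"]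
    by (intro bexI[of _ "\<lambda>p. k p + (- 1) * h p"]) auto
qed

text \<open>Left ideals of the path algebra in terms of functions. Left ideals of the quotient are
  handled through them, as images and preimages under \<open>cls\<close>.\<close>

definition left_closed :: "(('v, 'a) path \<Rightarrow> 'k::field) set \<Rightarrow> bool" where
  "left_closed A \<longleftrightarrow> A \<subseteq> carrier KQ \<and> (\<lambda>_. 0) \<in> A \<and> (\<forall>f\<in>A. \<forall>g\<in>A. (\<lambda>p. f p + g p) \<in> A) \<and>
     (\<forall>f\<in>carrier KQ. \<forall>g\<in>A. mult KQ f g \<in> A)"

lemma left_closedD:
  assumes "left_closed A"
  shows "(\<lambda>_. 0) \<in> A"
    and "f \<in> A \<Longrightarrow> g \<in> A \<Longrightarrow> (\<lambda>p. f p + g p) \<in> A"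
    and "h \<in> carrier KQ \<Longrightarrow> g \<in> A \<Longrightarrow> mult KQ h g \<in> A"
  using assms by (auto simp: left_closed_def)

text \<open>A scalar acts as a multiple of the identity element, so left ideals are closed under
  scalars and in particular under negation.\<close>

lemma scale_eq_mult:
  assumes "f \<in> carrier KQ"
  shows "(\<lambda>p. c * f p) = mult KQ (\<lambda>p. c * \<one>\<^bsub>KQ\<^esub> p) f"
proof -
  have "mult KQ (\<lambda>p. c * \<one>\<^bsub>KQ\<^esub> p) f (u, p) = c * mult KQ \<one>\<^bsub>KQ\<^esub> f (u, p)" for u p
    unfolding KQ_simps(2) by (simp add: sum_distrib_left mult.assoc)
  then show ?thesis using one_mult[OF assms] by auto
qed

lemma left_closed_scale:
  assumes "left_closed A" "f \<in> A"
  shows "(\<lambda>p. c * f p) \<in> A"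
proof -
  have "f \<in> carrier KQ" using assms by (auto simp: left_closed_def)
  then show ?thesis
    using assms scale_carrier[OF one_carrier, of c] scale_eq_mult[of f c] by (auto simp: left_closed_def)
qed

lemma left_ideal_image:
  fixes A :: "(('v, 'a) path \<Rightarrow> 'k::field) set"
  assumes A: "left_closed A"
  shows "left_ideal \<Lambda> (cls ` A)"
proof -
  interpret Lam: ring "\<Lambda> :: (('v, 'a) path \<Rightarrow> 'k) set ring" by (rule ring_\<Lambda>)
  have carr: "f \<in> carrier KQ" if "f \<in> A" for f using A that by (auto simp: left_closed_def)
  have "subgroup (cls ` A) (add_monoid \<Lambda>)"
  proof (rule group.subgroupI, goal_cases)
    case 1
    then show ?case by (rule Lam.a_group)
  next
    case 2
    then show ?case by (auto simp: carrier_\<Lambda> carr)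
  next
    case 3
    then show ?case using A by (auto simp: left_closed_def)
  next
    case (4 X)
    then obtain f where f: "X = cls f" "f \<in> A" by auto
    then have g: "(\<lambda>p. (- 1) * f p) \<in> A" using left_closed_scale[OF A] by blast
    have "cls (\<lambda>p. (- 1) * f p) \<oplus>\<^bsub>\<Lambda>\<^esub> X = cls (\<lambda>_. 0)"
      unfolding f by (subst cls_add) (use g f carr in auto)
    then have "\<ominus>\<^bsub>\<Lambda>\<^esub> X = cls (\<lambda>p. (- 1) * f p)"
      using f g carr by (intro Lam.minus_equality) (auto simp: cls_zero carrier_\<Lambda> simp del: mult_minus1)
    then show ?case using g by (simp add: a_inv_def)
  next
    case (5 X Y)
    then obtain f g where "X = cls f" "Y = cls g" "f \<in> A" "g \<in> A" by auto
    then show ?case using A carr by (auto simp: cls_add left_closed_def)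
  qed
  moreover have "X \<otimes>\<^bsub>\<Lambda>\<^esub> Y \<in> cls ` A" if "X \<in> carrier \<Lambda>" "Y \<in> cls ` A" for X Y
  proof -
    obtain f g where "X = cls f" "Y = cls g" "f \<in> carrier KQ" "g \<in> A" using \<open>X \<in> carrier \<Lambda>\<close> \<open>Y \<in> cls ` A\<close> by (auto simp: carrier_\<Lambda>)
    then show ?thesis using A carr by (auto simp: cls_mult left_closed_def)
  qed
  ultimately show ?thesis unfolding left_ideal_def by blast
qed

lemma left_closed_preimage:
  fixes I :: "(('v, 'a) path \<Rightarrow> 'k::field) set set"
  assumes I: "left_ideal \<Lambda> I"
  shows "left_closed {f \<in> carrier KQ. cls f \<in> I}" (is "left_closed ?A") "cls ` {f \<in> carrier KQ. cls f \<in> I} = I"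
proof -
  have sg: "subgroup I (add_monoid \<Lambda>)" and lm: "\<And>a x. a \<in> carrier \<Lambda> \<Longrightarrow> x \<in> I \<Longrightarrow> a \<otimes>\<^bsub>\<Lambda>\<^esub> x \<in> I"
    using I by (auto simp: left_ideal_def)
  have "\<zero>\<^bsub>\<Lambda>\<^esub> \<in> I" using subgroup.one_closed[OF sg] by simp
  moreover have "X \<oplus>\<^bsub>\<Lambda>\<^esub> Y \<in> I" if "X \<in> I" "Y \<in> I" for X Y
    using subgroup.m_closed[OF sg that] by simp
  moreover have "(\<lambda>_. 0) \<in> carrier KQ" using KQ.zero_closed by (simp add: KQ_simps(4))
  ultimately show "left_closed ?A"
    unfolding left_closed_def
    by (auto simp: cls_zero add_carrier cls_add[symmetric] mult_carrier cls_mult[symmetric] lm carrier_\<Lambda>)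
  show "cls ` ?A = I"
    using subgroup.subset[OF sg] by (auto simp: carrier_\<Lambda>)
qed

lemma left_closed_long_ideal: "left_closed (long_ideal l :: (('v, 'a) path \<Rightarrow> 'b::field) set)"
  unfolding left_closed_def
proof (intro conjI ballI)
  show "long_ideal l \<subseteq> carrier KQ" by (auto simp: long_ideal_def)
  fix f g :: "('v, 'a) path \<Rightarrow> 'b" assume g: "g \<in> long_ideal l"
  show "(\<lambda>p. f p + g p) \<in> long_ideal l" if "f \<in> long_ideal l"
    using that g by (rule long_ideal_add)
  show "mult KQ f g \<in> long_ideal l" if "f \<in> carrier KQ"
    using long_ideal_mult[of f 0 g l] that g by (simp add: long_ideal_0)
qed (rule zero_long_ideal)

text \<open>Each vertex gives a maximal left ideal, the kernel of the coefficient at its trivial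
  path, and together these cut out the arrow ideal. Conversely the arrow ideal is nilpotent in the
  quotient and hence contained in every maximal left ideal.\<close>

lemma jacobson_radical_eq:
  "jacobson_radical \<Lambda> = cls ` (long_ideal 1 :: (('v, 'a) path \<Rightarrow> 'k::field) set)"
proof (intro equalityI subsetI)
  fix X :: "(('v, 'a) path \<Rightarrow> 'k) set"
  assume X: "X \<in> jacobson_radical \<Lambda>"
  then obtain f where f: "X = cls f" "f \<in> carrier KQ" by (auto simp: jacobson_radical_def carrier_\<Lambda>)
  have "f (u, []) = 0" if u: "u \<in> verts Q" for u
  proof -
    let ?A = "{g \<in> carrier KQ. g (u, []) = 0} :: (('v, 'a) path \<Rightarrow> 'k) set"
    have A: "left_closed ?A"
      using zero_long_ideal[of 0] by (auto simp: left_closed_def add_carrier mult_carrier KQ_simps(2) long_ideal_0)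
    have memA: "g (u, []) = 0" if g: "cls g \<in> cls ` ?A" for g :: "('v, 'a) path \<Rightarrow> 'k"
    proof -
      obtain g' where g': "cls g = cls g'" "g' \<in> ?A" using g by blast
      obtain h where "h \<in> long_ideal (Suc L)" "g = (\<lambda>p. h p + g' p)"
        using cls_self[of g] unfolding g'(1) mem_cls by blast
      moreover have "h (u, []) = 0" using \<open>h \<in> long_ideal (Suc L)\<close> by (force simp: long_ideal_def)
      ultimately show ?thesis using g' by simp
    qed
    have "maximal_left_ideal \<Lambda> (cls ` ?A)"
      unfolding maximal_left_ideal_def
    proof (intro conjI allI impI)
      show "left_ideal \<Lambda> (cls ` ?A)" by (rule left_ideal_image[OF A])
      have "cls (single 1 (u, [])) \<notin> cls ` ?A"
        using memA[of "single 1 (u, [])"] by (auto simp: single_def)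
      moreover have "cls (single 1 (u, [])) \<in> carrier (\<Lambda> :: (('v, 'a) path \<Rightarrow> 'k) set ring)"
        using u by (auto simp: carrier_\<Lambda> intro!: single_carrier imageI) (simp add: paths_Nil)
      ultimately show "cls ` ?A \<noteq> carrier \<Lambda>" by blast
      fix I :: "(('v, 'a) path \<Rightarrow> 'k) set set" assume I: "left_ideal \<Lambda> I \<and> cls ` ?A \<subseteq> I"
      let ?B = "{f \<in> carrier KQ. cls f \<in> I}"
      have B: "left_closed ?B" "cls ` ?B = I" using left_closed_preimage I by auto
      show "I = cls ` ?A \<or> I = carrier \<Lambda>"
      proof (cases "I \<subseteq> cls ` ?A")
        case False
        then obtain b where b: "b \<in> carrier KQ" "cls b \<in> I" "b (u, []) \<noteq> 0"
          using B(2) by blast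
        have "g \<in> ?B" if g: "g \<in> carrier KQ" for g
        proof -
          \<comment> \<open>Chosen so that \<open>mult KQ ?e b\<close> agrees with \<open>g\<close>
            at the trivial path of \<open>u\<close>; the difference then lies in \<open>?A\<close>.
            So \<open>?A\<close> and one element outside it generate everything.\<close>
          let ?c = "g (u, []) / b (u, [])"
          let ?e = "single ?c (u, [])"
          have e: "?e \<in> carrier KQ" using u by (intro single_carrier) (simp add: paths_Nil)
          have eb: "mult KQ ?e b \<in> ?B" using B(1) e b by (auto simp: left_closed_def)
          have "mult KQ ?e b (u, []) = g (u, [])" using b by (simp add: KQ_simps(2) single_def)
          moreover have "(\<lambda>p. g p + (- 1) * mult KQ ?e b p) \<in> carrier KQ"
            using add_carrier[OF g scale_carrier[of "mult KQ ?e b" "- 1"]] eb by blast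
          ultimately have "(\<lambda>p. g p + (- 1) * mult KQ ?e b p) \<in> ?A" by simp
          then have "(\<lambda>p. g p + (- 1) * mult KQ ?e b p) \<in> ?B" using I by auto
          then have "(\<lambda>p. (g p + (- 1) * mult KQ ?e b p) + mult KQ ?e b p) \<in> ?B"
            by (rule left_closedD(2)[OF B(1) _ eb])
          then show ?thesis by simp
        qed
        then have "carrier \<Lambda> \<subseteq> I" using B(2) by (auto simp: carrier_\<Lambda>)
        then show ?thesis using I by (auto simp: left_ideal_def dest: subgroup.subset)
      qed (use I in auto)
    qed
    then have "X \<in> cls ` ?A" using X by (auto simp: jacobson_radical_def)
    then show ?thesis using memA[of f] f by simp
  qed
  moreover have "u \<in> verts Q" if "f (u, []) \<noteq> 0" for u
    using f that by (auto simp: KQ_simps(1) paths_Nil[symmetric])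
  ultimately have "f \<in> long_ideal 1"
    using f by (auto simp: long_ideal_def Suc_le_eq)
  then show "X \<in> cls ` long_ideal 1" using f by simp
next
  fix X :: "(('v, 'a) path \<Rightarrow> 'k) set"
  assume "X \<in> cls ` long_ideal 1"
  then obtain f where f: "X = cls f" "f \<in> long_ideal 1" by auto
  have fc: "f \<in> carrier KQ" using f by (auto simp: long_ideal_def)
  have "X \<in> I" if I: "maximal_left_ideal \<Lambda> I" for I
  proof (rule ccontr)
    assume XI: "X \<notin> I"
    have I': "left_ideal \<Lambda> I" "I \<noteq> carrier \<Lambda>"
      "\<And>I'. left_ideal \<Lambda> I' \<Longrightarrow> I \<subseteq> I' \<Longrightarrow> I' = I \<or> I' = carrier \<Lambda>"
      using I by (auto simp: maximal_left_ideal_def)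
    let ?B = "{f \<in> carrier KQ. cls f \<in> I}"
    have B: "left_closed ?B" "cls ` ?B = I" using left_closed_preimage I' by auto
    \<comment> \<open>The preimage of \<open>I\<close> plus the arrow ideal. As \<open>X\<close> is
      not in \<open>I\<close>, maximality makes its image everything, so 1 is a sum of an element of
      \<open>?B\<close> and one of the arrow ideal, modulo long paths.\<close>
    let ?C = "{(\<lambda>p. b p + n p) | b n. b \<in> ?B \<and> n \<in> long_ideal 1}"
    have N: "left_closed (long_ideal 1 :: (('v, 'a) path \<Rightarrow> 'k) set)" by (rule left_closed_long_ideal)
    have "left_closed ?C"
      unfolding left_closed_def
    proof (intro conjI ballI)
      show "?C \<subseteq> carrier KQ" using B(1) N by (auto simp: left_closed_def intro!: add_carrier)
      have "(\<lambda>_. 0) \<in> ?B" "(\<lambda>_. 0 :: 'k) \<in> long_ideal 1"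
        by (rule left_closedD(1)[OF B(1)], rule left_closedD(1)[OF N])
      then show "(\<lambda>_. 0) \<in> ?C"
        by (intro CollectI exI[of _ "\<lambda>_. 0"] conjI) auto
      fix g h :: "('v, 'a) path \<Rightarrow> 'k" assume h: "h \<in> ?C"
      then obtain b n where bn: "h = (\<lambda>p. b p + n p)" "b \<in> ?B" "n \<in> long_ideal 1" by blast
      {
        assume "g \<in> ?C"
        then obtain b' n' where bn': "g = (\<lambda>p. b' p + n' p)" "b' \<in> ?B" "n' \<in> long_ideal 1" by blast
        have "(\<lambda>p. b' p + b p) \<in> ?B" "(\<lambda>p. n' p + n p) \<in> long_ideal 1"
          by (rule left_closedD(2)[OF B(1) bn'(2) bn(2)], rule left_closedD(2)[OF N bn'(3) bn(3)])
        then show "(\<lambda>p. g p + h p) \<in> ?C"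
          unfolding bn bn'
          by (intro CollectI exI[of _ "\<lambda>p. b' p + b p"] exI[of _ "\<lambda>p. n' p + n p"] conjI) (auto simp: algebra_simps)
      }
      {
        assume g: "g \<in> carrier KQ"
        have "mult KQ g b \<in> ?B" "mult KQ g n \<in> long_ideal 1"
          by (rule left_closedD(3)[OF B(1) g bn(2)], rule left_closedD(3)[OF N g bn(3)])
        moreover have "mult KQ g h = (\<lambda>p. mult KQ g b p + mult KQ g n p)"
          unfolding bn by (auto simp: fun_eq_iff KQ_simps(2) algebra_simps sum.distrib)
        ultimately show "mult KQ g h \<in> ?C" by blast
      }
    qed
    then have C: "left_ideal \<Lambda> (cls ` ?C)" by (rule left_ideal_image)
    have "(\<lambda>_. 0) \<in> ?B" "(\<lambda>_. 0 :: 'k) \<in> long_ideal 1"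
      by (rule left_closedD(1)[OF B(1)], rule left_closedD(1)[OF N])
    note z = this
    have "b \<in> ?C" if "b \<in> ?B" for b
      by (intro CollectI exI[of _ b] exI[of _ "\<lambda>_. 0"] conjI that z) simp
    then have sub: "?B \<subseteq> ?C" by blast
    have "f \<in> ?C"
      by (intro CollectI exI[of _ f] exI[of _ "\<lambda>_. 0"] conjI f z) simp
    have IC: "I \<subseteq> cls ` ?C" using image_mono[OF sub, of cls] unfolding B(2) .
    have XC: "X \<in> cls ` ?C" unfolding f(1) by (rule imageI) (rule \<open>f \<in> ?C\<close>)
    have "cls ` ?C \<noteq> I" using XC XI by metis
    then have "cls ` ?C = carrier \<Lambda>" using I'(3)[OF C IC] by metis
    moreover have "cls \<one>\<^bsub>KQ\<^esub> \<in> carrier (\<Lambda> :: (('v, 'a) path \<Rightarrow> 'k) set ring)"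
      using one_carrier by (auto simp: carrier_\<Lambda>)
    ultimately have "cls \<one>\<^bsub>KQ\<^esub> \<in> cls ` ?C" by metis
    then obtain c where c: "cls \<one>\<^bsub>KQ\<^esub> = cls c" "c \<in> ?C" by (rule imageE)
    from c(2) obtain b n where bn: "c = (\<lambda>p. b p + n p)" "b \<in> ?B" "n \<in> long_ideal 1"
      unfolding mem_Collect_eq by metis
    have "\<one>\<^bsub>KQ\<^esub> \<in> cls c" unfolding c(1)[symmetric] by (rule cls_self)
    then obtain h where h: "h \<in> long_ideal (Suc L)" "\<one>\<^bsub>KQ\<^esub> = (\<lambda>p. h p + (b p + n p))"
      unfolding mem_cls bn(1) by (elim bexE)
    have nc: "n \<in> carrier KQ" using bn by (auto simp: long_ideal_def)
    have "h \<in> ?B"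
    proof -
      have "cls h = cls (\<lambda>_. 0)" using h by (intro cls_eqI[of h]) auto
      then show ?thesis using \<open>(\<lambda>_. 0) \<in> ?B\<close> h by (auto simp: long_ideal_def)
    qed
    then have "(\<lambda>p. h p + b p) \<in> ?B" by (rule left_closedD(2)[OF B(1) _ bn(2)])
    then have m: "(\<lambda>p. \<one>\<^bsub>KQ\<^esub> p + (- 1) * n p) \<in> ?B" unfolding h(2) by (simp add: algebra_simps)
    \<comment> \<open>Here \<open>g\<close> runs through the powers of \<open>n\<close>: 1 - g n =
      (1 - g) + g (1 - n) stays in the left ideal \<open>?B\<close>. The power with exponent
      \<open>Suc L\<close> vanishes in the quotient, which leaves 1 itself in
      \<open>I\<close>.\<close>
    have "\<exists>g\<in>long_ideal k. (\<lambda>p. \<one>\<^bsub>KQ\<^esub> p + (- 1) * g p) \<in> ?B" for k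
    proof (induction k)
      case 0
      then show ?case using \<open>(\<lambda>_. 0) \<in> ?B\<close> one_carrier
        by (intro bexI[of _ "\<one>\<^bsub>KQ\<^esub>"]) (auto simp: long_ideal_0)
    next
      case (Suc k)
      then obtain g where g: "g \<in> long_ideal k" "(\<lambda>p. \<one>\<^bsub>KQ\<^esub> p + (- 1) * g p) \<in> ?B" by blast
      have gc: "g \<in> carrier KQ" using g by (auto simp: long_ideal_def)
      have "mult KQ g (\<lambda>p. \<one>\<^bsub>KQ\<^esub> p + (- 1) * n p) \<in> ?B"
        by (rule left_closedD(3)[OF B(1) gc m])
      moreover have "mult KQ g (\<lambda>p. \<one>\<^bsub>KQ\<^esub> p + (- 1) * n p) = (\<lambda>p. mult KQ g \<one>\<^bsub>KQ\<^esub> p + (- 1) * mult KQ g n p)"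
        by (auto simp: fun_eq_iff KQ_simps(2) algebra_simps sum_subtractf)
      ultimately have "(\<lambda>p. g p + (- 1) * mult KQ g n p) \<in> ?B" by (simp only: mult_one[OF gc])
      then have "(\<lambda>p. (\<one>\<^bsub>KQ\<^esub> p + (- 1) * g p) + (g p + (- 1) * mult KQ g n p)) \<in> ?B"
        by (rule left_closedD(2)[OF B(1) g(2)])
      then show ?case
        using long_ideal_mult[OF g(1) bn(3)] by (intro bexI[of _ "mult KQ g n"]) (auto simp: algebra_simps)
    qed
    from this[of "Suc L"] obtain g where g: "g \<in> long_ideal (Suc L)" "(\<lambda>p. \<one>\<^bsub>KQ\<^esub> p + (- 1) * g p) \<in> ?B" by blast
    have "cls \<one>\<^bsub>KQ\<^esub> = cls (\<lambda>p. \<one>\<^bsub>KQ\<^esub> p + (- 1) * g p)"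
      by (rule cls_eqI[OF g(1)]) auto
    then have one: "\<one>\<^bsub>KQ\<^esub> \<in> ?B" using g(2) one_carrier by auto
    have "carrier KQ \<subseteq> ?B"
    proof
      fix g :: "('v, 'a) path \<Rightarrow> 'k" assume g: "g \<in> carrier KQ"
      then have "mult KQ g \<one>\<^bsub>KQ\<^esub> \<in> ?B" by (rule left_closedD(3)[OF B(1) _ one])
      then show "g \<in> ?B" using mult_one[OF g] by simp
    qed
    then have "carrier \<Lambda> \<subseteq> I" using B(2) by (auto simp: carrier_\<Lambda>)
    then show False using I' by (auto simp: left_ideal_def dest: subgroup.subset)
  qed
  then show "X \<in> jacobson_radical \<Lambda>"
    using f fc by (auto simp: jacobson_radical_def carrier_\<Lambda>)
qed

lemma ideal_power_eq:
  "ideal_power \<Lambda> (jacobson_radical \<Lambda>) l = cls ` (long_ideal l :: (('v, 'a) path \<Rightarrow> 'k::field) set)"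
proof (induction l)
  case 0
  then show ?case by (simp add: long_ideal_0 carrier_\<Lambda>)
next
  case (Suc l)
  let ?P = "ideal_prod \<Lambda> (cls ` (long_ideal 1 :: (('v, 'a) path \<Rightarrow> 'k) set)) (cls ` long_ideal l)"
  have "?P = cls ` long_ideal (Suc l)"
  proof (intro equalityI subsetI)
    fix X assume "X \<in> ?P"
    then show "X \<in> cls ` long_ideal (Suc l)"
    proof induction
      case (prod i j)
      then obtain f g where fg: "i = cls f" "j = cls g" "f \<in> long_ideal 1" "g \<in> long_ideal l" by blast
      then have "i \<otimes>\<^bsub>\<Lambda>\<^esub> j = cls (mult KQ f g)" by (auto simp: long_ideal_def cls_mult)
      then show ?case using long_ideal_mult[OF fg(3,4)] by auto
    next
      case (sum i j)
      then obtain f g where fg: "i = cls f" "j = cls g" "f \<in> long_ideal (Suc l)" "g \<in> long_ideal (Suc l)" by blast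
      then have "i \<oplus>\<^bsub>\<Lambda>\<^esub> j = cls (\<lambda>p. f p + g p)" by (auto simp: long_ideal_def cls_add)
      then show ?case using long_ideal_add[OF fg(3,4)] by auto
    qed
  next
    fix X assume "X \<in> cls ` (long_ideal (Suc l) :: (('v, 'a) path \<Rightarrow> 'k) set)"
    then obtain f where f: "X = cls f" "f \<in> long_ideal (Suc l)" by blast
    have P0: "cls (\<lambda>_. 0) \<in> ?P"
    proof -
      have "cls (\<lambda>_. 0) \<otimes>\<^bsub>\<Lambda>\<^esub> cls (\<lambda>_. 0) \<in> ?P"
        by (intro ideal_prod.prod imageI zero_long_ideal)
      moreover have "cls (\<lambda>_. 0) \<otimes>\<^bsub>\<Lambda>\<^esub> cls (\<lambda>_. 0) = cls (\<lambda>_. 0 :: 'k)"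
        using zero_long_ideal[of 0] by (subst cls_mult) (auto simp: long_ideal_0 KQ_simps(2) fun_eq_iff intro!: arg_cong[of _ _ cls])
      ultimately show ?thesis by simp
    qed
    have "f \<in> carrier KQ" using f by (auto simp: long_ideal_def)
    then have "cls f \<in> ?P"
    proof (rule support_induct)
      fix q assume q: "f q \<noteq> 0" "q \<in> paths Q"
      obtain u p where up: "q = (u, p)" by (cases q)
      have len: "Suc l \<le> length p" using f q up by (auto simp: long_ideal_def)
      \<comment> \<open>Splits off the last arrow. Later pieces stand on the left of a product, so
        this arrow is the factor from the radical and the rest is the factor from its power with
        exponent \<open>l\<close>.\<close>
      let ?k = "length p - 1"
      have P: "(u, take ?k p) \<in> paths Q" "(awlast u (take ?k p), drop ?k p) \<in> paths Q"
        using paths_take_drop q up by auto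
      have "single (f q) (awlast u (take ?k p), drop ?k p) \<in> long_ideal 1"
           "single (1::'k) (u, take ?k p) \<in> long_ideal l"
        using P len by (auto simp: long_ideal_def single_carrier) (auto simp: single_def split: if_splits)
      then have "cls (single (f q) (awlast u (take ?k p), drop ?k p)) \<otimes>\<^bsub>\<Lambda>\<^esub> cls (single 1 (u, take ?k p)) \<in> ?P"
        by (intro ideal_prod.prod imageI)
      then show "cls (single (f q) q) \<in> ?P"
        using P by (subst (asm) cls_mult) (auto simp: single_carrier single_mult_single up)
    next
      fix g h :: "('v, 'a) path \<Rightarrow> 'k"
      assume "g \<in> carrier KQ" "h \<in> carrier KQ" "cls g \<in> ?P" "cls h \<in> ?P"
      then show "cls (\<lambda>p. g p + h p) \<in> ?P"
        using ideal_prod.sum[of "cls g" \<Lambda> _ _ "cls h"] by (simp add: cls_add)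
    qed (rule P0)
    then show "X \<in> ?P" using f by simp
  qed
  then show ?case using Suc by (simp add: jacobson_radical_eq)
qed

end

section \<open>The action of paths on a representation\<close>

lemma extended_basis:
  fixes V :: "(nat \<Rightarrow> 'k::field) set"
  assumes "fs.subspace V" "V \<subseteq> cspace n" "fs.subspace V'" "V' \<subseteq> V"
  shows "\<exists>b r. indep_fam (fs.dim V' + r) b \<and> fs.span (b ` {..<fs.dim V'}) = V' \<and>
    fs.span (b ` {..<fs.dim V' + r}) = V \<and> fs.dim V = fs.dim V' + r"
proof -
  have "V' \<subseteq> cspace n" using assms by blast
  moreover have "indep_fam 0 (\<lambda>_. 0 :: nat \<Rightarrow> 'k)" by (simp add: indep_fam_def)
  moreover have "fs.span ((\<lambda>_. 0) ` {..<0::nat}) \<subseteq> V'" using fs.subspace_0[OF assms(3)] by simp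
  ultimately obtain b0 where b0: "indep_fam (fs.dim V') b0" "fs.span (b0 ` {..<fs.dim V'}) = V'"
    using extend_indep_fam[OF assms(3), of n 0 "\<lambda>_. 0"] by blast
  then obtain b where b: "\<forall>j<fs.dim V'. b j = b0 j" "indep_fam (fs.dim V) b" "fs.span (b ` {..<fs.dim V}) = V"
    using extend_indep_fam[OF assms(1,2) b0(1)] assms(4) by blast
  have "b ` {..<fs.dim V'} = b0 ` {..<fs.dim V'}" using b(1) by (intro image_cong) auto
  then have "fs.span (b ` {..<fs.dim V'}) = V'" using b0(2) by metis
  moreover have "fs.dim V = fs.dim V' + (fs.dim V - fs.dim V')"
    using dim_cspace_le(1)[OF assms(3,4,1,2)] by simp
  ultimately show ?thesis using b(2,3) by metis
qed

text \<open>Rank-nullity for a map that is known to be linear only on \<open>V\<close>, as happens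
  with a map extracted from a module isomorphism.\<close>

lemma dim_quotient:
  fixes \<tau> :: "(nat \<Rightarrow> 'k::field) \<Rightarrow> nat \<Rightarrow> 'k"
  assumes V: "fs.subspace V" "V \<subseteq> cspace n"
    and add: "\<And>v w. v \<in> V \<Longrightarrow> w \<in> V \<Longrightarrow> \<tau> (v + w) = \<tau> v + \<tau> w"
    and scale: "\<And>c v. v \<in> V \<Longrightarrow> \<tau> (fscale c v) = fscale c (\<tau> v)"
    and ker: "\<And>w. w \<in> V \<Longrightarrow> \<tau> w = 0 \<longleftrightarrow> w \<in> V'" "V' \<subseteq> V" "fs.subspace V'"
    and im: "\<tau> ` V = cspace s"
  shows "fs.dim V = fs.dim V' + s"
proof -
  let ?m = "fs.dim V'"
  obtain b r where b: "indep_fam (?m + r) b" "fs.span (b ` {..<?m}) = V'"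
    "fs.span (b ` {..<?m + r}) = V" "fs.dim V = ?m + r"
    using extended_basis[OF V ker(3,2)] by blast
  have bV: "b j \<in> V" if "j < ?m + r" for j
    using fs.span_base[of "b j" "b ` {..<?m + r}"] that b(3) by auto
  have \<tau>0: "\<tau> 0 = 0" using scale[of 0 0] fs.subspace_0[OF V(1)] by simp
  have \<tau>sum: "\<tau> (\<Sum>j\<in>A. fscale (c j) (b j)) = (\<Sum>j\<in>A. fscale (c j) (\<tau> (b j)))"
    if "A \<subseteq> {..<?m + r}" for A c
  proof -
    have "finite A" using that finite_subset by blast
    then show ?thesis using that
    proof (induction A rule: finite_induct)
      case (insert x A)
      have "(\<Sum>j\<in>A. fscale (c j) (b j)) \<in> V" "fscale (c x) (b x) \<in> V"
        using insert.prems bV by (auto intro!: fs.subspace_sum[OF V(1)] fs.subspace_scale[OF V(1)])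
      then show ?case using insert add scale bV by simp
    qed (simp add: \<tau>0)
  qed
  \<comment> \<open>Images of the vectors that complete a basis of the kernel \<open>V'\<close> to
    one of \<open>V\<close>; they turn out to be a basis of the image.\<close>
  define c where "c = (\<lambda>j. \<tau> (b (?m + j)))"
  have "indep_fam r c"
    unfolding indep_fam_def
  proof (intro allI impI notI)
    fix j assume j: "j < r" "c j \<in> fs.span (c ` {..<j})"
    then obtain \<gamma> where \<gamma>: "c j = (\<Sum>i<j. fscale (\<gamma> i) (c i))" using span_image_coeffs by blast
    let ?A = "(\<lambda>i. ?m + i) ` {..<j}"
    have A: "?A \<subseteq> {..<?m + r}" using j by auto
    let ?w = "\<Sum>i\<in>?A. fscale (\<gamma> (i - ?m)) (b i)"
    have w: "\<tau> ?w = c j"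
      unfolding \<tau>sum[OF A] \<gamma> by (subst sum.reindex) (auto simp: c_def)
    have wV: "?w \<in> V" using A bV by (auto intro!: fs.subspace_sum[OF V(1)] fs.subspace_scale[OF V(1)])
    have wspan: "?w \<in> fs.span (b ` {..<?m + j})"
      by (intro fs.span_sum fs.span_scale fs.span_base) auto
    have mV: "b (?m + j) \<in> V" "fscale (- 1) ?w \<in> V"
      by (rule bV) (use j in simp, rule fs.subspace_scale[OF V(1) wV])
    have "\<tau> (b (?m + j) + fscale (- 1) ?w) = c j + fscale (- 1) (\<tau> ?w)"
      unfolding add[OF mV] scale[OF wV] c_def ..
    also have "\<dots> = 0" unfolding w by simp
    finally have mem: "b (?m + j) + fscale (- 1) ?w \<in> V'"
      using ker(1) fs.subspace_add[OF V(1) mV] by metis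
    have "fs.span (b ` {..<?m}) \<subseteq> fs.span (b ` {..<?m + j})"
      by (intro fs.span_mono image_mono) auto
    then have sub: "V' \<subseteq> fs.span (b ` {..<?m + j})" unfolding b(2) .
    have "b (?m + j) + fscale (- 1) ?w + ?w \<in> fs.span (b ` {..<?m + j})"
      by (rule fs.span_add[OF subsetD[OF sub mem] wspan])
    then have "b (?m + j) \<in> fs.span (b ` {..<?m + j})" by simp
    then show False using b(1) j by (auto simp: indep_fam_def)
  qed
  moreover have "fs.span (c ` {..<r}) = cspace s"
  proof
    have "c ` {..<r} \<subseteq> cspace s" using bV im by (auto simp: c_def)
    then show "fs.span (c ` {..<r}) \<subseteq> cspace s" by (intro fs.span_minimal subspace_cspace)
    show "cspace s \<subseteq> fs.span (c ` {..<r})"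
    proof
      fix f :: "nat \<Rightarrow> 'k" assume "f \<in> cspace s"
      then obtain w where w: "w \<in> V" "f = \<tau> w" using im by auto
      then obtain \<gamma> where \<gamma>: "w = (\<Sum>j<?m + r. fscale (\<gamma> j) (b j))" using b(3) span_image_coeffs by blast
      have "f = (\<Sum>j<?m + r. fscale (\<gamma> j) (\<tau> (b j)))" unfolding w \<gamma> by (rule \<tau>sum) simp
      also have "\<dots> \<in> fs.span (c ` {..<r})"
      proof (intro fs.span_sum fs.span_scale)
        fix j assume j: "j \<in> {..<?m + r}"
        show "\<tau> (b j) \<in> fs.span (c ` {..<r})"
        proof (cases "j < ?m")
          case True
          then have "b j \<in> V'" using fs.span_base[of "b j" "b ` {..<?m}"] b(2) by auto
          then have "\<tau> (b j) = 0" using ker by blast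
          then show ?thesis by (simp add: fs.span_zero)
        next
          case False
          then have "\<tau> (b j) = c (j - ?m)" by (simp add: c_def)
          then show ?thesis using j False by (auto intro!: fs.span_base)
        qed
      qed
      finally show "f \<in> fs.span (c ` {..<r})" .
    qed
  qed
  ultimately have "fs.dim (cspace s :: (nat \<Rightarrow> 'k) set) = r" using indep_fam_independent[of r c] by metis
  then show ?thesis using b(4) by (simp add: dim_cspace)
qed

text \<open>A basis of \<open>V'\<close> is sent to zero, and the vectors completing it to a basis
  of \<open>V\<close> are sent to the unit vectors.\<close>

lemma linear_quotient_map:
  fixes V :: "(nat \<Rightarrow> 'k::field) set"
  assumes V: "fs.subspace V" "V \<subseteq> cspace n" "fs.subspace V'" "V' \<subseteq> V"
    and dim: "fs.dim V = fs.dim V' + s"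
  shows "\<exists>T. flinear T \<and> T ` V = cspace s \<and> (\<forall>w\<in>V. T w = 0 \<longleftrightarrow> w \<in> V')"
proof -
  let ?m = "fs.dim V'"
  obtain b r where b: "indep_fam (?m + r) b" "fs.span (b ` {..<?m}) = V'"
    "fs.span (b ` {..<?m + r}) = V" "fs.dim V = ?m + r"
    using extended_basis[OF V] by blast
  have r: "r = s" using dim b(4) by simp
  let ?F = "\<lambda>j. if j < ?m then 0 else unit_fun (j - ?m) :: nat \<Rightarrow> 'k"
  have ind: "fs.independent (b ` {..<?m + s})" "inj_on b {..<?m + s}"
    using indep_fam_independent[OF b(1)] r by auto
  obtain T where T: "flinear T" "\<forall>x\<in>b ` {..<?m + s}. T x = ?F (the_inv_into {..<?m + s} b x)"
    using fsp.linear_independent_extend[OF ind(1), of "\<lambda>x. ?F (the_inv_into {..<?m + s} b x)"] by blast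
  have Tb: "T (b j) = ?F j" if "j < ?m + s" for j
    using T(2) that the_inv_into_f_f[OF ind(2)] by auto
  interpret T: Vector_Spaces.linear fscale fscale T by (rule T(1))
  have expand: "T (\<Sum>j<?m + s. fscale (c j) (b j)) = (\<Sum>i<s. fscale (c (?m + i)) (unit_fun i))" for c
  proof -
    have "T (\<Sum>j<?m + s. fscale (c j) (b j)) = (\<Sum>j<?m + s. fscale (c j) (?F j))"
      by (auto simp: T.sum T.scale Tb intro!: sum.cong)
    also have "\<dots> = (\<Sum>j\<in>{?m..<?m + s}. fscale (c j) (unit_fun (j - ?m)))"
      by (intro sum.mono_neutral_cong_right) auto
    also have "\<dots> = (\<Sum>i<s. fscale (c (?m + i)) (unit_fun i))"
      by (rule sum.reindex_bij_witness[of _ "\<lambda>i. ?m + i" "\<lambda>j. j - ?m"]) auto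
    finally show ?thesis .
  qed
  have "T ` V = cspace s"
  proof (intro equalityI subsetI)
    fix f assume "f \<in> T ` V"
    then obtain w where "w \<in> V" "f = T w" by auto
    then obtain c where "w = (\<Sum>j<?m + s. fscale (c j) (b j))" using b(3) r span_image_coeffs by blast
    then have "f = (\<Sum>i<s. fscale (c (?m + i)) (unit_fun i))" using \<open>f = T w\<close> expand by simp
    also have "\<dots> \<in> cspace s"
      by (intro fs.subspace_sum[OF subspace_cspace] fs.subspace_scale[OF subspace_cspace] unit_fun_in_cspace) auto
    finally show "f \<in> cspace s" .
  next
    fix f :: "nat \<Rightarrow> 'k" assume f: "f \<in> cspace s"
    let ?w = "\<Sum>j<?m + s. fscale (f (j - ?m)) (b j)"
    have wV: "?w \<in> V" unfolding b(3)[symmetric] r by (intro fs.span_sum fs.span_scale fs.span_base) auto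
    have "f = T ?w" unfolding expand using cspace_expand[OF f] by simp
    then show "f \<in> T ` V" using wV by (rule image_eqI)
  qed
  moreover have "T w = 0 \<longleftrightarrow> w \<in> V'" if "w \<in> V" for w
  proof
    assume T0: "T w = 0"
    have "w \<in> fs.span (b ` {..<?m + s})" using that b(3) r by simp
    then obtain c where c: "w = (\<Sum>j<?m + s. fscale (c j) (b j))" using span_image_coeffs by blast
    have sum0: "(\<Sum>i<s. fscale (c (?m + i)) (unit_fun i)) = (0 :: nat \<Rightarrow> 'k)" using T0 expand c by simp
    have "c (?m + i) = 0" if "i < s" for i
      using indep_fam_coeffs[OF indep_fam_unit_fun sum0 that] .
    then have c0: "c j = 0" if "j < ?m + s" "\<not> j < ?m" for j
      using that by (metis add_diff_inverse_nat nat_add_left_cancel_less)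
    have "w = (\<Sum>j<?m. fscale (c j) (b j))"
      unfolding c by (intro sum.mono_neutral_right) (auto simp: c0)
    also have "\<dots> \<in> fs.span (b ` {..<?m})" by (intro fs.span_sum fs.span_scale fs.span_base) auto
    finally show "w \<in> V'" using b(2) by simp
  next
    assume "w \<in> V'"
    then obtain c where "w = (\<Sum>j<?m. fscale (c j) (b j))" using b(2) span_image_coeffs by blast
    then have "T w = (\<Sum>j<?m. fscale (c j) (?F j))" by (auto simp: T.sum T.scale Tb intro!: sum.cong)
    also have "\<dots> = 0" by (intro sum.neutral) auto
    finally show "T w = 0" .
  qed
  ultimately show ?thesis using T(1) by blast
qed

text \<open>Passage from vectors that carry their length to \<open>cspace\<close>;
  \<open>vec n\<close> is its inverse.\<close>

definition vf :: "'k::field vec \<Rightarrow> nat \<Rightarrow> 'k" where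
  "vf w = (\<lambda>i. if i < dim_vec w then w $ i else 0)"

lemma vf_in_cspace: "w \<in> carrier_vec n \<Longrightarrow> vf w \<in> cspace n"
  by (auto simp: vf_def cspace_def)

lemma vf_vec: "f \<in> cspace n \<Longrightarrow> vf (vec n f) = f"
  by (auto simp: vf_def cspace_def fun_eq_iff)

lemma vec_vf: "w \<in> carrier_vec n \<Longrightarrow> vec n (vf w) = w"
  by (intro eq_vecI) (auto simp: vf_def)

lemma vf_inject: "w \<in> carrier_vec n \<Longrightarrow> w' \<in> carrier_vec n \<Longrightarrow> vf w = vf w' \<longleftrightarrow> w = w'"
  using vec_vf by metis

lemma vf_add: "w \<in> carrier_vec n \<Longrightarrow> w' \<in> carrier_vec n \<Longrightarrow> vf (w + w') = vf w + vf w'"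
  by (auto simp: vf_def fun_eq_iff fun_apply)

lemma vf_zero: "vf (0\<^sub>v n) = 0"
  by (auto simp: vf_def fun_eq_iff fun_apply)

context quiver
begin

text \<open>Coordinates of \<open>f\<close> beyond the dimension at the source are ignored, which
  makes this a linear map on the space of all sequences.\<close>

definition act :: "('v \<Rightarrow> nat) \<Rightarrow> ('a \<Rightarrow> 'k::field mat) \<Rightarrow> 'a \<Rightarrow> (nat \<Rightarrow> 'k) \<Rightarrow> nat \<Rightarrow> 'k" where
  "act d x a f = (\<lambda>i. if i < d (head Q a) then \<Sum>j<d (tail Q a). x a $$ (i, j) * f j else 0)"

definition pact :: "('v \<Rightarrow> nat) \<Rightarrow> ('a \<Rightarrow> 'k::field mat) \<Rightarrow> 'a list \<Rightarrow> (nat \<Rightarrow> 'k) \<Rightarrow> nat \<Rightarrow> 'k" where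
  "pact d x p f = fold (act d x) p f"

lemma act_add: "act d x a (f + g) = act d x a f + act d x a g"
  by (auto simp: act_def fun_eq_iff fun_apply algebra_simps sum.distrib)

lemma act_scale: "act d x a (fscale c f) = fscale c (act d x a f)"
  by (auto simp: act_def fun_eq_iff fscale_apply algebra_simps sum_distrib_left)

lemma linear_act: "flinear (act d x a)"
  by (intro Vector_Spaces.linear_iff[THEN iffD2] conjI allI act_add act_scale fs.vector_space_axioms)

lemma act_zero: "act d x a 0 = 0"
  using act_scale[of d x a 0 0] by simp

lemma act_in_cspace: "act d x a f \<in> cspace (d (head Q a))"
  by (auto simp: act_def cspace_def)

lemma pact_append: "pact d x (p @ q) f = pact d x q (pact d x p f)"
  by (simp add: pact_def)

lemma pact_Nil [simp]: "pact d x [] f = f"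
  by (simp add: pact_def)

lemma pact_Cons: "pact d x (a # p) f = pact d x p (act d x a f)"
  by (simp add: pact_def)

lemma pact_zero: "pact d x p 0 = 0"
  by (induction p) (auto simp: pact_Cons act_zero)

definition tuples :: "('v \<Rightarrow> nat) \<Rightarrow> ('a \<Rightarrow> 'k::field mat) set" where
  "tuples d = (\<Pi>\<^sub>E a\<in>arcs Q. carrier_mat (d (head Q a)) (d (tail Q a)))"

lemma vf_mult_vec:
  assumes "x \<in> tuples d" "a \<in> arcs Q" "w \<in> carrier_vec (d (tail Q a))"
  shows "vf (x a *\<^sub>v w) = act d x a (vf w)"
proof -
  have "x a \<in> carrier_mat (d (head Q a)) (d (tail Q a))" using assms by (auto simp: tuples_def)
  then show ?thesis using assms(3)
    by (auto simp: vf_def act_def fun_eq_iff scalar_prod_def lessThan_atLeast0)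
qed

lemma path_matrix_snoc: "path_matrix x n (p @ [a]) = x a * path_matrix x n p"
  by (simp add: path_matrix_def)

lemma path_matrix_carrier:
  assumes "x \<in> tuples d" "awalk u p v"
  shows "path_matrix x (d u) p \<in> carrier_mat (d v) (d u)"
  using assms(2)
proof (induction p arbitrary: v rule: rev_induct)
  case Nil
  then show ?case by (simp add: path_matrix_def awalk_Nil_iff)
next
  case (snoc a p)
  then have "awalk u p (tail Q a)" "a \<in> arcs Q" "v = head Q a" by (auto simp: awalk_simps) 
  then have "x a \<in> carrier_mat (d v) (d (tail Q a))" using assms(1) by (auto simp: tuples_def)
  then show ?case using mult_carrier_mat snoc.IH[OF \<open>awalk u p (tail Q a)\<close>] by (auto simp: path_matrix_snoc)
qed

lemma vf_path_matrix:
  assumes "x \<in> tuples d" "awalk u p v" "w \<in> carrier_vec (d u)"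
  shows "vf (path_matrix x (d u) p *\<^sub>v w) = pact d x p (vf w)"
  using assms(2)
proof (induction p arbitrary: v rule: rev_induct)
  case Nil
  then show ?case using assms by (simp add: path_matrix_def)
next
  case (snoc a p)
  then have a: "awalk u p (tail Q a)" "a \<in> arcs Q" by (auto simp: awalk_simps)
  have P: "path_matrix x (d u) p \<in> carrier_mat (d (tail Q a)) (d u)"
    by (rule path_matrix_carrier[OF assms(1) a(1)])
  have X: "x a \<in> carrier_mat (d (head Q a)) (d (tail Q a))" using assms(1) a by (auto simp: tuples_def)
  have "path_matrix x (d u) (p @ [a]) *\<^sub>v w = x a *\<^sub>v (path_matrix x (d u) p *\<^sub>v w)"
    using assoc_mult_mat_vec[OF X P assms(3)] by (simp add: path_matrix_snoc)
  then show ?case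
    using vf_mult_vec[OF assms(1) a(2), of "path_matrix x (d u) p *\<^sub>v w"] P assms(3) snoc.IH[OF a(1)]
    by (auto simp: pact_append pact_Cons)
qed

lemma pact_in_cspace:
  assumes "awalk u p v" "f \<in> cspace (d u)"
  shows "pact d x p f \<in> cspace (d v)"
  using assms
proof (induction p arbitrary: u f)
  case Nil
  then show ?case by (simp add: awalk_Nil_iff)
next
  case (Cons a p)
  then show ?case using Cons.IH[OF _ act_in_cspace] by (auto simp: pact_Cons awalk_simps)
qed

lemma mat_zero_iff:
  fixes A :: "'k::field mat"
  assumes "A \<in> carrier_mat n m"
  shows "A = 0\<^sub>m n m \<longleftrightarrow> (\<forall>w\<in>carrier_vec m. A *\<^sub>v w = 0\<^sub>v n)"
proof
  assume *: "\<forall>w\<in>carrier_vec m. A *\<^sub>v w = 0\<^sub>v n"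
  show "A = 0\<^sub>m n m"
  proof (rule eq_matI)
    fix i j assume ij: "i < dim_row (0\<^sub>m n m)" "j < dim_col (0\<^sub>m n m :: 'k mat)"
    have "(A *\<^sub>v unit_vec m j) $ i = 0" using * ij by simp
    then show "A $$ (i, j) = 0\<^sub>m n m $$ (i, j)" using ij assms by simp
  qed (use assms in auto)
qed (use assms in auto)

lemma rep_variety_iff:
  fixes x :: "'a \<Rightarrow> 'k::field mat"
  shows "x \<in> rep_variety Q L d \<longleftrightarrow> x \<in> tuples d \<and>
     (\<forall>u p v f. awalk u p v \<and> length p = Suc L \<and> f \<in> cspace (d u) \<longrightarrow> pact d x p f = 0)"
proof -
  have "(path_matrix x (d u) p = 0\<^sub>m (d v) (d u)) \<longleftrightarrow> (\<forall>f\<in>cspace (d u). pact d x p f = 0)"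
    if x: "x \<in> tuples d" and p: "awalk u p v" for u p v
  proof -
    have P: "path_matrix x (d u) p \<in> carrier_mat (d v) (d u)" by (rule path_matrix_carrier[OF x p])
    have "path_matrix x (d u) p *\<^sub>v w = 0\<^sub>v (d v) \<longleftrightarrow> pact d x p (vf w) = 0" if w: "w \<in> carrier_vec (d u)" for w
      using vf_inject[of "path_matrix x (d u) p *\<^sub>v w" "d v" "0\<^sub>v (d v)"] P w vf_path_matrix[OF x p w]
      by (auto simp: vf_zero)
    then have "path_matrix x (d u) p = 0\<^sub>m (d v) (d u) \<longleftrightarrow> (\<forall>w\<in>carrier_vec (d u). pact d x p (vf w) = 0)"
      unfolding mat_zero_iff[OF P] by simp
    also have "\<dots> \<longleftrightarrow> (\<forall>f\<in>cspace (d u). pact d x p f = 0)"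
    proof (intro iffI ballI)
      fix f :: "nat \<Rightarrow> 'k" assume "\<forall>w\<in>carrier_vec (d u). pact d x p (vf w) = 0" "f \<in> cspace (d u)"
      then show "pact d x p f = 0" using vf_vec[of f "d u"] vec_carrier[of "d u" f] by metis
    qed (auto dest: vf_in_cspace)
    finally show ?thesis .
  qed
  note key = this
  show ?thesis
  proof
    assume "x \<in> rep_variety Q L d"
    then have "x \<in> tuples d" "\<And>u p v. awalk u p v \<Longrightarrow> length p = Suc L \<Longrightarrow> path_matrix x (d u) p = 0\<^sub>m (d v) (d u)"
      unfolding rep_variety_def tuples_def[symmetric] by auto
    then show "x \<in> tuples d \<and>
        (\<forall>u p v f. awalk u p v \<and> length p = Suc L \<and> f \<in> cspace (d u) \<longrightarrow> pact d x p f = 0)"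
      using key by blast
  next
    assume *: "x \<in> tuples d \<and>
        (\<forall>u p v f. awalk u p v \<and> length p = Suc L \<and> f \<in> cspace (d u) \<longrightarrow> pact d x p f = 0)"
    then have "\<forall>u p v. awalk u p v \<and> length p = Suc L \<longrightarrow> path_matrix x (d u) p = 0\<^sub>m (d v) (d u)"
      using key by blast
    then show "x \<in> rep_variety Q L d"
      using * unfolding rep_variety_def tuples_def[symmetric] by blast
  qed
qed

end

section \<open>Representations as modules\<close>

context quiver
begin

definition graded :: "('v \<Rightarrow> nat) \<Rightarrow> ('v \<Rightarrow> (nat \<Rightarrow> 'k::field) set) \<Rightarrow> bool" where
  "graded d W \<longleftrightarrow> (\<forall>v\<in>verts Q. fs.subspace (W v) \<and> W v \<subseteq> cspace (d v))"

definition stable :: "('v \<Rightarrow> nat) \<Rightarrow> ('a \<Rightarrow> 'k::field mat) \<Rightarrow> ('v \<Rightarrow> (nat \<Rightarrow> 'k) set) \<Rightarrow> bool" where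
  "stable d x W \<longleftrightarrow> (\<forall>a\<in>arcs Q. act d x a ` W (tail Q a) \<subseteq> W (head Q a))"

lemma stable_pact:
  assumes "stable d x W" "awalk u p v" "f \<in> W u"
  shows "pact d x p f \<in> W v"
  using assms(2,3)
proof (induction p arbitrary: u f)
  case Nil
  then show ?case by (simp add: awalk_Nil_iff)
next
  case (Cons a p)
  then have "a \<in> arcs Q" "u = tail Q a" "awalk (head Q a) p v" by (auto simp: awalk_simps)
  moreover from this have "act d x a f \<in> W (head Q a)"
    using assms(1) Cons.prems unfolding stable_def by blast
  ultimately show ?case using Cons.IH by (simp add: pact_Cons)
qed

text \<open>The component at \<open>v\<close> of J^l M, as \<open>radical_power_eq\<close> confirms.
  The recursion runs over arrows because they generate the radical.\<close>

primrec rad :: "('v \<Rightarrow> nat) \<Rightarrow> ('a \<Rightarrow> 'k::field mat) \<Rightarrow> nat \<Rightarrow> 'v \<Rightarrow> (nat \<Rightarrow> 'k) set" where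
  "rad d x 0 = (\<lambda>v. cspace (d v))"
| "rad d x (Suc l) = (\<lambda>v. fs.span (\<Union>a\<in>{a\<in>arcs Q. head Q a = v}. act d x a ` rad d x l (tail Q a)))"

lemma rad_subspace: "fs.subspace (rad d x l v)"
  by (cases l) (auto simp: subspace_cspace)

lemma rad_act: "a \<in> arcs Q \<Longrightarrow> f \<in> rad d x l (tail Q a) \<Longrightarrow> act d x a f \<in> rad d x (Suc l) (head Q a)"
  by (auto intro!: fs.span_base)

lemma rad_Suc_subset: "rad d x (Suc l) v \<subseteq> rad d x l v"
proof (induction l arbitrary: v)
  case 0
  have "act d x a f \<in> cspace (d (head Q a))" for a f by (rule act_in_cspace)
  then have "(\<Union>a\<in>{a\<in>arcs Q. head Q a = v}. act d x a ` cspace (d (tail Q a))) \<subseteq> cspace (d v)" by auto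
  then show ?case unfolding rad.simps by (rule fs.span_minimal[OF _ subspace_cspace])
next
  case (Suc l)
  have "fs.span (\<Union>a\<in>{a \<in> arcs Q. head Q a = v}. act d x a ` rad d x (Suc l) (tail Q a)) \<subseteq>
    fs.span (\<Union>a\<in>{a \<in> arcs Q. head Q a = v}. act d x a ` rad d x l (tail Q a))"
    using Suc by (intro fs.span_mono UN_mono image_mono) auto
  then show ?case by simp
qed

lemma rad_antimono: "l \<le> m \<Longrightarrow> rad d x m v \<subseteq> rad d x l v"
  by (induction rule: dec_induct) (use rad_Suc_subset in blast)+

lemma graded_rad: "graded d (rad d x l)"
  unfolding graded_def using rad_antimono[of 0 l d x] by (intro ballI conjI rad_subspace) simp

lemma stable_rad: "stable d x (rad d x l)"
  unfolding stable_def using rad_act rad_Suc_subset by blast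

lemma rad_pact:
  assumes "awalk u p v" "f \<in> rad d x l u"
  shows "pact d x p f \<in> rad d x (l + length p) v"
  using assms
proof (induction p arbitrary: u f l)
  case Nil
  then show ?case by (simp add: awalk_Nil_iff)
next
  case (Cons a p)
  then have "a \<in> arcs Q" "u = tail Q a" "awalk (head Q a) p v" by (auto simp: awalk_simps)
  moreover from this have "act d x a f \<in> rad d x (Suc l) (head Q a)"
    using Cons.prems by (intro rad_act) auto
  ultimately show ?case using Cons.IH[of "head Q a" "act d x a f" "Suc l"]
    by (simp add: pact_Cons del: rad.simps)
qed

text \<open>Unrolls the recursion. Paths of length exactly \<open>l\<close> suffice here, although
  the \<open>l\<close>-th power of the radical also contains longer ones.\<close>

lemma rad_subset_span:
  assumes "v \<in> verts Q"
  shows "rad d x l v \<subseteq> fs.span {pact d x p f | u p f. awalk u p v \<and> length p = l \<and> f \<in> cspace (d u)}"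
  using assms
proof (induction l arbitrary: v)
  case 0
  have "f \<in> {pact d x p f | u p f. awalk u p v \<and> length p = 0 \<and> f \<in> cspace (d u)}" if "f \<in> cspace (d v)" for f
    using that 0 by (intro CollectI exI[of _ v] exI[of _ "[]"] exI[of _ f]) (simp add: awalk_Nil_iff)
  then show ?case by (auto intro!: fs.span_base)
next
  case (Suc l)
  let ?P = "\<lambda>l v. {pact d x p f | u p f. awalk u p v \<and> length p = l \<and> f \<in> cspace (d u)}"
  have "act d x a f \<in> fs.span (?P (Suc l) v)"
    if a: "a \<in> arcs Q" "head Q a = v" and f: "f \<in> rad d x l (tail Q a)" for a f
  proof -
    interpret A: Vector_Spaces.linear fscale fscale "act d x a" by (rule linear_act)
    have "f \<in> fs.span (?P l (tail Q a))" using Suc.IH[of "tail Q a"] a f by auto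
    then have "act d x a f \<in> act d x a ` fs.span (?P l (tail Q a))" by (rule imageI)
    also have "\<dots> = fs.span (act d x a ` ?P l (tail Q a))" by (rule A.span_image[symmetric])
    also have "\<dots> \<subseteq> fs.span (?P (Suc l) v)"
    proof (intro fs.span_mono subsetI)
      fix g assume "g \<in> act d x a ` ?P l (tail Q a)"
      then obtain u p f where *: "g = act d x a (pact d x p f)" "awalk u p (tail Q a)" "length p = l" "f \<in> cspace (d u)"
        by blast
      then have "awalk u (p @ [a]) v" using a by (auto simp: awalk_simps)
      moreover have "g = pact d x (p @ [a]) f" using * by (simp add: pact_append pact_Cons)
      ultimately show "g \<in> ?P (Suc l) v" using * by (intro CollectI exI[of _ u] exI[of _ "p @ [a]"] exI[of _ f]) simp
    qed
    finally show ?thesis .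
  qed
  then have "(\<Union>a\<in>{a \<in> arcs Q. head Q a = v}. act d x a ` rad d x l (tail Q a)) \<subseteq> fs.span (?P (Suc l) v)"
    by blast
  then show ?case unfolding rad.simps by (rule fs.span_minimal) (rule fs.subspace_span)
qed

end

locale rep = trunc Q L for Q :: "('v, 'a) pre_digraph" and L :: nat +
  fixes d :: "'v \<Rightarrow> nat" and x :: "'a \<Rightarrow> 'k::field mat"
  assumes x: "x \<in> rep_variety Q L d"
begin

abbreviation M :: "((('v, 'a) path \<Rightarrow> 'k) set, 'v \<Rightarrow> 'k vec) module" where
  "M \<equiv> rep_module Q d x"

section \<open>Components of the module of a point, and its submodules\<close>

definition cp :: "('v \<Rightarrow> 'k vec) \<Rightarrow> 'v \<Rightarrow> nat \<Rightarrow> 'k" where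
  "cp m v = vf (m v)"

definition mk :: "('v \<Rightarrow> nat \<Rightarrow> 'k) \<Rightarrow> 'v \<Rightarrow> 'k vec" where
  "mk f = (\<lambda>v\<in>verts Q. vec (d v) (f v))"

definition sub :: "('v \<Rightarrow> (nat \<Rightarrow> 'k) set) \<Rightarrow> ('v \<Rightarrow> 'k vec) set" where
  "sub W = {m \<in> carrier M. \<forall>v\<in>verts Q. cp m v \<in> W v}"

lemma x_tuples: "x \<in> tuples d"
  using x rep_variety_iff by blast

lemma M_simps:
  "carrier M = (\<Pi>\<^sub>E v\<in>verts Q. carrier_vec (d v))"
  "\<zero>\<^bsub>M\<^esub> = (\<lambda>v\<in>verts Q. 0\<^sub>v (d v))"
  "m \<oplus>\<^bsub>M\<^esub> m' = (\<lambda>v\<in>verts Q. m v + m' v)"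
  "A \<odot>\<^bsub>M\<^esub> m = the_elem ((\<lambda>f. path_action Q d x f m) ` A)"
  by (simp_all add: rep_module_def)

lemma cp_in_cspace: "m \<in> carrier M \<Longrightarrow> v \<in> verts Q \<Longrightarrow> cp m v \<in> cspace (d v)"
  unfolding cp_def by (rule vf_in_cspace) (auto simp: M_simps)

lemma M_eqI:
  assumes "m \<in> carrier M" "m' \<in> carrier M" "\<And>v. v \<in> verts Q \<Longrightarrow> cp m v = cp m' v"
  shows "m = m'"
  using assms unfolding M_simps cp_def
  by (intro PiE_ext[of m "verts Q" _ m']) (auto simp: PiE_iff vf_inject[symmetric])

lemma mk_carrier: "mk f \<in> carrier M"
  by (auto simp: mk_def M_simps)

lemma cp_mk: "v \<in> verts Q \<Longrightarrow> f v \<in> cspace (d v) \<Longrightarrow> cp (mk f) v = f v"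
  by (simp add: mk_def cp_def vf_vec)

lemma add_M_carrier: "m \<in> carrier M \<Longrightarrow> m' \<in> carrier M \<Longrightarrow> m \<oplus>\<^bsub>M\<^esub> m' \<in> carrier M"
  by (auto simp: M_simps PiE_iff)

lemma zero_M_carrier: "\<zero>\<^bsub>M\<^esub> \<in> carrier M"
  by (auto simp: M_simps)

lemma cp_add: "m \<in> carrier M \<Longrightarrow> m' \<in> carrier M \<Longrightarrow> v \<in> verts Q \<Longrightarrow> cp (m \<oplus>\<^bsub>M\<^esub> m') v = cp m v + cp m' v"
  by (auto simp: M_simps cp_def intro!: vf_add)

lemma cp_zero: "v \<in> verts Q \<Longrightarrow> cp \<zero>\<^bsub>M\<^esub> v = 0"
  by (simp add: M_simps cp_def vf_zero)

text \<open>Longer paths act as zero, so this one finite set indexes the action of every element of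
  the algebra.\<close>

definition short_paths :: "('v, 'a) path set" where
  "short_paths = {(u, p). (u, p) \<in> paths Q \<and> length p \<le> L}"

lemma finite_short_paths: "finite short_paths"
proof -
  have "short_paths \<subseteq> verts Q \<times> {p. set p \<subseteq> arcs Q \<and> length p \<le> L}"
    by (auto simp: short_paths_def paths_iff awalk_def)
  then show ?thesis
    by (rule finite_subset) (intro finite_cartesian_product finite_verts finite_lists_length_le finite_arcs)
qed

lemma pact_long:
  assumes "(u, p) \<in> paths Q" "L < length p" "f \<in> cspace (d u)"
  shows "pact d x p f = 0"
proof -
  have p: "p = take (Suc L) p @ drop (Suc L) p" by simp
  have "(u, take (Suc L) p) \<in> paths Q" using paths_take_drop assms(1) by blast
  then have "pact d x (take (Suc L) p) f = 0"
    using assms x unfolding rep_variety_iff paths_iff by force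
  then show ?thesis
    by (subst p, subst pact_append) (simp add: pact_zero)
qed

definition actF :: "(('v, 'a) path \<Rightarrow> 'k) \<Rightarrow> ('v \<Rightarrow> 'k vec) \<Rightarrow> 'v \<Rightarrow> nat \<Rightarrow> 'k" where
  "actF f m v = (\<Sum>q\<in>{q \<in> short_paths. awlast (fst q) (snd q) = v}. fscale (f q) (pact d x (snd q) (cp m (fst q))))"

lemma path_action_carrier: "path_action Q d x f m \<in> carrier M"
  by (auto simp: path_action_def M_simps)

lemma path_in_cspace:
  assumes "(u, p) \<in> paths Q" "m \<in> carrier M"
  shows "pact d x p (cp m u) \<in> cspace (d (awlast u p))"
proof -
  have w: "awalk u p (awlast u p)" using assms(1) by (simp add: paths_iff)
  then show ?thesis using awalk_hd_in_verts[OF w] assms(2) by (intro pact_in_cspace[OF w] cp_in_cspace)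
qed

lemma cp_path_action:
  assumes f: "f \<in> carrier KQ" and m: "m \<in> carrier M" and v: "v \<in> verts Q"
  shows "cp (path_action Q d x f m) v = actF f m v"
proof
  fix r
  let ?S = "{(u, p). f (u, p) \<noteq> 0 \<and> awlast u p = v}"
  let ?T = "{q \<in> short_paths. awlast (fst q) (snd q) = v}"
  have "?S \<subseteq> {q. f q \<noteq> 0}" "finite {q. f q \<noteq> 0}" using f by (auto simp: KQ_simps)
  then have fin: "finite ?S" "finite ?T"
    using finite_short_paths finite_subset by auto
  have Sp: "(u, p) \<in> paths Q" if "(u, p) \<in> ?S" for u p using that f by (auto simp: KQ_simps)
  have ucs: "cp m u \<in> cspace (d u)" if "(u, p) \<in> paths Q" for u p
    using that m awalk_hd_in_verts unfolding paths_iff by (blast intro: cp_in_cspace)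
  show "cp (path_action Q d x f m) v r = actF f m v r"
  proof (cases "r < d v")
    case True
    have "cp (path_action Q d x f m) v r = (\<Sum>(u, p)\<in>?S. f (u, p) * (path_matrix x (d u) p *\<^sub>v m u) $ r)"
      using v True by (simp add: cp_def vf_def path_action_def)
    also have "\<dots> = (\<Sum>(u, p)\<in>?S. f (u, p) * pact d x p (cp m u) r)"
    proof (intro sum.cong refl, clarify)
      fix u p assume *: "f (u, p) \<noteq> 0" "v = awlast u p"
      then have w: "awalk u p v" using Sp[of u p] by (auto simp: paths_iff)
      then have mu: "m u \<in> carrier_vec (d u)" using m awalk_hd_in_verts by (auto simp: M_simps)
      have "path_matrix x (d u) p *\<^sub>v m u \<in> carrier_vec (d v)"
        using path_matrix_carrier[OF x_tuples w] mu by (rule mult_mat_vec_carrier)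
      then have "(path_matrix x (d u) p *\<^sub>v m u) $ r = vf (path_matrix x (d u) p *\<^sub>v m u) r"
        using True by (metis carrier_vecD vf_def)
      then show "f (u, p) * (path_matrix x (d u) p *\<^sub>v m u) $ r = f (u, p) * pact d x p (cp m u) r"
        using vf_path_matrix[OF x_tuples w mu] by (simp add: cp_def)
    qed
    also have "\<dots> = (\<Sum>q\<in>?S. f q * pact d x (snd q) (cp m (fst q)) r)"
      by (intro sum.cong) auto
    also have "\<dots> = (\<Sum>q\<in>?S \<inter> ?T. f q * pact d x (snd q) (cp m (fst q)) r)"
    proof (rule sum.mono_neutral_right[OF fin(1)])
      show "\<forall>q\<in>?S - ?S \<inter> ?T. f q * pact d x (snd q) (cp m (fst q)) r = 0"
      proof
        fix q assume q: "q \<in> ?S - ?S \<inter> ?T"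
        obtain u p where up: "q = (u, p)" by (cases q)
        have *: "f (u, p) \<noteq> 0" "v = awlast u p" "(u, p) \<notin> short_paths" using q up by auto
        then have P: "(u, p) \<in> paths Q" using Sp by auto
        moreover have "L < length p" using * P by (auto simp: short_paths_def)
        ultimately have "pact d x p (cp m u) = 0" using ucs pact_long by blast
        then show "f q * pact d x (snd q) (cp m (fst q)) r = 0" by (simp add: up fun_apply)
      qed
    qed auto
    also have "\<dots> = (\<Sum>q\<in>?T. f q * pact d x (snd q) (cp m (fst q)) r)"
      by (rule sum.mono_neutral_left[OF fin(2)]) auto
    also have "\<dots> = actF f m v r"
      by (simp add: actF_def sum_fun_apply fscale_apply)
    finally show ?thesis .
  next
    case False
    have "actF f m v \<in> cspace (d v)"
      unfolding actF_def using path_in_cspace m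
      by (intro fs.subspace_sum[OF subspace_cspace] fs.subspace_scale[OF subspace_cspace])
        (auto simp: short_paths_def)
    moreover have "cp (path_action Q d x f m) v \<in> cspace (d v)"
      by (rule cp_in_cspace[OF path_action_carrier v])
    ultimately show ?thesis using False by (simp add: cspace_def)
  qed
qed

text \<open>Representatives of a class agree on the short paths, and longer paths act as zero; hence
  \<open>the_elem\<close> is applied to a singleton.\<close>

lemma smult_cls:
  assumes f: "f \<in> carrier KQ" and m: "m \<in> carrier M"
  shows "cls f \<odot>\<^bsub>M\<^esub> m = path_action Q d x f m"
proof -
  have "path_action Q d x g m = path_action Q d x f m" if g: "g \<in> cls f" for g
  proof -
    obtain h where h: "h \<in> long_ideal (Suc L)" "g = (\<lambda>p. h p + f p)" using g by (auto simp: mem_cls)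
    then have gc: "g \<in> carrier KQ" using f by (auto simp: long_ideal_def intro: add_carrier)
    have "g q = f q" if "q \<in> short_paths" for q
      using h that by (cases q) (force simp: long_ideal_def short_paths_def)
    then have "actF g m v = actF f m v" for v
      unfolding actF_def by (intro sum.cong) auto
    then show ?thesis
      using gc f m by (intro M_eqI path_action_carrier) (simp add: cp_path_action)
  qed
  then have "(\<lambda>g. path_action Q d x g m) ` cls f = {path_action Q d x f m}"
    using cls_self by blast
  then show ?thesis by (simp add: M_simps)
qed

lemma smult_carrier: "f \<in> carrier KQ \<Longrightarrow> m \<in> carrier M \<Longrightarrow> cls f \<odot>\<^bsub>M\<^esub> m \<in> carrier M"
  by (simp add: smult_cls path_action_carrier)

lemma cp_smult:
  "f \<in> carrier KQ \<Longrightarrow> m \<in> carrier M \<Longrightarrow> v \<in> verts Q \<Longrightarrow> cp (cls f \<odot>\<^bsub>M\<^esub> m) v = actF f m v"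
  by (simp add: smult_cls cp_path_action)

lemma actF_single:
  assumes "(u, p) \<in> paths Q" "m \<in> carrier M"
  shows "actF (single c (u, p)) m v = (if awlast u p = v then fscale c (pact d x p (cp m u)) else 0)"
proof -
  let ?T = "{q \<in> short_paths. awlast (fst q) (snd q) = v}"
  have fin: "finite ?T" using finite_short_paths by (auto elim!: finite_subset[rotated])
  have "actF (single c (u, p)) m v = (\<Sum>q\<in>?T. if q = (u, p) then fscale c (pact d x p (cp m u)) else 0)"
    unfolding actF_def by (intro sum.cong) (auto simp: single_def)
  also have "\<dots> = (if (u, p) \<in> ?T then fscale c (pact d x p (cp m u)) else 0)"
    using fin by simp
  also have "\<dots> = (if awlast u p = v then fscale c (pact d x p (cp m u)) else 0)"
  proof (cases "length p \<le> L")
    case True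
    then show ?thesis using assms by (auto simp: short_paths_def)
  next
    case False
    have "u \<in> verts Q" using assms(1) awalk_hd_in_verts unfolding paths_iff by blast
    then have "pact d x p (cp m u) = 0"
      using False pact_long[OF assms(1) _ cp_in_cspace[OF assms(2)]] by simp
    then show ?thesis by simp
  qed
  finally show ?thesis .
qed

lemma group_M: "group (add_monoid M)"
proof (rule groupI, goal_cases)
  case (1 m m')
  then show ?case using add_M_carrier by simp
next
  case 2
  then show ?case using zero_M_carrier by simp
next
  case (3 m m' m'')
  then show ?case by (simp, intro M_eqI) (simp_all add: add_M_carrier cp_add add.assoc)
next
  case (4 m)
  then show ?case by (simp, intro M_eqI) (simp_all add: add_M_carrier zero_M_carrier cp_add cp_zero)
next
  case (5 m)
  let ?m = "mk (\<lambda>v. fscale (- 1) (cp m v))"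
  have m: "m \<in> carrier M" using 5 by simp
  have "fscale (- 1) (cp m v) \<in> cspace (d v)" if "v \<in> verts Q" for v
    using cp_in_cspace[OF m that] by (rule fs.subspace_scale[OF subspace_cspace])
  then have "?m \<oplus>\<^bsub>M\<^esub> m = \<zero>\<^bsub>M\<^esub>"
    using m by (intro M_eqI) (simp_all add: add_M_carrier mk_carrier zero_M_carrier cp_add cp_zero cp_mk)
  then show ?case using mk_carrier by auto
qed

lemma inv_M:
  assumes "m \<in> carrier M"
  shows "inv\<^bsub>add_monoid M\<^esub> m = mk (\<lambda>v. fscale (- 1) (cp m v))"
proof -
  let ?m = "mk (\<lambda>v. fscale (- 1) (cp m v))"
  have "fscale (- 1) (cp m v) \<in> cspace (d v)" if "v \<in> verts Q" for v
    using cp_in_cspace[OF assms that] by (rule fs.subspace_scale[OF subspace_cspace])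
  then have "?m \<oplus>\<^bsub>M\<^esub> m = \<zero>\<^bsub>M\<^esub>"
    using assms by (intro M_eqI) (simp_all add: add_M_carrier mk_carrier zero_M_carrier cp_add cp_zero cp_mk)
  then show ?thesis using group.inv_equality[OF group_M, of ?m m] assms mk_carrier by simp
qed

definition incl :: "'v \<Rightarrow> (nat \<Rightarrow> 'k) \<Rightarrow> 'v \<Rightarrow> 'k vec" where
  "incl v w = mk (\<lambda>u. if u = v then w else 0)"

lemma cp_incl: "u \<in> verts Q \<Longrightarrow> w \<in> cspace (d v) \<Longrightarrow> cp (incl v w) u = (if u = v then w else 0)"
  unfolding incl_def by (subst cp_mk) (auto simp: fs.subspace_0[OF subspace_cspace])

lemma incl_carrier: "incl v w \<in> carrier M"
  unfolding incl_def by (rule mk_carrier)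

text \<open>Vectors concentrated at single vertices generate \<open>sub W\<close> additively; an
  element is assembled from them one vertex at a time.\<close>

lemma sub_induct:
  assumes zero: "\<zero>\<^bsub>M\<^esub> \<in> P"
    and add: "\<And>m m'. m \<in> P \<Longrightarrow> m' \<in> P \<Longrightarrow> m \<oplus>\<^bsub>M\<^esub> m' \<in> P"
    and incl: "\<And>v w. v \<in> verts Q \<Longrightarrow> w \<in> W v \<Longrightarrow> w \<in> cspace (d v) \<Longrightarrow> incl v w \<in> P"
  shows "sub W \<subseteq> P"
proof
  fix m assume m: "m \<in> sub W"
  then have mc: "m \<in> carrier M" by (simp add: sub_def)
  let ?m = "\<lambda>A. mk (\<lambda>v. if v \<in> A then cp m v else 0)"
  have in_cs: "(if v \<in> A then cp m v else 0) \<in> cspace (d v)" if "v \<in> verts Q" for v A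
    using cp_in_cspace[OF mc that] by (auto simp: fs.subspace_0[OF subspace_cspace])
  have cpA: "cp (?m A) v = (if v \<in> A then cp m v else 0)" if "v \<in> verts Q" for v A
    by (rule cp_mk[of v "\<lambda>v. if v \<in> A then cp m v else 0", OF that in_cs[OF that]])
  have "?m A \<in> P" if "finite A" "A \<subseteq> verts Q" for A
    using that
  proof (induction A rule: finite_induct)
    case empty
    have "?m {} = \<zero>\<^bsub>M\<^esub>"
      by (intro M_eqI mk_carrier zero_M_carrier) (simp add: cp_mk cp_zero fs.subspace_0[OF subspace_cspace])
    then show ?case using zero by simp
  next
    case (insert v A)
    have v: "v \<in> verts Q" "cp m v \<in> W v" using insert.prems m by (auto simp: sub_def)
    have "?m (insert v A) = ?m A \<oplus>\<^bsub>M\<^esub> incl v (cp m v)"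
    proof (rule M_eqI)
      fix u assume u: "u \<in> verts Q"
      show "cp (?m (insert v A)) u = cp (?m A \<oplus>\<^bsub>M\<^esub> incl v (cp m v)) u"
        unfolding cp_add[OF mk_carrier incl_carrier u] cp_incl[OF u cp_in_cspace[OF mc v(1)]] cpA[OF u]
        using insert.hyps by auto
    qed (auto intro: mk_carrier incl_carrier add_M_carrier)
    moreover have "incl v (cp m v) \<in> P" by (intro incl v cp_in_cspace mc)
    ultimately show ?case using insert add by simp
  qed
  from this[OF finite_verts] have "?m (verts Q) \<in> P" by simp
  moreover have "?m (verts Q) = m"
    using in_cs by (intro M_eqI mk_carrier mc) (simp add: cp_mk cp_in_cspace[OF mc])
  ultimately show "m \<in> P" by simp
qed

lemma subgroup_sub:
  assumes "graded d W"
  shows "subgroup (sub W) (add_monoid M)"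
proof (rule group.subgroupI[OF group_M], goal_cases)
  case 1
  then show ?case by (auto simp: sub_def)
next
  case 2
  have "\<zero>\<^bsub>M\<^esub> \<in> sub W"
    using assms by (auto simp: sub_def zero_M_carrier cp_zero graded_def fs.subspace_0)
  then show ?case by blast
next
  case (3 m)
  then have m: "m \<in> carrier M" "\<And>v. v \<in> verts Q \<Longrightarrow> cp m v \<in> W v" by (auto simp: sub_def)
  have W: "fscale (- 1) (cp m v) \<in> W v" "fscale (- 1) (cp m v) \<in> cspace (d v)" if "v \<in> verts Q" for v
    using assms that m(2)[OF that] unfolding graded_def by (meson fs.subspace_scale subsetD)+
  then show ?case unfolding inv_M[OF m(1)] by (auto simp: sub_def mk_carrier cp_mk simp del: fs.scale_minus_left)
next
  case (4 m m')
  then show ?case using assms by (auto simp: sub_def add_M_carrier cp_add graded_def fs.subspace_add)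
qed

lemma actF_in:
  assumes "graded d W" "stable d x W" "m \<in> sub W" "v \<in> verts Q"
  shows "actF f m v \<in> W v"
  unfolding actF_def
proof (intro fs.subspace_sum fs.subspace_scale)
  show W: "fs.subspace (W v)" "fs.subspace (W v)" using assms by (auto simp: graded_def)
  fix q assume "q \<in> {q \<in> short_paths. awlast (fst q) (snd q) = v}"
  then have w: "awalk (fst q) (snd q) v" by (auto simp: short_paths_def paths_iff)
  then have "cp m (fst q) \<in> W (fst q)" using assms(3) awalk_hd_in_verts by (auto simp: sub_def)
  then show "pact d x (snd q) (cp m (fst q)) \<in> W v" by (rule stable_pact[OF assms(2) w])
qed

lemma submodule_sub:
  assumes "graded d W" "stable d x W"
  shows "submodule (sub W) \<Lambda> M"
proof (intro submodule.intro submodule_axioms.intro subgroup_sub assms(1))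
  fix A m assume "A \<in> carrier (\<Lambda> :: (('v, 'a) path \<Rightarrow> 'k) set ring)" and m: "m \<in> sub W"
  then obtain f where f: "A = cls f" "f \<in> carrier KQ" by (auto simp: carrier_\<Lambda>)
  have mc: "m \<in> carrier M" using m by (simp add: sub_def)
  show "A \<odot>\<^bsub>M\<^esub> m \<in> sub W"
    using f mc actF_in[OF assms m] by (auto simp: sub_def smult_carrier cp_smult)
qed

text \<open>Trivial paths act as the projections to the vertices. A submodule therefore contains the
  components of its elements and is the direct sum of its parts at the vertices.\<close>

lemma submodule_is_sub:
  assumes U: "submodule U \<Lambda> M"
  shows "\<exists>W. graded d W \<and> stable d x W \<and> U = sub W"
proof -
  interpret U: submodule U \<Lambda> M by (rule U)
  have Uc: "m \<in> carrier M" if "m \<in> U" for m using U.subset that by auto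
  have Uadd: "m \<oplus>\<^bsub>M\<^esub> m' \<in> U" if "m \<in> U" "m' \<in> U" for m m' using U.m_closed[OF that] by simp
  have Uzero: "\<zero>\<^bsub>M\<^esub> \<in> U" using U.one_closed by simp
  have Usm: "cls f \<odot>\<^bsub>M\<^esub> m \<in> U" if "f \<in> carrier KQ" "m \<in> U" for f m
    using that by (auto simp: carrier_\<Lambda>)
  define W where "W = (\<lambda>v. (\<lambda>m. cp m v) ` U)"
  \<comment> \<open>Multiplication by a multiple of one path. Trivial paths will give projections
    and scalars, arrows will give stability.\<close>
  have single: "\<exists>m'\<in>U. \<forall>v\<in>verts Q. cp m' v = (if awlast u p = v then fscale c (pact d x p (cp m u)) else 0)"
    if "m \<in> U" "(u, p) \<in> paths Q" for c m u p
    using Usm[OF single_carrier[OF that(2), of c] that(1)] that Uc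
    by (intro bexI[of _ "cls (single c (u, p)) \<odot>\<^bsub>M\<^esub> m"]) (auto simp: cp_smult single_carrier actF_single)
  have "graded d W"
    unfolding graded_def
  proof (intro ballI conjI)
    fix v assume v: "v \<in> verts Q"
    show "fs.subspace (W v)"
      unfolding fs.subspace_def
    proof (intro conjI allI impI ballI)
      show "0 \<in> W v" using cp_zero[OF v] Uzero by (force simp: W_def)
      fix f g assume f: "f \<in> W v"
      then obtain m where m: "m \<in> U" "f = cp m v" by (auto simp: W_def)
      show "f + g \<in> W v" if "g \<in> W v"
      proof -
        obtain m' where m': "m' \<in> U" "g = cp m' v" using \<open>g \<in> W v\<close> by (auto simp: W_def)
        have "f + g = cp (m \<oplus>\<^bsub>M\<^esub> m') v" using m m' v Uc by (simp add: cp_add)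
        then show ?thesis using Uadd[OF m(1) m'(1)] by (auto simp: W_def)
      qed
      show "fscale c f \<in> W v" for c
      proof -
        obtain m' where "m' \<in> U" "cp m' v = fscale c f"
          using single[OF m(1), of v "[]" c] v m by (auto simp: paths_Nil)
        then show ?thesis by (force simp: W_def)
      qed
    qed
    show "W v \<subseteq> cspace (d v)" using v Uc by (auto simp: W_def intro: cp_in_cspace)
  qed
  moreover have "stable d x W"
    unfolding stable_def
  proof (intro ballI subsetI)
    fix a g assume a: "a \<in> arcs Q" and "g \<in> act d x a ` W (tail Q a)"
    then obtain m where m: "m \<in> U" "g = act d x a (cp m (tail Q a))" by (auto simp: W_def)
    have "(tail Q a, [a]) \<in> paths Q" using a by (simp add: paths_iff awalk_simps)
    from single[OF m(1) this, of 1] a obtain m' where "m' \<in> U" "cp m' (head Q a) = g"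
      by (auto simp: m pact_Cons)
    then show "g \<in> W (head Q a)" by (force simp: W_def)
  qed
  moreover have "U = sub W"
  proof
    show "U \<subseteq> sub W" using Uc by (auto simp: sub_def W_def)
    show "sub W \<subseteq> U"
    proof (rule sub_induct)
      fix v w assume v: "v \<in> verts Q" and w: "w \<in> W v" "w \<in> cspace (d v)"
      then obtain m where m: "m \<in> U" "w = cp m v" by (auto simp: W_def)
      from single[OF m(1), of v "[]" 1] v obtain m' where
        m': "m' \<in> U" "\<forall>u\<in>verts Q. cp m' u = (if v = u then w else 0)" by (auto simp: paths_Nil m)
      have "m' = incl v w"
        using m' Uc w by (intro M_eqI incl_carrier) (auto simp: cp_incl)
      then show "incl v w \<in> U" using m' by simp
    qed (auto intro: Uzero Uadd)
  qed
  ultimately show ?thesis by blast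
qed

lemma sub_subset_iff:
  assumes "graded d W" 
  shows "sub W \<subseteq> sub W' \<longleftrightarrow> (\<forall>v\<in>verts Q. W v \<subseteq> W' v)"
proof
  assume *: "sub W \<subseteq> sub W'"
  show "\<forall>v\<in>verts Q. W v \<subseteq> W' v"
  proof (intro ballI subsetI)
    fix v w assume v: "v \<in> verts Q" "w \<in> W v"
    then have w: "w \<in> cspace (d v)" using assms by (auto simp: graded_def)
    have "incl v w \<in> sub W"
      using assms v w by (auto simp: sub_def incl_carrier cp_incl graded_def fs.subspace_0)
    then have "cp (incl v w) v \<in> W' v" using * v by (auto simp: sub_def)
    then show "w \<in> W' v" using v w by (simp add: cp_incl)
  qed
qed (auto simp: sub_def)

lemma sub_eq_iff:
  assumes "graded d W" "graded d W'"
  shows "sub W = sub W' \<longleftrightarrow> (\<forall>v\<in>verts Q. W v = W' v)"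
  using sub_subset_iff[OF assms(1), of W'] sub_subset_iff[OF assms(2), of W] by blast

lemma sub_UNIV: "sub (\<lambda>v. cspace (d v)) = carrier M"
  by (auto simp: sub_def cp_in_cspace)

lemma sub_zero: "sub (\<lambda>v. {0}) = {\<zero>\<^bsub>M\<^esub>}"
  by (auto simp: sub_def zero_M_carrier cp_zero intro!: M_eqI)

text \<open>An element supported on paths of length at least \<open>l\<close> maps every vector into
  \<open>rad d x l\<close>. Conversely a path of length \<open>l\<close>, applied to a vector
  concentrated at its start, is one of the generators of the radical power.\<close>

lemma radical_power_eq: "radical_power \<Lambda> M l = sub (rad d x l)"
proof
  let ?G = "{a \<odot>\<^bsub>M\<^esub> m | a m. a \<in> cls ` (long_ideal l :: (('v, 'a) path \<Rightarrow> 'k) set) \<and> m \<in> carrier M}"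
  have rp: "radical_power \<Lambda> M l = generate (add_monoid M) ?G"
    unfolding radical_power_def ideal_times_module_def ideal_power_eq ..
  have "?G \<subseteq> sub (rad d x l)"
  proof clarify
    fix f :: "('v, 'a) path \<Rightarrow> 'k" and m
    assume f: "f \<in> long_ideal l" and m: "m \<in> carrier M"
    have fc: "f \<in> carrier KQ" using f by (auto simp: long_ideal_def)
    have "actF f m v \<in> rad d x l v" if "v \<in> verts Q" for v
      unfolding actF_def
    proof (intro fs.subspace_sum rad_subspace)
      fix q assume "q \<in> {q \<in> short_paths. awlast (fst q) (snd q) = v}"
      then have w: "awalk (fst q) (snd q) v" by (auto simp: short_paths_def paths_iff)
      show "fscale (f q) (pact d x (snd q) (cp m (fst q))) \<in> rad d x l v"
      proof (cases "f q = 0")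
        case True
        then show ?thesis by (simp add: fs.subspace_0[OF rad_subspace])
      next
        case False
        then have "l \<le> length (snd q)" using f by (cases q) (auto simp: long_ideal_def)
        moreover have "cp m (fst q) \<in> rad d x 0 (fst q)"
          using awalk_hd_in_verts[OF w] m by (simp add: cp_in_cspace)
        ultimately show ?thesis
          using rad_pact[OF w, of "cp m (fst q)" d x 0] rad_antimono[of l "length (snd q)" d x v]
          by (intro fs.subspace_scale rad_subspace) auto
      qed
    qed
    then show "cls f \<odot>\<^bsub>M\<^esub> m \<in> sub (rad d x l)"
      using fc m by (auto simp: sub_def smult_carrier cp_smult)
  qed
  then show "radical_power \<Lambda> M l \<subseteq> sub (rad d x l)"
    unfolding rp using group.generate_subgroup_incl[OF group_M _ subgroup_sub[OF graded_rad]] by blast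
  have Gc: "?G \<subseteq> carrier (add_monoid M)"
    by (auto simp: long_ideal_def smult_carrier)
  interpret P: subgroup "radical_power \<Lambda> M l" "add_monoid M"
    unfolding rp by (rule group.generate_is_subgroup[OF group_M Gc])
  have Padd: "m \<oplus>\<^bsub>M\<^esub> m' \<in> radical_power \<Lambda> M l"
    if "m \<in> radical_power \<Lambda> M l" "m' \<in> radical_power \<Lambda> M l" for m m' using P.m_closed[OF that] by simp
  have Pzero: "\<zero>\<^bsub>M\<^esub> \<in> radical_power \<Lambda> M l" using P.one_closed by simp
  show "sub (rad d x l) \<subseteq> radical_power \<Lambda> M l"
  proof (rule sub_induct)
    fix v w assume v: "v \<in> verts Q" and w: "w \<in> rad d x l v"
    then have "w \<in> fs.span {pact d x p f | u p f. awalk u p v \<and> length p = l \<and> f \<in> cspace (d u)}"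
      using rad_subset_span by blast
    then have "w \<in> cspace (d v) \<and> incl v w \<in> radical_power \<Lambda> M l"
    proof (induction rule: fs.span_induct_alt)
      case base
      have "incl v 0 = \<zero>\<^bsub>M\<^esub>"
        by (intro M_eqI incl_carrier zero_M_carrier) (simp add: cp_incl cp_zero fs.subspace_0[OF subspace_cspace])
      then show ?case using Pzero by (simp add: fs.subspace_0[OF subspace_cspace])
    next
      case (step c y z)
      then obtain u p f where y: "y = pact d x p f" "awalk u p v" "length p = l" "f \<in> cspace (d u)" by blast
      then have ycs: "y \<in> cspace (d v)" using pact_in_cspace by blast
      have vl: "awlast u p = v" using y(2) by auto
      have u: "u \<in> verts Q" using y(2) awalk_hd_in_verts by blast
      have path: "(u, p) \<in> paths Q" using y(2) vl by (simp add: paths_iff)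
      let ?m = "cls (single c (u, p)) \<odot>\<^bsub>M\<^esub> incl u f"
      have "single c (u, p) \<in> long_ideal l"
        using path y(3) by (auto simp: long_ideal_def single_carrier) (auto simp: single_def split: if_splits)
      then have "?m \<in> ?G" using incl_carrier by blast
      then have "?m \<in> radical_power \<Lambda> M l" unfolding rp by (rule generate.incl)
      then have "?m \<oplus>\<^bsub>M\<^esub> incl v z \<in> radical_power \<Lambda> M l" using Padd step by blast
      moreover have "incl v (fscale c y + z) = ?m \<oplus>\<^bsub>M\<^esub> incl v z"
      proof (rule M_eqI)
        have mc: "?m \<in> carrier M" by (intro smult_carrier single_carrier path incl_carrier)
        then show "?m \<oplus>\<^bsub>M\<^esub> incl v z \<in> carrier M" by (intro add_M_carrier incl_carrier)
        fix u' assume u': "u' \<in> verts Q"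
        have "fscale c y + z \<in> cspace (d v)"
          using ycs step by (intro fs.subspace_add[OF subspace_cspace] fs.subspace_scale[OF subspace_cspace]) auto
        then show "cp (incl v (fscale c y + z)) u' = cp (?m \<oplus>\<^bsub>M\<^esub> incl v z) u'"
          using step u' u y vl path mc
          by (simp add: cp_add incl_carrier cp_incl cp_smult single_carrier actF_single)
      qed (rule incl_carrier)
      ultimately show ?case
        using ycs step by (auto intro!: fs.subspace_add[OF subspace_cspace] fs.subspace_scale[OF subspace_cspace])
    qed
    then show "incl v w \<in> radical_power \<Lambda> M l" by blast
  qed (auto intro: Pzero Padd)
qed

lemma rad_Suc_L:
  assumes "v \<in> verts Q"
  shows "rad d x (Suc L) v = {0}"
proof -
  have "pact d x p f = 0" if "awalk u p v" "length p = Suc L" "f \<in> cspace (d u)" for u p f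
    using that x unfolding rep_variety_iff by blast
  then have "{pact d x p f | u p f. awalk u p v \<and> length p = Suc L \<and> f \<in> cspace (d u)} \<subseteq> {0}" by blast
  then have "fs.span {pact d x p f | u p f. awalk u p v \<and> length p = Suc L \<and> f \<in> cspace (d u)} \<subseteq> {0}"
    by (rule fs.span_minimal) simp
  then show ?thesis using rad_subset_span[OF assms, of d x "Suc L"] fs.subspace_0[OF rad_subspace, of d x "Suc L" v] by blast
qed

end

section \<open>Governed filtrations of representations\<close>

context quiver
begin

definition zero_tuple :: "('v \<Rightarrow> nat) \<Rightarrow> 'a \<Rightarrow> 'k::field mat" where
  "zero_tuple s = (\<lambda>a\<in>arcs Q. 0\<^sub>m (s (head Q a)) (s (tail Q a)))"

lemma semisimple_module_eq: "semisimple_module Q s = rep_module Q s (zero_tuple s)"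
  by (simp add: semisimple_module_def zero_tuple_def)

lemma act_zero_tuple: "a \<in> arcs Q \<Longrightarrow> act s (zero_tuple s) a f = 0"
  by (auto simp: act_def zero_tuple_def fun_eq_iff fun_apply)

lemma zero_tuple_rep_variety: "zero_tuple s \<in> rep_variety Q L s"
  unfolding rep_variety_iff
proof (intro conjI allI impI)
  show "zero_tuple s \<in> tuples s" by (auto simp: tuples_def zero_tuple_def)
  fix u p v f assume *: "awalk u p v \<and> length p = Suc L \<and> f \<in> cspace (s u)"
  then obtain a p' where p: "p = a # p'" by (cases p) auto
  then have "a \<in> arcs Q" using * by (auto simp: awalk_simps)
  then show "pact s (zero_tuple s) p f = 0" by (simp add: p pact_Cons act_zero_tuple pact_zero)
qed

lemma pact_add: "pact d x p (f + g) = pact d x p f + pact d x p g"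
  by (induction p arbitrary: f g) (auto simp: pact_Cons act_add)

lemma pact_diff: "pact d x p (f - g) = pact d x p f - pact d x p g"
  using pact_add[of d x p "f - g" g] by (simp add: algebra_simps)

end

locale rep_quotient = rep Q L d x for Q :: "('v, 'a) pre_digraph" and L d and x :: "'a \<Rightarrow> 'k::field mat" +
  fixes W W' :: "'v \<Rightarrow> (nat \<Rightarrow> 'k) set"
  assumes W: "graded d W" "stable d x W" and W': "graded d W'" "stable d x W'"
    and sub_W: "\<And>v. v \<in> verts Q \<Longrightarrow> W' v \<subseteq> W v"
begin

abbreviation coset :: "('v \<Rightarrow> 'k vec) \<Rightarrow> ('v \<Rightarrow> 'k vec) set" where
  "coset m \<equiv> sub W' +>\<^bsub>M\<^esub> m"

abbreviation K where "K \<equiv> quotient_module M (sub W) (sub W')"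

lemma W_sub: "v \<in> verts Q \<Longrightarrow> fs.subspace (W v)" "v \<in> verts Q \<Longrightarrow> W v \<subseteq> cspace (d v)"
  "v \<in> verts Q \<Longrightarrow> fs.subspace (W' v)" "v \<in> verts Q \<Longrightarrow> W' v \<subseteq> cspace (d v)"
  using W W' by (auto simp: graded_def)

lemma subD: "m \<in> sub W \<Longrightarrow> m \<in> carrier M" "m \<in> sub W \<Longrightarrow> v \<in> verts Q \<Longrightarrow> cp m v \<in> W v"
  by (auto simp: sub_def)

lemma mem_cos:
  assumes m: "m \<in> carrier M"
  shows "m' \<in> coset m \<longleftrightarrow> m' \<in> carrier M \<and> (\<forall>v\<in>verts Q. cp m' v - cp m v \<in> W' v)"
proof
  assume "m' \<in> coset m"
  then obtain h where h: "h \<in> sub W'" "m' = h \<oplus>\<^bsub>M\<^esub> m" by (auto simp: a_r_coset_def')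
  then have "h \<in> carrier M" by (simp add: sub_def)
  then show "m' \<in> carrier M \<and> (\<forall>v\<in>verts Q. cp m' v - cp m v \<in> W' v)"
    using h m by (auto simp: add_M_carrier cp_add sub_def)
next
  assume *: "m' \<in> carrier M \<and> (\<forall>v\<in>verts Q. cp m' v - cp m v \<in> W' v)"
  let ?h = "mk (\<lambda>v. cp m' v - cp m v)"
  have cph: "cp ?h v = cp m' v - cp m v" if "v \<in> verts Q" for v
    using * that W_sub(4)[OF that] by (intro cp_mk) auto
  have "?h \<in> sub W'" using * by (auto simp: sub_def mk_carrier cph)
  moreover have "m' = ?h \<oplus>\<^bsub>M\<^esub> m"
    using * m by (intro M_eqI) (auto simp: add_M_carrier mk_carrier cp_add cph)
  ultimately show "m' \<in> coset m" by (auto simp: a_r_coset_def')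
qed

lemma cos_self: "m \<in> carrier M \<Longrightarrow> m \<in> coset m"
  using mem_cos fs.subspace_0[OF W_sub(3)] by simp

lemma cos_eq:
  assumes m: "m \<in> carrier M" "m' \<in> carrier M"
  shows "coset m = coset m' \<longleftrightarrow> (\<forall>v\<in>verts Q. cp m v - cp m' v \<in> W' v)"
proof
  assume "coset m = coset m'"
  then have "m \<in> coset m'" using cos_self[OF m(1)] by simp
  then show "\<forall>v\<in>verts Q. cp m v - cp m' v \<in> W' v" using mem_cos[OF m(2)] by blast
next
  assume *: "\<forall>v\<in>verts Q. cp m v - cp m' v \<in> W' v"
  have "cp y v - cp m v \<in> W' v \<longleftrightarrow> cp y v - cp m' v \<in> W' v" if v: "v \<in> verts Q" for y v
  proof
    assume "cp y v - cp m v \<in> W' v"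
    then have "(cp y v - cp m v) + (cp m v - cp m' v) \<in> W' v"
      using * v by (intro fs.subspace_add[OF W_sub(3)]) auto
    then show "cp y v - cp m' v \<in> W' v" by simp
  next
    assume "cp y v - cp m' v \<in> W' v"
    then have "(cp y v - cp m' v) - (cp m v - cp m' v) \<in> W' v"
      using * v fs.subspace_diff[OF W_sub(3)[OF v], of "cp y v - cp m' v" "cp m v - cp m' v"] by blast
    then show "cp y v - cp m v \<in> W' v" by simp
  qed
  then show "coset m = coset m'" using mem_cos[OF m(1)] mem_cos[OF m(2)] by auto
qed

lemma cos_add:
  assumes m: "m \<in> carrier M" "m' \<in> carrier M"
  shows "set_add M (coset m) (coset m') = coset (m \<oplus>\<^bsub>M\<^esub> m')"
proof (intro equalityI subsetI)
  fix y assume "y \<in> set_add M (coset m) (coset m')"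
  then obtain y1 y2 where y: "y1 \<in> coset m" "y2 \<in> coset m'" "y = y1 \<oplus>\<^bsub>M\<^esub> y2"
    by (auto simp: set_add_def set_mult_def)
  then have yc: "y1 \<in> carrier M" "y2 \<in> carrier M" using mem_cos m by auto
  have "cp y v - cp (m \<oplus>\<^bsub>M\<^esub> m') v \<in> W' v" if v: "v \<in> verts Q" for v
  proof -
    have "(cp y1 v - cp m v) + (cp y2 v - cp m' v) \<in> W' v"
      using y m v mem_cos by (intro fs.subspace_add[OF W_sub(3)]) auto
    then show ?thesis using v m yc by (simp add: y cp_add algebra_simps)
  qed
  then show "y \<in> coset (m \<oplus>\<^bsub>M\<^esub> m')" using yc m by (simp add: mem_cos add_M_carrier y)
next
  fix y assume "y \<in> coset (m \<oplus>\<^bsub>M\<^esub> m')"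
  then have y: "y \<in> carrier M" "\<And>v. v \<in> verts Q \<Longrightarrow> cp y v - cp (m \<oplus>\<^bsub>M\<^esub> m') v \<in> W' v"
    using m by (auto simp: mem_cos add_M_carrier)
  let ?y = "mk (\<lambda>v. cp y v - cp m' v)"
  have cpy: "cp ?y v = cp y v - cp m' v" if "v \<in> verts Q" for v
    using y m that by (intro cp_mk fs.subspace_diff[OF subspace_cspace] cp_in_cspace) auto
  have "?y \<in> coset m"
    using y(2) m by (auto simp: mem_cos mk_carrier cpy cp_add algebra_simps)
  moreover have "y = ?y \<oplus>\<^bsub>M\<^esub> m'"
    using y m by (intro M_eqI) (auto simp: add_M_carrier mk_carrier cp_add cpy)
  ultimately show "y \<in> set_add M (coset m) (coset m')"
    using cos_self[OF m(2)] by (auto simp: set_add_def set_mult_def)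
qed

text \<open>Makes the action on cosets independent of representatives.\<close>

lemma actF_diff_in:
  assumes m: "m \<in> carrier M" "m' \<in> carrier M" "\<And>v. v \<in> verts Q \<Longrightarrow> cp m v - cp m' v \<in> W' v"
    and v: "v \<in> verts Q"
  shows "actF f m v - actF f m' v \<in> W' v"
proof -
  have "actF f m v - actF f m' v = (\<Sum>q\<in>{q \<in> short_paths. awlast (fst q) (snd q) = v}.
      fscale (f q) (pact d x (snd q) (cp m (fst q) - cp m' (fst q))))"
    by (simp add: actF_def sum_subtractf[symmetric] pact_diff fs.scale_right_diff_distrib)
  also have "\<dots> \<in> W' v"
  proof (intro fs.subspace_sum fs.subspace_scale W_sub v)
    fix q assume "q \<in> {q \<in> short_paths. awlast (fst q) (snd q) = v}"
    then have w: "awalk (fst q) (snd q) v" by (auto simp: short_paths_def paths_iff)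
    show "pact d x (snd q) (cp m (fst q) - cp m' (fst q)) \<in> W' v"
      using m(3) awalk_hd_in_verts[OF w] by (intro stable_pact[OF W'(2) w])
  qed
  finally show ?thesis .
qed

lemma K_simps:
  "carrier K = coset ` sub W"
  "m \<in> carrier M \<Longrightarrow> m' \<in> carrier M \<Longrightarrow> coset m \<oplus>\<^bsub>K\<^esub> coset m' = coset (m \<oplus>\<^bsub>M\<^esub> m')"
  "m \<in> carrier M \<Longrightarrow> f \<in> carrier KQ \<Longrightarrow> cls f \<odot>\<^bsub>K\<^esub> coset m = coset (cls f \<odot>\<^bsub>M\<^esub> m)"
proof -
  show "carrier K = coset ` sub W" by (simp add: quotient_module_def)
  show "coset m \<oplus>\<^bsub>K\<^esub> coset m' = coset (m \<oplus>\<^bsub>M\<^esub> m')" if "m \<in> carrier M" "m' \<in> carrier M" for m m'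
    using cos_add[OF that] by (simp add: quotient_module_def)
  fix m and f :: "('v, 'a) path \<Rightarrow> 'k" assume m: "m \<in> carrier M" and f: "f \<in> carrier KQ"
  have "coset (cls f \<odot>\<^bsub>M\<^esub> m') = coset (cls f \<odot>\<^bsub>M\<^esub> m)" if "m' \<in> coset m" for m'
  proof -
    have m': "m' \<in> carrier M" "\<And>v. v \<in> verts Q \<Longrightarrow> cp m' v - cp m v \<in> W' v" using that m by (auto simp: mem_cos)
    show ?thesis
      using actF_diff_in[OF m'(1) m m'(2)] m m' f by (simp add: cos_eq smult_carrier cp_smult)
  qed
  then have "(\<Union>m'\<in>coset m. coset (cls f \<odot>\<^bsub>M\<^esub> m')) = coset (cls f \<odot>\<^bsub>M\<^esub> m)"
    using cos_self[OF m] by blast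
  then show "cls f \<odot>\<^bsub>K\<^esub> coset m = coset (cls f \<odot>\<^bsub>M\<^esub> m)" by (simp add: quotient_module_def)
qed

text \<open>A path of positive length enters \<open>W'\<close> with its first arrow, and
  \<open>W'\<close> is stable under the rest. Modulo \<open>W'\<close> only the trivial path at
  \<open>v\<close> acts, so the quotient is semisimple.\<close>

lemma actF_trivial:
  assumes arr: "\<And>a. a \<in> arcs Q \<Longrightarrow> act d x a ` W (tail Q a) \<subseteq> W' (head Q a)"
    and m: "m \<in> sub W" and v: "v \<in> verts Q"
  shows "actF f m v - fscale (f (v, [])) (cp m v) \<in> W' v"
proof -
  let ?T = "{q \<in> short_paths. awlast (fst q) (snd q) = v}"
  have "finite ?T" using finite_short_paths by simp
  moreover have "(v, []) \<in> ?T" using v by (auto simp: short_paths_def paths_Nil)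
  ultimately have "actF f m v - fscale (f (v, [])) (cp m v) =
      (\<Sum>q\<in>?T - {(v, [])}. fscale (f q) (pact d x (snd q) (cp m (fst q))))"
    unfolding actF_def by (subst sum.remove[of ?T "(v, [])"]) auto
  also have "\<dots> \<in> W' v"
  proof (intro fs.subspace_sum fs.subspace_scale W_sub v)
    fix q assume q: "q \<in> ?T - {(v, [])}"
    obtain u p where up: "q = (u, p)" by (cases q)
    then have w: "awalk u p v" and "p \<noteq> []" using q by (auto simp: short_paths_def paths_iff)
    then obtain a p' where p: "p = a # p'" by (cases p) auto
    then have a: "a \<in> arcs Q" "u = tail Q a" "awalk (head Q a) p' v" using w by (auto simp: awalk_simps)
    then have "cp m u \<in> W (tail Q a)" using subD(2)[OF m] by simp
    then have "act d x a (cp m u) \<in> W' (head Q a)" using arr[OF a(1)] by blast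
    then show "pact d x (snd q) (cp m (fst q)) \<in> W' v"
      using stable_pact[OF W'(2) a(3)] by (simp add: up p pact_Cons)
  qed
  finally show ?thesis .
qed

lemma incl_in_sub: "v \<in> verts Q \<Longrightarrow> w \<in> W v \<Longrightarrow> incl v w \<in> sub W"
  using W_sub(2)[of v] by (auto simp: sub_def incl_carrier cp_incl fs.subspace_0[OF W_sub(1)])

lemma smult_incl:
  assumes "awalk u p v" "w \<in> cspace (d u)"
  shows "cls (single c (u, p)) \<odot>\<^bsub>M\<^esub> incl u w = incl v (fscale c (pact d x p w))"
proof (rule M_eqI)
  have P: "(u, p) \<in> paths Q" "awlast u p = v" "u \<in> verts Q" using assms(1) awalk_hd_in_verts by (auto simp: paths_iff)
  show "cls (single c (u, p)) \<odot>\<^bsub>M\<^esub> incl u w \<in> carrier M"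
    by (intro smult_carrier single_carrier P incl_carrier)
  fix u' assume u': "u' \<in> verts Q"
  have "fscale c (pact d x p w) \<in> cspace (d v)"
    by (rule fs.subspace_scale[OF subspace_cspace pact_in_cspace[where d = d, OF assms]])
  then show "cp (cls (single c (u, p)) \<odot>\<^bsub>M\<^esub> incl u w) u' = cp (incl v (fscale c (pact d x p w))) u'"
    using P u' assms by (simp add: cp_smult single_carrier incl_carrier actF_single cp_incl)
qed (rule incl_carrier)

text \<open>The isomorphism commutes with paths. Arrows act as zero on the semisimple module, which
  forces them to map \<open>W\<close> into \<open>W'\<close>; trivial paths split the isomorphism
  into maps at the vertices, where \<open>dim_quotient\<close> counts dimensions.\<close>

lemma isomorphic_imp:
  assumes iso: "module_isomorphic \<Lambda> K (semisimple_module Q s)"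
  shows "\<And>a. a \<in> arcs Q \<Longrightarrow> act d x a ` W (tail Q a) \<subseteq> W' (head Q a)"
    and "\<And>v. v \<in> verts Q \<Longrightarrow> fs.dim (W v) = fs.dim (W' v) + s v"
proof -
  interpret N: rep Q L s "zero_tuple s :: 'a \<Rightarrow> 'k mat"
    by unfold_locales (rule zero_tuple_rep_variety)
  obtain h where h: "bij_betw h (carrier K) (carrier N.M)"
    "\<And>m m'. m \<in> carrier K \<Longrightarrow> m' \<in> carrier K \<Longrightarrow> h (m \<oplus>\<^bsub>K\<^esub> m') = h m \<oplus>\<^bsub>N.M\<^esub> h m'"
    "\<And>a m. a \<in> carrier \<Lambda> \<Longrightarrow> m \<in> carrier K \<Longrightarrow> h (a \<odot>\<^bsub>K\<^esub> m) = a \<odot>\<^bsub>N.M\<^esub> h m"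
    using iso unfolding module_isomorphic_def semisimple_module_eq by blast
  define h' where "h' = (\<lambda>m. h (coset m))"
  interpret SW: submodule "sub W" \<Lambda> M by (rule submodule_sub[OF W])
  have h'c: "h' m \<in> carrier N.M" if "m \<in> sub W" for m
    using h(1) that unfolding h'_def K_simps(1) by (auto dest: bij_betwE)
  have h'add: "h' (m \<oplus>\<^bsub>M\<^esub> m') = h' m \<oplus>\<^bsub>N.M\<^esub> h' m'" if "m \<in> sub W" "m' \<in> sub W" for m m'
    using h(2)[of "coset m" "coset m'"] that by (simp add: h'_def K_simps subD)
  have h'sm: "h' (cls f \<odot>\<^bsub>M\<^esub> m) = cls f \<odot>\<^bsub>N.M\<^esub> h' m" if "f \<in> carrier KQ" "m \<in> sub W" for f m
    using h(3)[of "cls f" "coset m"] that by (simp add: h'_def K_simps subD carrier_\<Lambda>)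
  have h'inj: "cp m v - cp m' v \<in> W' v" if "m \<in> sub W" "m' \<in> sub W" "h' m = h' m'" "v \<in> verts Q" for m m' v
  proof -
    have "coset m = coset m'"
      using h(1) that unfolding h'_def bij_betw_def K_simps(1) inj_on_def by blast
    then show ?thesis using that by (simp add: cos_eq subD)
  qed
  have h'surj: "\<exists>m\<in>sub W. h' m = n" if "n \<in> carrier N.M" for n
  proof -
    have "n \<in> h ` carrier K" using h(1) that by (simp add: bij_betw_def)
    then show ?thesis by (auto simp: K_simps(1) h'_def)
  qed
  have zW: "\<zero>\<^bsub>M\<^esub> \<in> sub W" using SW.one_closed by simp
  have h'0: "h' \<zero>\<^bsub>M\<^esub> = \<zero>\<^bsub>N.M\<^esub>"
  proof (rule N.M_eqI[OF h'c[OF zW] N.zero_M_carrier])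
    fix v assume v: "v \<in> verts Q"
    have "\<zero>\<^bsub>M\<^esub> \<oplus>\<^bsub>M\<^esub> \<zero>\<^bsub>M\<^esub> = \<zero>\<^bsub>M\<^esub>"
      by (intro M_eqI add_M_carrier zero_M_carrier) (simp add: cp_add zero_M_carrier cp_zero)
    then have "h' \<zero>\<^bsub>M\<^esub> = h' \<zero>\<^bsub>M\<^esub> \<oplus>\<^bsub>N.M\<^esub> h' \<zero>\<^bsub>M\<^esub>" using h'add[OF zW zW] by simp
    then have "N.cp (h' \<zero>\<^bsub>M\<^esub>) v = N.cp (h' \<zero>\<^bsub>M\<^esub>) v + N.cp (h' \<zero>\<^bsub>M\<^esub>) v"
      using N.cp_add[OF h'c[OF zW] h'c[OF zW] v] by simp
    then show "N.cp (h' \<zero>\<^bsub>M\<^esub>) v = N.cp \<zero>\<^bsub>N.M\<^esub> v" using N.cp_zero[OF v] by simp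
  qed
  have h'0I: "cp m v \<in> W' v" if "m \<in> sub W" "\<And>u. u \<in> verts Q \<Longrightarrow> N.cp (h' m) u = 0" "v \<in> verts Q" for m v
  proof -
    have "h' m = h' \<zero>\<^bsub>M\<^esub>" unfolding h'0
      using that by (intro N.M_eqI h'c N.zero_M_carrier) (simp_all add: N.cp_zero)
    from h'inj[OF that(1) zW this that(3)] show ?thesis using that by (simp add: cp_zero)
  qed
  {
    fix a assume a: "a \<in> arcs Q"
    have wa: "awalk (tail Q a) [a] (head Q a)" using a by (simp add: awalk_simps)
    then have P: "(tail Q a, [a]) \<in> paths Q" by (auto simp: paths_def)
    show "act d x a ` W (tail Q a) \<subseteq> W' (head Q a)"
    proof
      fix g assume "g \<in> act d x a ` W (tail Q a)"
      then obtain w where w: "w \<in> W (tail Q a)" "g = act d x a w" by blast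
      have wc: "w \<in> cspace (d (tail Q a))" using W_sub(2)[of "tail Q a"] w a by auto
      have inclw: "incl (tail Q a) w \<in> sub W" using a w by (intro incl_in_sub) auto
      let ?m = "cls (single 1 (tail Q a, [a])) \<odot>\<^bsub>M\<^esub> incl (tail Q a) w"
      have m: "?m = incl (head Q a) g" using smult_incl[OF wa wc, of 1] w by (simp add: pact_Cons)
      have "?m \<in> sub W" using P inclw by (intro SW.smult_closed) (auto simp: carrier_\<Lambda> single_carrier)
      moreover have "N.cp (h' ?m) u = 0" if u: "u \<in> verts Q" for u
        using P a u by (simp add: h'sm inclw single_carrier N.cp_smult h'c N.actF_single pact_Cons act_zero_tuple)
      ultimately have "cp ?m (head Q a) \<in> W' (head Q a)" using a by (intro h'0I) auto
      moreover have "g \<in> cspace (d (head Q a))" unfolding w by (rule act_in_cspace)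
      ultimately show "g \<in> W' (head Q a)" unfolding m using a by (simp add: cp_incl)
    qed
  }
  {
    fix v assume v: "v \<in> verts Q"
    have wv: "awalk v [] v" using v by (simp add: awalk_Nil_iff)
    have P: "(v, []) \<in> paths Q" using v by (simp add: paths_Nil)
    \<comment> \<open>The part of the isomorphism at \<open>v\<close>. By \<open>off\<close> below,
      a vector concentrated at \<open>v\<close> has no image at the other vertices.\<close>
    define \<tau> where "\<tau> = (\<lambda>w. N.cp (h' (incl v w)) v)"
    have wc: "w \<in> cspace (d v)" if "w \<in> W v" for w using W_sub(2)[OF v] that by auto
    have off: "N.cp (h' (incl v w)) u = 0" if w: "w \<in> W v" and u: "u \<in> verts Q" "u \<noteq> v" for w u
    proof -
      have eq: "incl v w = cls (single 1 (v, [])) \<odot>\<^bsub>M\<^esub> incl v w" using smult_incl[OF wv wc[OF w], of 1] by simp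
      show ?thesis
        using P u by (subst eq) (simp add: h'sm incl_in_sub[OF v w] single_carrier N.cp_smult h'c N.actF_single)
    qed
    show "fs.dim (W v) = fs.dim (W' v) + s v"
    proof (rule dim_quotient[where \<tau> = \<tau>, OF W_sub(1,2)[OF v]])
      fix w w' assume w: "w \<in> W v" "w' \<in> W v"
      have "incl v (w + w') = incl v w \<oplus>\<^bsub>M\<^esub> incl v w'"
        using wc w by (intro M_eqI incl_carrier add_M_carrier)
          (simp add: cp_add incl_carrier cp_incl fs.subspace_add[OF subspace_cspace])
      then show "\<tau> (w + w') = \<tau> w + \<tau> w'"
        using w v by (simp add: \<tau>_def h'add incl_in_sub N.cp_add h'c)
    next
      fix c w assume w: "w \<in> W v"
      have "incl v (fscale c w) = cls (single c (v, [])) \<odot>\<^bsub>M\<^esub> incl v w"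
        using smult_incl[OF wv wc[OF w], of c] by simp
      then show "\<tau> (fscale c w) = fscale c (\<tau> w)"
        using w v P by (simp add: \<tau>_def h'sm incl_in_sub single_carrier N.cp_smult h'c N.actF_single)
    next
      fix w assume w: "w \<in> W v"
      show "\<tau> w = 0 \<longleftrightarrow> w \<in> W' v"
      proof
        assume "\<tau> w = 0"
        then have "N.cp (h' (incl v w)) u = 0" if "u \<in> verts Q" for u
          using off[OF w that] by (cases "u = v") (auto simp: \<tau>_def)
        then have "cp (incl v w) v \<in> W' v" by (intro h'0I incl_in_sub v w)
        then show "w \<in> W' v" using v wc[OF w] by (simp add: cp_incl)
      next
        assume w': "w \<in> W' v"
        have "coset (incl v w) = coset \<zero>\<^bsub>M\<^esub>"
          using w' wc[OF w] by (auto simp: cos_eq incl_carrier zero_M_carrier cp_incl cp_zero fs.subspace_0[OF W_sub(3)])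
        then have "h' (incl v w) = \<zero>\<^bsub>N.M\<^esub>" using h'0 by (simp add: h'_def)
        then show "\<tau> w = 0" using v by (simp add: \<tau>_def N.cp_zero)
      qed
    next
      show "\<tau> ` W v = cspace (s v)"
      proof (intro equalityI subsetI)
        fix f assume "f \<in> \<tau> ` W v"
        then show "f \<in> cspace (s v)" using v by (auto simp: \<tau>_def intro!: N.cp_in_cspace h'c incl_in_sub)
      next
        fix f :: "nat \<Rightarrow> 'k" assume f: "f \<in> cspace (s v)"
        \<comment> \<open>A preimage of a vector concentrated at \<open>v\<close> may have
          components elsewhere; the trivial path at \<open>v\<close> removes them without changing
          the image.\<close>
        obtain m where m: "m \<in> sub W" "h' m = N.incl v f" using h'surj[OF N.incl_carrier] by blast
        have mW: "cp m v \<in> W v" using subD(2)[OF m(1) v] .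
        have "incl v (cp m v) = cls (single 1 (v, [])) \<odot>\<^bsub>M\<^esub> m"
          using P v wc[OF mW] subD(1)[OF m(1)]
          by (intro M_eqI incl_carrier smult_carrier single_carrier) (auto simp: cp_incl cp_smult single_carrier actF_single)
        then have "\<tau> (cp m v) = f"
          using P v f m(1) by (simp add: \<tau>_def h'sm single_carrier m(2) N.cp_smult N.incl_carrier N.actF_single N.cp_incl)
        then show "f \<in> \<tau> ` W v" using mW by blast
      qed
    qed (use sub_W W_sub v in auto)
  }
qed

text \<open>Surjections of the spaces \<open>W v\<close> with kernels \<open>W' v\<close> assemble
  to the isomorphism. It commutes with the algebra because on both sides only the coefficients at
  trivial paths act.\<close>

lemma isomorphicI:
  assumes arr: "\<And>a. a \<in> arcs Q \<Longrightarrow> act d x a ` W (tail Q a) \<subseteq> W' (head Q a)"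
    and dim: "\<And>v. v \<in> verts Q \<Longrightarrow> fs.dim (W v) = fs.dim (W' v) + s v"
  shows "module_isomorphic \<Lambda> K (semisimple_module Q s)"
proof -
  interpret N: rep Q L s "zero_tuple s :: 'a \<Rightarrow> 'k mat"
    by unfold_locales (rule zero_tuple_rep_variety)
  interpret NQ: rep_quotient Q L s "zero_tuple s :: 'a \<Rightarrow> 'k mat" "\<lambda>v. cspace (s v)" "\<lambda>v. {0}"
    by unfold_locales
      (auto simp: graded_def stable_def subspace_cspace act_zero_tuple act_in_cspace fs.subspace_0[OF subspace_cspace])
  have Nact: "N.actF f n v = fscale (f (v, [])) (N.cp n v)" if "n \<in> carrier N.M" "v \<in> verts Q" for f n v
    using NQ.actF_trivial[of n v f] that by (simp add: N.sub_UNIV act_zero_tuple image_subset_iff)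
  have "\<exists>T. flinear T \<and> T ` W v = cspace (s v) \<and> (\<forall>w\<in>W v. T w = 0 \<longleftrightarrow> w \<in> W' v)" if "v \<in> verts Q" for v
    by (rule linear_quotient_map[OF W_sub(1-3)[OF that] sub_W[OF that] dim[OF that]])
  then obtain T where T: "\<And>v. v \<in> verts Q \<Longrightarrow> flinear (T v)" "\<And>v. v \<in> verts Q \<Longrightarrow> T v ` W v = cspace (s v)"
    "\<And>v w. v \<in> verts Q \<Longrightarrow> w \<in> W v \<Longrightarrow> T v w = 0 \<longleftrightarrow> w \<in> W' v"
    by metis
  have Tdiff: "T v f = T v g \<longleftrightarrow> f - g \<in> W' v" if "v \<in> verts Q" "f \<in> W v" "g \<in> W v" for v f g
  proof -
    interpret Tv: Vector_Spaces.linear fscale fscale "T v" by (rule T(1)[OF that(1)])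
    have "T v f = T v g \<longleftrightarrow> T v (f - g) = 0" by (simp add: Tv.diff)
    also have "\<dots> \<longleftrightarrow> f - g \<in> W' v" using that by (intro T(3) fs.subspace_diff[OF W_sub(1)])
    finally show ?thesis .
  qed
  define h' where "h' = (\<lambda>m. N.mk (\<lambda>v. T v (cp m v)))"
  have cph': "N.cp (h' m) v = T v (cp m v)" if "m \<in> sub W" "v \<in> verts Q" for m v
    unfolding h'_def using T(2)[OF that(2)] subD(2)[OF that] by (intro N.cp_mk that) auto
  have h'eq: "h' m = h' m' \<longleftrightarrow> coset m = coset m'" if "m \<in> sub W" "m' \<in> sub W" for m m'
  proof -
    have "h' m = h' m' \<longleftrightarrow> (\<forall>v\<in>verts Q. T v (cp m v) = T v (cp m' v))"
    proof
      assume eq: "h' m = h' m'"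
      show "\<forall>v\<in>verts Q. T v (cp m v) = T v (cp m' v)"
        using cph'[OF that(1)] cph'[OF that(2)] unfolding eq by simp
    next
      assume eq: "\<forall>v\<in>verts Q. T v (cp m v) = T v (cp m' v)"
      show "h' m = h' m'"
      proof (rule N.M_eqI)
        fix v assume v: "v \<in> verts Q"
        show "N.cp (h' m) v = N.cp (h' m') v"
          unfolding cph'[OF that(1) v] cph'[OF that(2) v] using eq v by blast
      qed (simp_all only: h'_def N.mk_carrier)
    qed
    also have "\<dots> \<longleftrightarrow> coset m = coset m'"
      using that by (auto simp: Tdiff cos_eq subD)
    finally show ?thesis .
  qed
  \<comment> \<open>Defined on a coset through an arbitrary representative; \<open>h'eq\<close>
    makes the choice harmless and also gives injectivity.\<close>
  define h where "h = (\<lambda>A. h' (SOME m. m \<in> sub W \<and> coset m = A))"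
  have hcos: "h (coset m) = h' m" if "m \<in> sub W" for m
  proof -
    let ?m = "SOME m'. m' \<in> sub W \<and> coset m' = coset m"
    have "?m \<in> sub W \<and> coset ?m = coset m"
      by (rule someI[of "\<lambda>m'. m' \<in> sub W \<and> coset m' = coset m" m]) (use that in simp)
    then have "h' ?m = h' m" using h'eq[of ?m m] that by metis
    then show ?thesis unfolding h_def .
  qed
  interpret SW: submodule "sub W" \<Lambda> M by (rule submodule_sub[OF W])
  have Wadd: "m \<oplus>\<^bsub>M\<^esub> m' \<in> sub W" if "m \<in> sub W" "m' \<in> sub W" for m m'
    using SW.m_closed[OF that] by simp
  have h'c: "h' m \<in> carrier N.M" for m unfolding h'_def by (rule N.mk_carrier)
  have "bij_betw h (carrier K) (carrier N.M)"
    unfolding bij_betw_def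
  proof
    show "inj_on h (carrier K)" unfolding inj_on_def K_simps(1) using hcos h'eq by auto
    show "h ` carrier K = carrier N.M"
    proof (intro equalityI subsetI)
      fix n assume "n \<in> h ` carrier K"
      then show "n \<in> carrier N.M" using hcos h'c by (auto simp: K_simps(1))
    next
      fix n assume n: "n \<in> carrier N.M"
      have "\<exists>w. w \<in> W v \<and> T v w = N.cp n v" if "v \<in> verts Q" for v
        using T(2)[OF that] N.cp_in_cspace[OF n that] by (metis imageE)
      then obtain w where w: "\<And>v. v \<in> verts Q \<Longrightarrow> w v \<in> W v \<and> T v (w v) = N.cp n v" by metis
      have cpw: "cp (mk w) v = w v" if "v \<in> verts Q" for v
        using w[OF that] W_sub(2)[OF that] by (intro cp_mk that) auto
      have "mk w \<in> sub W" using w by (auto simp: sub_def mk_carrier cpw)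
      moreover have "h' (mk w) = n"
        using w cph'[OF \<open>mk w \<in> sub W\<close>] by (intro N.M_eqI h'c n) (simp add: cpw)
      ultimately show "n \<in> h ` carrier K" using hcos by (force simp: K_simps(1))
    qed
  qed
  moreover have "h (A \<oplus>\<^bsub>K\<^esub> B) = h A \<oplus>\<^bsub>N.M\<^esub> h B" if AB: "A \<in> carrier K" "B \<in> carrier K" for A B
  proof -
    obtain m m' where m: "A = coset m" "m \<in> sub W" "B = coset m'" "m' \<in> sub W"
      using AB by (auto simp: K_simps(1))
    have "h' (m \<oplus>\<^bsub>M\<^esub> m') = h' m \<oplus>\<^bsub>N.M\<^esub> h' m'"
    proof (rule N.M_eqI[OF h'c N.add_M_carrier[OF h'c h'c]])
      fix v assume v: "v \<in> verts Q"
      interpret Tv: Vector_Spaces.linear fscale fscale "T v" by (rule T(1)[OF v])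
      show "N.cp (h' (m \<oplus>\<^bsub>M\<^esub> m')) v = N.cp (h' m \<oplus>\<^bsub>N.M\<^esub> h' m') v"
        using m v by (simp add: N.cp_add h'c cph' Wadd cp_add subD Tv.add)
    qed
    then show ?thesis using m by (simp add: K_simps(2) subD hcos Wadd)
  qed
  moreover have "h (A \<odot>\<^bsub>K\<^esub> B) = A \<odot>\<^bsub>N.M\<^esub> h B" if AB: "A \<in> carrier \<Lambda>" "B \<in> carrier K" for A B
  proof -
    obtain f m where m: "A = cls f" "f \<in> carrier KQ" "B = coset m" "m \<in> sub W"
      using AB by (auto simp: K_simps(1) carrier_\<Lambda>)
    have sm: "cls f \<odot>\<^bsub>M\<^esub> m \<in> sub W" using m by (intro SW.smult_closed) (auto simp: carrier_\<Lambda>)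
    have "h' (cls f \<odot>\<^bsub>M\<^esub> m) = cls f \<odot>\<^bsub>N.M\<^esub> h' m"
    proof (rule N.M_eqI[OF h'c N.smult_carrier[OF m(2) h'c]])
      fix v assume v: "v \<in> verts Q"
      interpret Tv: Vector_Spaces.linear fscale fscale "T v" by (rule T(1)[OF v])
      have "actF f m v \<in> W v" by (rule actF_in[OF W m(4) v])
      moreover have "fscale (f (v, [])) (cp m v) \<in> W v"
        by (intro fs.subspace_scale W_sub v subD(2)[OF m(4)])
      ultimately have "T v (actF f m v) = T v (fscale (f (v, [])) (cp m v))"
        using actF_trivial[OF arr m(4) v] Tdiff[OF v] by blast
      then show "N.cp (h' (cls f \<odot>\<^bsub>M\<^esub> m)) v = N.cp (cls f \<odot>\<^bsub>N.M\<^esub> h' m) v"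
        using m v by (simp add: cph' sm cp_smult subD N.cp_smult h'c Nact Tv.scale)
    qed
    then show ?thesis using m by (simp add: K_simps(3) subD hcos sm)
  qed
  ultimately show ?thesis
    unfolding module_isomorphic_def semisimple_module_eq by blast
qed

end

context rep
begin

lemma quotient_isomorphic_iff:
  assumes "graded d W" "stable d x W" "graded d W'" "stable d x W'" "\<And>v. v \<in> verts Q \<Longrightarrow> W' v \<subseteq> W v"
  shows "module_isomorphic \<Lambda> (quotient_module M (sub W) (sub W')) (semisimple_module Q s) \<longleftrightarrow>
    (\<forall>a\<in>arcs Q. act d x a ` W (tail Q a) \<subseteq> W' (head Q a)) \<and>
    (\<forall>v\<in>verts Q. fs.dim (W v) = fs.dim (W' v) + s v)"
proof -
  interpret rep_quotient Q L d x W W' using assms by unfold_locales auto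
  show ?thesis
  proof
    assume iso: "module_isomorphic \<Lambda> K (semisimple_module Q s)"
    show "(\<forall>a\<in>arcs Q. act d x a ` W (tail Q a) \<subseteq> W' (head Q a)) \<and>
        (\<forall>v\<in>verts Q. fs.dim (W v) = fs.dim (W' v) + s v)"
      using isomorphic_imp[OF iso] by simp
  next
    assume *: "(\<forall>a\<in>arcs Q. act d x a ` W (tail Q a) \<subseteq> W' (head Q a)) \<and>
        (\<forall>v\<in>verts Q. fs.dim (W v) = fs.dim (W' v) + s v)"
    show "module_isomorphic \<Lambda> K (semisimple_module Q s)"
      by (rule isomorphicI) (use * in simp_all)
  qed
qed

lemma has_radical_layering_iff:
  "has_radical_layering Q L M S \<longleftrightarrow>
    (\<forall>l\<le>L. \<forall>v\<in>verts Q. fs.dim (rad d x l v) = fs.dim (rad d x (Suc l) v) + S l v)"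
proof -
  have "act d x a ` rad d x l (tail Q a) \<subseteq> rad d x (Suc l) (head Q a)" if "a \<in> arcs Q" for a l
    using rad_act[OF that] by blast
  then have "module_isomorphic \<Lambda> (quotient_module M (radical_power \<Lambda> M l) (radical_power \<Lambda> M (Suc l)))
        (semisimple_module Q (S l)) \<longleftrightarrow>
      (\<forall>v\<in>verts Q. fs.dim (rad d x l v) = fs.dim (rad d x (Suc l) v) + S l v)" for l
    using quotient_isomorphic_iff[OF graded_rad stable_rad graded_rad stable_rad, of "Suc l" l "S l"]
      rad_Suc_subset[of d x l]
    unfolding radical_power_eq by blast
  then show ?thesis unfolding has_radical_layering_def Let_def by blast
qed

text \<open>Governed filtrations in components. The condition on arrows expresses that the layers
  are semisimple, and it also makes the members submodules.\<close>

definition layered :: "(nat \<Rightarrow> 'v \<Rightarrow> nat) \<Rightarrow> (nat \<Rightarrow> 'v \<Rightarrow> (nat \<Rightarrow> 'k) set) \<Rightarrow> bool" where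
  "layered S W \<longleftrightarrow> (\<forall>l\<le>Suc L. graded d (W l)) \<and>
     (\<forall>v\<in>verts Q. W 0 v = cspace (d v) \<and> W (Suc L) v = {0}) \<and>
     (\<forall>l\<le>L. (\<forall>v\<in>verts Q. W (Suc l) v \<subseteq> W l v \<and> fs.dim (W l v) = fs.dim (W (Suc l) v) + S l v) \<and>
       (\<forall>a\<in>arcs Q. act d x a ` W l (tail Q a) \<subseteq> W (Suc l) (head Q a)))"

lemma layered_stable:
  assumes "layered S W" "l \<le> Suc L"
  shows "stable d x (W l)"
proof (cases "l = Suc L")
  case True
  then show ?thesis using assms by (auto simp: layered_def stable_def act_zero)
next
  case False
  then have "l \<le> L" using assms by simp
  then show ?thesis using assms unfolding layered_def stable_def by (meson head_in_verts order_trans)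
qed

lemma governed_filtration_iff:
  "governed_filtration Q L M S U \<longleftrightarrow> (\<exists>W. layered S W \<and> (\<forall>l\<le>Suc L. U l = sub (W l)))"
proof
  assume G: "governed_filtration Q L M S U"
  then have G': "U 0 = carrier M" "U (Suc L) = {\<zero>\<^bsub>M\<^esub>}" "\<And>l. l \<le> Suc L \<Longrightarrow> submodule (U l) \<Lambda> M"
    "\<And>l. l \<le> L \<Longrightarrow> U (Suc l) \<subseteq> U l"
    "\<And>l. l \<le> L \<Longrightarrow> module_isomorphic \<Lambda> (quotient_module M (U l) (U (Suc l))) (semisimple_module Q (S l))"
    by (auto simp: governed_filtration_def Let_def)
  have "\<exists>W. l \<le> Suc L \<longrightarrow> graded d W \<and> stable d x W \<and> U l = sub W" for l
    using submodule_is_sub[OF G'(3)[of l]] by blast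
  then obtain W where W: "\<And>l. l \<le> Suc L \<Longrightarrow> graded d (W l)" "\<And>l. l \<le> Suc L \<Longrightarrow> stable d x (W l)"
    "\<And>l. l \<le> Suc L \<Longrightarrow> U l = sub (W l)" by metis
  have g0: "graded d (\<lambda>v. cspace (d v))" "graded d (\<lambda>v. {0})"
    by (auto simp: graded_def subspace_cspace fs.subspace_0[OF subspace_cspace])
  have "sub (W 0) = sub (\<lambda>v. cspace (d v))" using W(3)[of 0] G'(1) by (simp add: sub_UNIV)
  then have W0: "\<forall>v\<in>verts Q. W 0 v = cspace (d v)" using sub_eq_iff[OF W(1) g0(1), of 0] by simp
  have "sub (W (Suc L)) = sub (\<lambda>v. {0})" using W(3)[of "Suc L"] G'(2) by (simp add: sub_zero)
  then have WL: "\<forall>v\<in>verts Q. W (Suc L) v = {0}" using sub_eq_iff[OF W(1) g0(2), of "Suc L"] by simp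
  have step: "(\<forall>v\<in>verts Q. W (Suc l) v \<subseteq> W l v \<and> fs.dim (W l v) = fs.dim (W (Suc l) v) + S l v) \<and>
       (\<forall>a\<in>arcs Q. act d x a ` W l (tail Q a) \<subseteq> W (Suc l) (head Q a))" if l: "l \<le> L" for l
  proof -
    have sub: "\<forall>v\<in>verts Q. W (Suc l) v \<subseteq> W l v"
      using G'(4)[OF l] l W(3)[of l] W(3)[of "Suc l"] sub_subset_iff[OF W(1)[of "Suc l"], of "W l"] by simp
    have "module_isomorphic \<Lambda> (quotient_module M (sub (W l)) (sub (W (Suc l)))) (semisimple_module Q (S l))"
      using G'(5)[OF l] l W(3)[of l] W(3)[of "Suc l"] by simp
    then show ?thesis
      using quotient_isomorphic_iff[of "W l" "W (Suc l)" "S l"] W(1,2) sub l by auto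
  qed
  have "layered S W" unfolding layered_def using W(1) W0 WL step by auto
  with W(3) show "\<exists>W. layered S W \<and> (\<forall>l\<le>Suc L. U l = sub (W l))" by blast
next
  assume "\<exists>W. layered S W \<and> (\<forall>l\<le>Suc L. U l = sub (W l))"
  then obtain W where L: "layered S W" and U: "\<And>l. l \<le> Suc L \<Longrightarrow> U l = sub (W l)" by blast
  have gr: "graded d (W l)" if "l \<le> Suc L" for l using L that by (simp add: layered_def)
  have g0: "graded d (\<lambda>v. cspace (d v))" "graded d (\<lambda>v. {0})"
    by (auto simp: graded_def subspace_cspace fs.subspace_0[OF subspace_cspace])
  have "sub (W 0) = sub (\<lambda>v. cspace (d v))"
    using L sub_eq_iff[OF gr g0(1), of 0] by (simp add: layered_def)
  then have U0: "U 0 = carrier M" using U[of 0] by (simp add: sub_UNIV)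
  have "sub (W (Suc L)) = sub (\<lambda>v. {0})"
    using L sub_eq_iff[OF gr g0(2), of "Suc L"] by (simp add: layered_def)
  then have UL: "U (Suc L) = {\<zero>\<^bsub>M\<^esub>}" using U[of "Suc L"] by (simp add: sub_zero)
  have sm: "submodule (U l) \<Lambda> M" if "l \<le> Suc L" for l
    using U[OF that] submodule_sub[OF gr[OF that] layered_stable[OF L that]] by simp
  have "U (Suc l) \<subseteq> U l \<and> module_isomorphic \<Lambda> (quotient_module M (U l) (U (Suc l))) (semisimple_module Q (S l))"
    if l: "l \<le> L" for l
  proof -
    have sub: "\<And>v. v \<in> verts Q \<Longrightarrow> W (Suc l) v \<subseteq> W l v"
      and dim: "\<forall>v\<in>verts Q. fs.dim (W l v) = fs.dim (W (Suc l) v) + S l v"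
      and arr: "\<forall>a\<in>arcs Q. act d x a ` W l (tail Q a) \<subseteq> W (Suc l) (head Q a)"
      using L l by (auto simp: layered_def)
    have l': "l \<le> Suc L" "Suc l \<le> Suc L" using l by auto
    have "module_isomorphic \<Lambda> (quotient_module M (sub (W l)) (sub (W (Suc l)))) (semisimple_module Q (S l))"
      using quotient_isomorphic_iff[OF gr[OF l'(1)] layered_stable[OF L l'(1)] gr[OF l'(2)] layered_stable[OF L l'(2)] sub, of "S l"]
        dim arr by blast
    moreover have "sub (W (Suc l)) \<subseteq> sub (W l)"
      using sub_subset_iff[OF gr[OF l'(2)], of "W l"] sub by blast
    ultimately show ?thesis using U[OF l'(1)] U[OF l'(2)] by simp
  qed
  then show "governed_filtration Q L M S U"
    using U0 UL sm by (auto simp: governed_filtration_def Let_def)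
qed

end

section \<open>Adapted frames and polynomial curves\<close>

definition polyfun :: "('k::field \<Rightarrow> 'k) \<Rightarrow> bool" where
  "polyfun r \<longleftrightarrow> (\<exists>p. \<forall>t. r t = poly p t)"

lemma polyfun_const: "polyfun (\<lambda>t. c)"
  unfolding polyfun_def by (intro exI[of _ "[:c:]"]) simp

lemma polyfun_id: "polyfun (\<lambda>t. t)"
  unfolding polyfun_def by (intro exI[of _ "[:0, 1:]"]) simp

lemma polyfun_add:
  assumes "polyfun r" "polyfun s"
  shows "polyfun (\<lambda>t. r t + s t)"
proof -
  obtain p q where "\<forall>t. r t = poly p t" "\<forall>t. s t = poly q t" using assms by (auto simp: polyfun_def)
  then show ?thesis unfolding polyfun_def by (intro exI[of _ "p + q"]) simp
qed

lemma polyfun_mult: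
  assumes "polyfun r" "polyfun s"
  shows "polyfun (\<lambda>t. r t * s t)"
proof -
  obtain p q where "\<forall>t. r t = poly p t" "\<forall>t. s t = poly q t" using assms by (auto simp: polyfun_def)
  then show ?thesis unfolding polyfun_def by (intro exI[of _ "p * q"]) simp
qed

lemma polyfun_diff: "polyfun r \<Longrightarrow> polyfun s \<Longrightarrow> polyfun (\<lambda>t. r t - s t)"
  using polyfun_add[OF _ polyfun_mult[OF polyfun_const[of "-1"]], of r s] by simp

lemma polyfun_sum: "(\<And>i. i \<in> A \<Longrightarrow> polyfun (r i)) \<Longrightarrow> polyfun (\<lambda>t. \<Sum>i\<in>A. r i t)"
proof (induction A rule: infinite_finite_induct)
  case (insert i A)
  then show ?case using polyfun_add[of "r i" "\<lambda>t. \<Sum>i\<in>A. r i t"] by simp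
qed (simp_all add: polyfun_const)

lemma polyfun_prod: "(\<And>i. i \<in> A \<Longrightarrow> polyfun (r i)) \<Longrightarrow> polyfun (\<lambda>t. \<Prod>i\<in>A. r i t)"
proof (induction A rule: infinite_finite_induct)
  case (insert i A)
  then show ?case using polyfun_mult[of "r i" "\<lambda>t. \<Prod>i\<in>A. r i t"] by simp
qed (simp_all add: polyfun_const)

lemma polyfun_det:
  assumes "\<And>i j. i < n \<Longrightarrow> j < n \<Longrightarrow> polyfun (\<lambda>t. F t i j)"
  shows "polyfun (\<lambda>t. det (mat n n (\<lambda>(i, j). F t i j)))"
proof -
  have "polyfun (\<lambda>t. \<Sum>p\<in>{p. p permutes {0..<n}}. signof p * (\<Prod>i = 0..<n. F t i (p i)))"
    using assms by (intro polyfun_sum polyfun_mult polyfun_const polyfun_prod) (auto simp: permutes_in_image)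
  also have "(\<lambda>t. \<Sum>p\<in>{p. p permutes {0..<n}}. signof p * (\<Prod>i = 0..<n. F t i (p i))) =
      (\<lambda>t. det (mat n n (\<lambda>(i, j). F t i j)))"
    by (auto simp: det_def'[of _ n] permutes_in_image intro!: sum.cong prod.cong arg_cong2[of _ _ _ _ "(*)"])
  finally show ?thesis .
qed

lemma polyfun_adj:
  assumes "\<And>i j. i < n \<Longrightarrow> j < n \<Longrightarrow> polyfun (\<lambda>t. F t i j)" "i < n" "j < n"
  shows "polyfun (\<lambda>t. adj_mat (mat n n (\<lambda>(i, j). F t i j)) $$ (i, j))"
proof -
  have "adj_mat (mat n n (\<lambda>(i, j). F t i j)) $$ (i, j) = (-1) ^ (j + i) *
      det (mat (n - 1) (n - 1) (\<lambda>(i', j'). F t (if i' < j then i' else Suc i') (if j' < i then j' else Suc j')))" for t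
    using assms(2,3) unfolding adj_mat_def cofactor_def mat_delete_def
    by (auto intro!: arg_cong[of _ _ det] cong_mat)
  then show ?thesis
    using assms by (auto intro!: polyfun_mult polyfun_const polyfun_det)
qed

text \<open>Over a finite field the product of all t - a, plus 1, has the constant value 1 and thus
  no root.\<close>

lemma infinite_UNIV_alg_closed: "infinite (UNIV :: 'k::alg_closed_field set)"
proof
  assume fin: "finite (UNIV :: 'k set)"
  let ?p = "(\<Prod>a\<in>(UNIV :: 'k set). [:- a, 1:]) + 1"
  have "poly ?p x = 1" for x
    using fin by (simp add: poly_prod prod_zero_iff)
  moreover have "degree ?p > 0"
  proof -
    have "degree (\<Prod>a\<in>(UNIV :: 'k set). [:- a, 1:]) = card (UNIV :: 'k set)"
      by (subst degree_prod_eq_sum_degree) auto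
    moreover have "card (UNIV :: 'k set) > 0" using fin by (simp add: card_gt_0_iff)
    ultimately show ?thesis by (subst degree_add_eq_left) auto
  qed
  ultimately show False using alg_closed_imp_poly_has_root[of ?p] by auto
qed

lemma polyfun_cofinite:
  assumes "polyfun r" "r t0 \<noteq> 0"
  shows "eventually (\<lambda>t. r t \<noteq> 0) cofinite"
proof -
  obtain p where p: "\<And>t. r t = poly p t" using assms by (auto simp: polyfun_def)
  then have "p \<noteq> 0" using assms by auto
  then have "finite {t. poly p t = 0}" by (rule poly_roots_finite)
  then show ?thesis by (simp add: eventually_cofinite p)
qed

lemma cofinite_neq_bot: "(cofinite :: 'k::alg_closed_field filter) \<noteq> bot"
  using infinite_UNIV_alg_closed[where 'k = 'k] by (simp add: trivial_limit_def eventually_cofinite)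

text \<open>\<open>N l v\<close> is the prescribed dimension at \<open>v\<close> of the
  \<open>l\<close>-th member of a filtration; for a semisimple sequence it will be
  \<open>seq_dim\<close>.\<close>

locale flags = trunc Q L for Q :: "('v, 'a) pre_digraph" and L +
  fixes d :: "'v \<Rightarrow> nat" and N :: "nat \<Rightarrow> 'v \<Rightarrow> nat"
  assumes N_0: "v \<in> verts Q \<Longrightarrow> N 0 v = d v"
    and N_Suc: "v \<in> verts Q \<Longrightarrow> l \<le> L \<Longrightarrow> N (Suc l) v \<le> N l v"
    and N_L: "v \<in> verts Q \<Longrightarrow> N (Suc L) v = 0"
begin

text \<open>
  \<open>c a\<close> is the matrix of the arrow \<open>a\<close> with respect to the bases \<open>b\<close>.  In \<open>flagc\<close> and \<open>genc\<close>
  the initial \<open>N l v\<close> vectors of \<open>b v\<close> span the \<open>l\<close>-th member of the filtration; \<open>genc\<close> says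
  that arrows map each member onto a generating set of the next one.
\<close>

definition presents :: "('a \<Rightarrow> 'k::field mat) \<Rightarrow> ('v \<Rightarrow> nat \<Rightarrow> nat \<Rightarrow> 'k) \<Rightarrow> ('a \<Rightarrow> nat \<Rightarrow> nat \<Rightarrow> 'k) \<Rightarrow> bool" where
  "presents x b c \<longleftrightarrow> x \<in> tuples d \<and> (\<forall>v\<in>verts Q. frame (d v) (b v)) \<and>
     (\<forall>a\<in>arcs Q. \<forall>j<d (tail Q a).
        act d x a (b (tail Q a) j) = (\<Sum>i<d (head Q a). fscale (c a i j) (b (head Q a) i)))"

definition flagc :: "('a \<Rightarrow> nat \<Rightarrow> nat \<Rightarrow> 'k::field) \<Rightarrow> bool" where
  "flagc c \<longleftrightarrow> (\<forall>a\<in>arcs Q. \<forall>l\<le>L. \<forall>j<N l (tail Q a). \<forall>i<d (head Q a). N (Suc l) (head Q a) \<le> i \<longrightarrow> c a i j = 0)"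

text \<open>Picks the columns of a minor of full size: column \<open>k\<close> belongs to an arrow
  into \<open>v\<close> and to a basis vector of the \<open>l\<close>-th member at its
  source.\<close>

definition selects :: "nat \<Rightarrow> 'v \<Rightarrow> (nat \<Rightarrow> 'a \<times> nat) \<Rightarrow> bool" where
  "selects l v \<sigma> \<longleftrightarrow> (\<forall>k<N (Suc l) v. fst (\<sigma> k) \<in> arcs Q \<and> head Q (fst (\<sigma> k)) = v \<and>
     snd (\<sigma> k) < N l (tail Q (fst (\<sigma> k))))"

definition genc :: "('a \<Rightarrow> nat \<Rightarrow> nat \<Rightarrow> 'k::field) \<Rightarrow> bool" where
  "genc c \<longleftrightarrow> (\<forall>l\<le>L. \<forall>v\<in>verts Q. \<exists>\<sigma>. selects l v \<sigma> \<and>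
     det (mat (N (Suc l) v) (N (Suc l) v) (\<lambda>(i, k). c (fst (\<sigma> k)) i (snd (\<sigma> k)))) \<noteq> 0)"

lemma N_antimono:
  assumes "v \<in> verts Q" "l \<le> m" "m \<le> Suc L"
  shows "N m v \<le> N l v"
  using assms(2,3)
proof (induction rule: dec_induct)
  case (step k)
  then show ?case using N_Suc[OF assms(1), of k] by simp
qed simp

lemma N_le: "v \<in> verts Q \<Longrightarrow> l \<le> Suc L \<Longrightarrow> N l v \<le> d v"
  using N_antimono[of v 0 l] N_0 by simp

definition chain :: "('v \<Rightarrow> nat \<Rightarrow> nat \<Rightarrow> 'k::field) \<Rightarrow> nat \<Rightarrow> 'v \<Rightarrow> (nat \<Rightarrow> 'k) set" where
  "chain b l v = fs.span (b v ` {..<N l v})"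

text \<open>The counterpart of \<open>layered\<close> that records dimensions of members instead of
  layers, since these are the indices at which an adapted basis is cut.\<close>

definition flagged_by :: "('a \<Rightarrow> 'k::field mat) \<Rightarrow> (nat \<Rightarrow> 'v \<Rightarrow> (nat \<Rightarrow> 'k) set) \<Rightarrow> bool" where
  "flagged_by x W \<longleftrightarrow>
     (\<forall>v\<in>verts Q. W 0 v = cspace (d v) \<and> (\<forall>l\<le>Suc L. fs.subspace (W l v) \<and> fs.dim (W l v) = N l v) \<and>
        (\<forall>l\<le>L. W (Suc l) v \<subseteq> W l v)) \<and>
     (\<forall>l\<le>L. \<forall>a\<in>arcs Q. act d x a ` W l (tail Q a) \<subseteq> W (Suc l) (head Q a))"

lemma flagged_presents:
  fixes x :: "'a \<Rightarrow> 'k::field mat"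
  assumes x: "x \<in> tuples d" and W: "flagged_by x W"
  shows "\<exists>b c. presents x b c \<and> flagc c \<and> (\<forall>l\<le>Suc L. \<forall>v\<in>verts Q. W l v = chain b l v)"
proof -
  have W': "W 0 v = cspace (d v)" "\<And>l. l \<le> Suc L \<Longrightarrow> fs.subspace (W l v)"
    "\<And>l. l \<le> Suc L \<Longrightarrow> fs.dim (W l v) = N l v" "\<And>l. l \<le> L \<Longrightarrow> W (Suc l) v \<subseteq> W l v" if "v \<in> verts Q" for v
    using W that by (auto simp: flagged_by_def)
  have "\<exists>b. v \<in> verts Q \<longrightarrow> frame (d v) b \<and> (\<forall>l\<le>Suc L. fs.span (b ` {..<N l v}) = W l v)" for v
    using adapted_basis[of "Suc L" "\<lambda>l. W l v" "d v"] W'[of v] by (cases "v \<in> verts Q") auto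
  then obtain b where b: "\<And>v. v \<in> verts Q \<Longrightarrow> frame (d v) (b v)"
    "\<And>v l. v \<in> verts Q \<Longrightarrow> l \<le> Suc L \<Longrightarrow> fs.span (b v ` {..<N l v}) = W l v" by metis
  have "\<exists>c. a \<in> arcs Q \<longrightarrow> act d x a (b (tail Q a) j) = (\<Sum>i<d (head Q a). fscale (c i) (b (head Q a) i))" for a j
  proof (cases "a \<in> arcs Q")
    case True
    then have "head Q a \<in> verts Q" by simp
    from frame_coeffs[OF b(1)[OF this] act_in_cspace[of d x a "b (tail Q a) j"]] show ?thesis by blast
  qed auto
  then obtain c where c: "\<And>a j. a \<in> arcs Q \<Longrightarrow>
      act d x a (b (tail Q a) j) = (\<Sum>i<d (head Q a). fscale (c a j i) (b (head Q a) i))" by metis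
  have "flagc (\<lambda>a i j. c a j i)"
    unfolding flagc_def
  proof (intro ballI allI impI)
    fix a l j i assume *: "a \<in> arcs Q" "l \<le> L" "j < N l (tail Q a)" "i < d (head Q a)" "N (Suc l) (head Q a) \<le> i"
    then have v: "tail Q a \<in> verts Q" "head Q a \<in> verts Q" by auto
    have "b (tail Q a) j \<in> W l (tail Q a)"
      using b(2)[OF v(1), of l] * fs.span_base[of "b (tail Q a) j" "b (tail Q a) ` {..<N l (tail Q a)}"] by auto
    then have "act d x a (b (tail Q a) j) \<in> W (Suc l) (head Q a)"
      using W * unfolding flagged_by_def by blast
    then have "(\<Sum>i<d (head Q a). fscale (c a j i) (b (head Q a) i)) \<in> fs.span (b (head Q a) ` {..<N (Suc l) (head Q a)})"
      using b(2)[OF v(2), of "Suc l"] * c by simp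
    then show "c a j i = 0"
      by (rule coeffs_in_initial_span[OF b(1)[OF v(2)]]) (use * N_le[OF v(2)] in auto)
  qed
  moreover have "presents x b (\<lambda>a i j. c a j i)"
    unfolding presents_def using x b c by auto
  ultimately show ?thesis using b(2) unfolding chain_def by metis
qed

lemma presents_flagged:
  fixes x :: "'a \<Rightarrow> 'k::field mat"
  assumes P: "presents x b c" and fl: "flagc c"
  shows "flagged_by x (chain b)"
proof -
  have fr: "frame (d v) (b v)" if "v \<in> verts Q" for v using P that by (simp add: presents_def)
  have "act d x a ` chain b l (tail Q a) \<subseteq> chain b (Suc l) (head Q a)" if a: "a \<in> arcs Q" and l: "l \<le> L" for a l
  proof -
    interpret A: Vector_Spaces.linear fscale fscale "act d x a" by (rule linear_act)
    have v: "tail Q a \<in> verts Q" "head Q a \<in> verts Q" using a by auto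
    have "act d x a (b (tail Q a) j) \<in> chain b (Suc l) (head Q a)" if j: "j < N l (tail Q a)" for j
    proof -
      have "j < d (tail Q a)" using j N_le[OF v(1), of l] l by simp
      then have "act d x a (b (tail Q a) j) = (\<Sum>i<d (head Q a). fscale (c a i j) (b (head Q a) i))"
        using P a by (simp add: presents_def)
      also have "\<dots> \<in> chain b (Suc l) (head Q a)"
        unfolding chain_def
      proof (rule fs.span_sum)
        fix i assume i: "i \<in> {..<d (head Q a)}"
        show "fscale (c a i j) (b (head Q a) i) \<in> fs.span (b (head Q a) ` {..<N (Suc l) (head Q a)})"
        proof (cases "i < N (Suc l) (head Q a)")
          case True
          then show ?thesis by (intro fs.span_scale fs.span_base) auto
        next
          case False
          then have "c a i j = 0" using fl a l j i by (auto simp: flagc_def)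
          then show ?thesis by (simp add: fs.span_zero)
        qed
      qed
      finally show ?thesis .
    qed
    then have "act d x a ` (b (tail Q a) ` {..<N l (tail Q a)}) \<subseteq> chain b (Suc l) (head Q a)" by blast
    then have "fs.span (act d x a ` (b (tail Q a) ` {..<N l (tail Q a)})) \<subseteq> chain b (Suc l) (head Q a)"
      unfolding chain_def by (rule fs.span_minimal) (rule fs.subspace_span)
    then show ?thesis unfolding chain_def A.span_image .
  qed
  moreover have "fs.dim (chain b l v) = N l v" if "v \<in> verts Q" "l \<le> Suc L" for v l
    using indep_fam_independent[OF indep_fam_mono[OF _ N_le[OF that]]] fr[OF that(1)]
    unfolding frame_def chain_def by blast
  moreover have "chain b 0 v = cspace (d v)" if "v \<in> verts Q" for v
    using frame_span[OF fr[OF that]] N_0[OF that] by (simp add: chain_def)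
  moreover have "chain b (Suc l) v \<subseteq> chain b l v" if "v \<in> verts Q" "l \<le> L" for v l
    unfolding chain_def using N_Suc[OF that] by (intro fs.span_mono image_mono) auto
  ultimately show ?thesis
    unfolding flagged_by_def by (auto simp: chain_def)
qed

lemma flagged_act:
  "flagged_by x W \<Longrightarrow> l \<le> L \<Longrightarrow> a \<in> arcs Q \<Longrightarrow> f \<in> W l (tail Q a) \<Longrightarrow> act d x a f \<in> W (Suc l) (head Q a)"
  unfolding flagged_by_def by blast

text \<open>Every arrow moves one step down a chain that reaches zero after \<open>Suc L\<close>
  steps. The relations of the variety thus follow from the staircase shape, which keeps the curves
  inside the variety.\<close>

lemma flagged_rep_variety:
  fixes x :: "'a \<Rightarrow> 'k::field mat"
  assumes x: "x \<in> tuples d" and W: "flagged_by x W"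
  shows "x \<in> rep_variety Q L d"
proof -
  have step: "pact d x p f \<in> W (l + length p) v"
    if "awalk u p v" "f \<in> W l u" "l + length p \<le> Suc L" for u p v f l
    using that
  proof (induction p arbitrary: u f l)
    case Nil
    then show ?case by (simp add: awalk_Nil_iff)
  next
    case (Cons a p)
    then have a: "a \<in> arcs Q" "u = tail Q a" "awalk (head Q a) p v" by (auto simp: awalk_simps)
    have "act d x a f \<in> W (Suc l) (head Q a)"
      using Cons.prems a by (intro flagged_act[OF W]) auto
    then show ?case using Cons.IH[OF a(3), of "act d x a f" "Suc l"] Cons.prems by (simp add: pact_Cons)
  qed
  have "pact d x p f = 0" if p: "awalk u p v" "length p = Suc L" "f \<in> cspace (d u)" for u p v f
  proof -
    have v: "u \<in> verts Q" "v \<in> verts Q" using p awalk_hd_in_verts awalk_last_in_verts by blast+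
    have "pact d x p f \<in> W (Suc L) v"
      using step[OF p(1), of f 0] p W v by (simp add: flagged_by_def)
    moreover have sub: "fs.subspace (W (Suc L) v)" "fs.dim (W (Suc L) v) = 0"
      using W v N_L by (auto simp: flagged_by_def)
    moreover have "W (Suc L) v \<subseteq> cspace (d v)"
    proof -
      have "l \<le> Suc L \<Longrightarrow> W l v \<subseteq> W 0 v" for l
      proof (induction l)
        case (Suc l)
        then show ?case using W v unfolding flagged_by_def by (meson Suc_leD Suc_le_mono order_trans)
      qed simp
      from this[of "Suc L"] show ?thesis using W v by (simp add: flagged_by_def)
    qed
    moreover obtain B where "finite B" "fs.span B = W (Suc L) v" "card B = fs.dim (W (Suc L) v)"
      using subspace_basis[OF sub(1) \<open>W (Suc L) v \<subseteq> cspace (d v)\<close>] by metis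
    ultimately show ?thesis by auto
  qed
  then show ?thesis using x unfolding rep_variety_iff by blast
qed

lemma rad_flagged:
  assumes x: "x \<in> rep_variety Q L d" and dim: "\<And>l v. l \<le> Suc L \<Longrightarrow> v \<in> verts Q \<Longrightarrow> fs.dim (rad d x l v) = N l v"
  shows "flagged_by x (rad d x)"
  unfolding flagged_by_def
proof (intro conjI ballI allI impI)
  show "rad d x (Suc l) v \<subseteq> rad d x l v" for l v by (rule rad_Suc_subset)
  show "act d x a ` rad d x l (tail Q a) \<subseteq> rad d x (Suc l) (head Q a)" if "a \<in> arcs Q" for l a
    using rad_act[OF that] by blast
qed (auto intro: rad_subspace dim simp: rad.simps(1))

text \<open>The arrow images of one member of the radical filtration span the next, so among their
  coordinate vectors in an adapted basis there is a basis. Its determinant is the minor that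
  \<open>genc\<close> asks for.\<close>

lemma rad_presents:
  fixes x :: "'a \<Rightarrow> 'k::field mat"
  assumes x: "x \<in> rep_variety Q L d"
    and dim: "\<And>l v. l \<le> Suc L \<Longrightarrow> v \<in> verts Q \<Longrightarrow> fs.dim (rad d x l v) = N l v"
  shows "\<exists>b c. presents x b c \<and> flagc c \<and> genc c"
proof -
  have xt: "x \<in> tuples d" using x rep_variety_iff by blast
  obtain b c where P: "presents x b c" "flagc c" and ch: "\<And>l v. l \<le> Suc L \<Longrightarrow> v \<in> verts Q \<Longrightarrow> rad d x l v = chain b l v"
    using flagged_presents[OF xt rad_flagged[OF x dim]] by blast
  have "genc c"
    unfolding genc_def
  proof (intro allI impI ballI)
    fix l v assume l: "l \<le> L" and v: "v \<in> verts Q"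
    let ?r = "N (Suc l) v"
    have fr: "frame (d v) (b v)" using P v by (simp add: presents_def)
    have rd: "?r \<le> d v" using N_le[OF v] l by simp
    define col where "col = (\<lambda>(a, j) i. if i < ?r then c a i j else 0)"
    define I where "I = {q. fst q \<in> arcs Q \<and> head Q (fst q) = v \<and> snd q < N l (tail Q (fst q))}"
    have ind: "fs.independent (b v ` {..<d v})" "inj_on (b v) {..<d v}"
      using indep_fam_independent[of "d v" "b v"] fr by (auto simp: frame_def)
    \<comment> \<open>A linear coordinate map for the basis \<open>b v\<close>; it turns the
      spanning statement about subspaces into one about columns of structure constants.\<close>
    obtain \<kappa> where \<kappa>: "flinear \<kappa>" "\<forall>y\<in>b v ` {..<d v}. \<kappa> y = unit_fun (the_inv_into {..<d v} (b v) y)"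
      using fsp.linear_independent_extend[OF ind(1), of "\<lambda>y. unit_fun (the_inv_into {..<d v} (b v) y)"] by blast
    have \<kappa>b: "\<kappa> (b v i) = unit_fun i" if "i < d v" for i
      using \<kappa>(2) that the_inv_into_f_f[OF ind(2)] by auto
    interpret \<kappa>: Vector_Spaces.linear fscale fscale \<kappa> by (rule \<kappa>(1))
    have act_eq: "act d x a (b (tail Q a) j) = (\<Sum>i<?r. fscale (c a i j) (b v i))" if "(a, j) \<in> I" for a j
    proof -
      have a: "a \<in> arcs Q" "head Q a = v" "j < N l (tail Q a)" using that by (auto simp: I_def)
      then have "j < d (tail Q a)" using N_le[of "tail Q a" l] l by auto
      then have "act d x a (b (tail Q a) j) = (\<Sum>i<d v. fscale (c a i j) (b v i))"
        using P a by (auto simp: presents_def)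
      also have "\<dots> = (\<Sum>i<?r. fscale (c a i j) (b v i))"
        using rd P(2) a l by (intro sum.mono_neutral_right) (auto simp: flagc_def)
      finally show ?thesis .
    qed
    have \<kappa>act: "\<kappa> (act d x a (b (tail Q a) j)) = col (a, j)" if "(a, j) \<in> I" for a j
    proof -
      have "\<kappa> (act d x a (b (tail Q a) j)) = (\<Sum>i<?r. fscale (c a i j) (unit_fun i))"
        unfolding act_eq[OF that] using rd by (auto simp: \<kappa>.sum \<kappa>.scale \<kappa>b intro!: sum.cong)
      also have "\<dots> = (\<Sum>i<?r. fscale (col (a, j) i) (unit_fun i))" by (simp add: col_def)
      also have "\<dots> = col (a, j)" by (rule cspace_expand[symmetric]) (simp add: col_def cspace_def)
      finally show ?thesis .
    qed
    have "rad d x (Suc l) v \<subseteq> fs.span ((\<lambda>(a, j). act d x a (b (tail Q a) j)) ` I)"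
      unfolding rad.simps
    proof (rule fs.span_minimal[OF _ fs.subspace_span], rule UN_least)
      fix a assume a: "a \<in> {a \<in> arcs Q. head Q a = v}"
      interpret A: Vector_Spaces.linear fscale fscale "act d x a" by (rule linear_act)
      have "act d x a ` rad d x l (tail Q a) = fs.span (act d x a ` (b (tail Q a) ` {..<N l (tail Q a)}))"
        using ch[of l "tail Q a"] a l by (simp add: chain_def A.span_image)
      also have "\<dots> \<subseteq> fs.span ((\<lambda>(a, j). act d x a (b (tail Q a) j)) ` I)"
        using a by (intro fs.span_mono) (force simp: I_def)
      finally show "act d x a ` rad d x l (tail Q a) \<subseteq> fs.span ((\<lambda>(a, j). act d x a (b (tail Q a) j)) ` I)" .
    qed
    then have "\<kappa> ` rad d x (Suc l) v \<subseteq> \<kappa> ` fs.span ((\<lambda>(a, j). act d x a (b (tail Q a) j)) ` I)" by (rule image_mono)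
    also have "\<dots> = fs.span (\<kappa> ` ((\<lambda>(a, j). act d x a (b (tail Q a) j)) ` I))" by (rule \<kappa>.span_image[symmetric])
    also have "\<kappa> ` ((\<lambda>(a, j). act d x a (b (tail Q a) j)) ` I) = col ` I"
      unfolding image_image using \<kappa>act by (intro image_cong) auto
    finally have sub: "\<kappa> ` rad d x (Suc l) v \<subseteq> fs.span (col ` I)" .
    have "\<kappa> ` rad d x (Suc l) v = fs.span (\<kappa> ` (b v ` {..<?r}))"
      using ch[of "Suc l" v] l v by (simp add: chain_def \<kappa>.span_image del: rad.simps)
    also have "\<kappa> ` (b v ` {..<?r}) = unit_fun ` {..<?r}"
      unfolding image_image using \<kappa>b rd by (intro image_cong) auto
    finally have "cspace ?r \<subseteq> fs.span (col ` I)" using sub by (simp add: span_unit_fun del: rad.simps)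
    moreover have "fs.span (col ` I) \<subseteq> cspace ?r"
      by (intro fs.span_minimal subspace_cspace) (auto simp: col_def cspace_def)
    ultimately have "fs.span (col ` I) = cspace ?r" by blast
    then obtain t where t: "\<forall>k<?r. t k \<in> col ` I" "indep_fam ?r t" using spanning_set_selection by blast
    then have "\<exists>\<sigma>. \<forall>k<?r. \<sigma> k \<in> I \<and> t k = col (\<sigma> k)" by (intro choice) blast
    then obtain \<sigma> where \<sigma>: "\<forall>k<?r. \<sigma> k \<in> I \<and> t k = col (\<sigma> k)" by blast
    have "col q \<in> cspace ?r" for q by (cases q) (simp add: col_def cspace_def)
    then have "t k \<in> cspace ?r" if "k < ?r" for k using \<sigma> that by simp
    then have "det (mat ?r ?r (\<lambda>(i, k). t k i)) \<noteq> 0"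
      using det_columns[of ?r t] t(2) by blast
    also have "mat ?r ?r (\<lambda>(i, k). t k i) = mat ?r ?r (\<lambda>(i, k). c (fst (\<sigma> k)) i (snd (\<sigma> k)))"
      using \<sigma> by (intro cong_mat) (auto simp: col_def split: prod.splits)
    finally show "\<exists>\<sigma>. selects l v \<sigma> \<and> det (mat ?r ?r (\<lambda>(i, k). c (fst (\<sigma> k)) i (snd (\<sigma> k)))) \<noteq> 0"
      using \<sigma> by (intro exI[of _ \<sigma>] conjI) (auto simp: selects_def I_def)
  qed
  with P show ?thesis by blast
qed

text \<open>A nonvanishing minor makes every basis vector of the next member a combination of arrow
  images of the current one, and the radical contains these. The other inclusion holds for every
  flagged chain.\<close>

lemma presents_rad:
  fixes x :: "'a \<Rightarrow> 'k::field mat"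
  assumes P: "presents x b c" "flagc c" "genc c"
  shows "l \<le> Suc L \<Longrightarrow> v \<in> verts Q \<Longrightarrow> rad d x l v = chain b l v"
proof (induction l arbitrary: v)
  case 0
  have "flagged_by x (chain b)" by (rule presents_flagged[OF P(1,2)])
  then show ?case using 0 by (simp add: flagged_by_def)
next
  case (Suc l)
  have fl: "flagged_by x (chain b)" by (rule presents_flagged[OF P(1,2)])
  have v: "v \<in> verts Q" and l: "l \<le> L" using Suc.prems by auto
  let ?r = "N (Suc l) v"
  have rd: "?r \<le> d v" using N_le[OF v] l by simp
  have IH: "rad d x l (tail Q a) = chain b l (tail Q a)" if "a \<in> arcs Q" for a
    using Suc.IH[of "tail Q a"] that l by auto
  show ?case
  proof
    show "rad d x (Suc l) v \<subseteq> chain b (Suc l) v"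
      unfolding rad.simps
    proof (rule fs.span_minimal)
      show "(\<Union>a\<in>{a \<in> arcs Q. head Q a = v}. act d x a ` rad d x l (tail Q a)) \<subseteq> chain b (Suc l) v"
        using flagged_act[OF fl l] IH by auto
      show "fs.subspace (chain b (Suc l) v)" by (simp add: chain_def)
    qed
    obtain \<sigma> where \<sigma>: "selects l v \<sigma>"
      "det (mat ?r ?r (\<lambda>(i, k). c (fst (\<sigma> k)) i (snd (\<sigma> k)))) \<noteq> 0"
      using P(3) l v unfolding genc_def by blast
    define t where "t = (\<lambda>k i. if i < ?r then c (fst (\<sigma> k)) i (snd (\<sigma> k)) else 0)"
    have tc: "t k \<in> cspace ?r" for k by (auto simp: t_def cspace_def)
    have eq: "mat ?r ?r (\<lambda>(i, k). c (fst (\<sigma> k)) i (snd (\<sigma> k))) = mat ?r ?r (\<lambda>(i, k). t k i)"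
      by (intro cong_mat) (auto simp: t_def)
    have "indep_fam ?r t"
      by (rule iffD1[OF det_columns[of ?r t, OF tc]]) (use \<sigma>(2) in \<open>simp only: eq not_False_eq_True\<close>)
    then have "frame ?r t" by (simp add: frame_def tc)
    then have span_t: "fs.span (t ` {..<?r}) = cspace ?r" by (rule frame_span)
    have "b v i \<in> rad d x (Suc l) v" if i: "i < ?r" for i
    proof -
      obtain \<gamma> where \<gamma>: "unit_fun i = (\<Sum>k<?r. fscale (\<gamma> k) (t k))"
        using unit_fun_in_cspace[OF i] span_t span_image_coeffs by blast
      have t_act: "(\<Sum>i'<?r. fscale (t k i') (b v i')) \<in> rad d x (Suc l) v" if k: "k < ?r" for k
      proof -
        let ?a = "fst (\<sigma> k)" and ?j = "snd (\<sigma> k)"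
        have a: "?a \<in> arcs Q" "head Q ?a = v" "?j < N l (tail Q ?a)" using \<sigma>(1) k by (auto simp: selects_def)
        then have "?j < d (tail Q ?a)" using N_le[of "tail Q ?a" l] l by auto
        then have "act d x ?a (b (tail Q ?a) ?j) = (\<Sum>i<d v. fscale (c ?a i ?j) (b v i))"
          using P a by (auto simp: presents_def)
        also have "\<dots> = (\<Sum>i'<?r. fscale (t k i') (b v i'))"
          using rd P(2) a l by (intro sum.mono_neutral_cong_right) (auto simp: flagc_def t_def)
        finally have eq: "act d x ?a (b (tail Q ?a) ?j) = (\<Sum>i'<?r. fscale (t k i') (b v i'))" .
        have "b (tail Q ?a) ?j \<in> rad d x l (tail Q ?a)"
          unfolding IH[OF a(1)] chain_def using a by (intro fs.span_base) auto
        then have "act d x ?a (b (tail Q ?a) ?j) \<in> rad d x (Suc l) (head Q ?a)" by (rule rad_act[OF a(1)])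
        then show ?thesis using eq a by simp
      qed
      have "b v i = (\<Sum>i'<?r. fscale (unit_fun i i') (b v i'))"
        using i by (subst sum.remove[of _ i]) (auto simp: unit_fun_def intro!: sum.neutral)
      also have "\<dots> = (\<Sum>i'<?r. \<Sum>k<?r. fscale (\<gamma> k) (fscale (t k i') (b v i')))"
        unfolding \<gamma> sum_fun_apply fs.scale_sum_left by (simp add: fscale_apply)
      also have "\<dots> = (\<Sum>k<?r. fscale (\<gamma> k) (\<Sum>i'<?r. fscale (t k i') (b v i')))"
        by (subst sum.swap) (simp add: fs.scale_sum_right)
      also have "\<dots> \<in> rad d x (Suc l) v"
        using t_act by (intro fs.subspace_sum[OF rad_subspace]) (simp add: fs.subspace_scale[OF rad_subspace] del: rad.simps)
      finally show ?thesis .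
    qed
    then show "chain b (Suc l) v \<subseteq> rad d x (Suc l) v"
      unfolding chain_def by (intro fs.span_minimal rad_subspace) auto
  qed
qed

lemma tuple_eqI:
  fixes x y :: "'a \<Rightarrow> 'k::field mat"
  assumes x: "x \<in> tuples d" and y: "y \<in> tuples d" and fr: "\<And>v. v \<in> verts Q \<Longrightarrow> frame (d v) (b v)"
    and eq: "\<And>a j. a \<in> arcs Q \<Longrightarrow> j < d (tail Q a) \<Longrightarrow> act d x a (b (tail Q a) j) = act d y a (b (tail Q a) j)"
  shows "x = y"
proof (rule PiE_ext[OF x[unfolded tuples_def] y[unfolded tuples_def]])
  fix a assume a: "a \<in> arcs Q"
  interpret X: Vector_Spaces.linear fscale fscale "act d x a" by (rule linear_act)
  interpret Y: Vector_Spaces.linear fscale fscale "act d y a" by (rule linear_act)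
  have act_eq: "act d x a f = act d y a f" if f: "f \<in> cspace (d (tail Q a))" for f
  proof -
    obtain c where "f = (\<Sum>j<d (tail Q a). fscale (c j) (b (tail Q a) j))"
      using frame_coeffs[OF fr f] a by auto
    then show ?thesis using eq[OF a] by (auto simp: X.sum X.scale Y.sum Y.scale intro!: sum.cong)
  qed
  have entry: "act d z a (unit_fun j) i = z a $$ (i, j)" if "i < d (head Q a)" "j < d (tail Q a)" for z :: "'a \<Rightarrow> 'k mat" and i j
    using that by (simp add: act_def unit_fun_def if_distrib cong: if_cong)
  have "x a \<in> carrier_mat (d (head Q a)) (d (tail Q a))" "y a \<in> carrier_mat (d (head Q a)) (d (tail Q a))"
    using x y a by (auto simp: tuples_def)
  moreover have "x a $$ (i, j) = y a $$ (i, j)" if ij: "i < d (head Q a)" "j < d (tail Q a)" for i j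
    using entry[OF ij, of x] entry[OF ij, of y] act_eq[OF unit_fun_in_cspace[OF ij(2)]] by simp
  ultimately show "x a = y a" by (intro eq_matI) auto
qed

text \<open>
  The curve interpolates bases and structure constants linearly.  Transporting structure constants
  back with the adjugate instead of the inverse keeps it polynomial, at the price of a nonzero
  factor on each arrow.
\<close>

lemma polynomial_curve:
  fixes x y :: "'a \<Rightarrow> 'k::alg_closed_field mat"
  assumes x: "presents x b c" "flagc c" and y: "presents y b' c'" "flagc c'" "genc c'"
  shows "\<exists>\<gamma>. (\<forall>a i j. a \<in> arcs Q \<longrightarrow> i < d (head Q a) \<longrightarrow> j < d (tail Q a) \<longrightarrow> polyfun (\<lambda>t. \<gamma> t a $$ (i, j))) \<and>
    \<gamma> 0 = x \<and> \<gamma> 1 = y \<and> eventually (\<lambda>t. \<exists>B C. presents (\<gamma> t) B C \<and> flagc C \<and> genc C) cofinite"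
proof -
  define B where "B = (\<lambda>t v j i. (1 - t) * b v j i + t * b' v j i)"
  define G where "G = (\<lambda>t v. mat (d v) (d v) (\<lambda>(i, j). B t v j i))"
  define D where "D = (\<lambda>t v. det (G t v))"
  define A where "A = (\<lambda>t v. adj_mat (G t v))"
  \<comment> \<open>The adjugate multiplies the constants on an arrow by the determinant at its
    source. Dividing by the values of this determinant at 0 and 1, which are scalars, makes the
    endpoints come out as \<open>x\<close> and \<open>y\<close> and keeps \<open>C\<close> of degree
    at most one in \<open>t\<close>.\<close>
  define C where "C = (\<lambda>t a i j. (1 - t) * (c a i j / D 0 (tail Q a)) + t * (c' a i j / D 1 (tail Q a)))"
  define \<gamma> where "\<gamma> = (\<lambda>t. \<lambda>a\<in>arcs Q. mat (d (head Q a)) (d (tail Q a)) (\<lambda>(r, s).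
     \<Sum>i<d (head Q a). \<Sum>j<d (tail Q a). C t a i j * B t (head Q a) i r * A t (tail Q a) $$ (j, s)))"
  have B01: "B 0 = b" "B 1 = b'" by (auto simp: B_def fun_eq_iff)
  have fr: "frame (d v) (b v)" "frame (d v) (b' v)" if "v \<in> verts Q" for v
    using x y that by (auto simp: presents_def)
  have Bc: "B t v j \<in> cspace (d v)" if "v \<in> verts Q" "j < d v" for t v j
    using fr[OF that(1)] that(2) by (auto simp: B_def frame_def cspace_def)
  have Bframe: "frame (d v) (B t v) \<longleftrightarrow> D t v \<noteq> 0" if "v \<in> verts Q" for t v
    unfolding D_def G_def using det_columns[of "d v" "B t v"] Bc[OF that] by (auto simp: frame_def)
  have D01: "D 0 v \<noteq> 0" "D 1 v \<noteq> 0" if "v \<in> verts Q" for v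
    using Bframe[OF that, of 0] Bframe[OF that, of 1] fr[OF that] B01 by auto
  have polyB: "polyfun (\<lambda>t. B t v j i)" for v j i
    unfolding B_def by (intro polyfun_add polyfun_mult polyfun_diff polyfun_const polyfun_id)
  have polyC: "polyfun (\<lambda>t. C t a i j)" for a i j
    unfolding C_def by (intro polyfun_add polyfun_mult polyfun_diff polyfun_const polyfun_id)
  have polyD: "polyfun (\<lambda>t. D t v)" for v
    unfolding D_def G_def by (intro polyfun_det polyB)
  have polyA: "polyfun (\<lambda>t. A t v $$ (i, j))" if "i < d v" "j < d v" for v i j
    unfolding A_def G_def by (intro polyfun_adj polyB that)
  have poly\<gamma>: "polyfun (\<lambda>t. \<gamma> t a $$ (i, j))" if "a \<in> arcs Q" "i < d (head Q a)" "j < d (tail Q a)" for a i j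
    using that by (auto simp: \<gamma>_def intro!: polyfun_sum polyfun_mult polyB polyC polyA)
  have \<gamma>t: "\<gamma> t \<in> tuples d" for t by (auto simp: \<gamma>_def tuples_def)
  have adj: "(\<Sum>s<d v. A t v $$ (j, s) * B t v j0 s) = (if j = j0 then D t v else 0)" if "j < d v" "j0 < d v" for t v j j0
  proof -
    have Gc: "G t v \<in> carrier_mat (d v) (d v)" by (simp add: G_def)
    have Ac: "A t v \<in> carrier_mat (d v) (d v)" unfolding A_def using adj_mat(1)[OF Gc] .
    have "A t v * G t v = D t v \<cdot>\<^sub>m 1\<^sub>m (d v)" unfolding A_def D_def using adj_mat(3)[OF Gc] .
    then have "(A t v * G t v) $$ (j, j0) = (if j = j0 then D t v else 0)" using that by simp
    moreover have "(A t v * G t v) $$ (j, j0) = (\<Sum>s<d v. A t v $$ (j, s) * B t v j0 s)"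
      using that Ac Gc by (simp add: scalar_prod_def lessThan_atLeast0 G_def)
    ultimately show ?thesis by simp
  qed
  \<comment> \<open>The identity holds for every \<open>t\<close>, even where \<open>B t\<close>
    fails to be a basis; where it is one, these are the structure constants of the curve.\<close>
  have act\<gamma>: "act d (\<gamma> t) a (B t (tail Q a) j0) = (\<Sum>i<d (head Q a). fscale (D t (tail Q a) * C t a i j0) (B t (head Q a) i))"
    if a: "a \<in> arcs Q" and j0: "j0 < d (tail Q a)" for t a j0
  proof
    fix r
    let ?h = "head Q a" and ?u = "tail Q a"
    show "act d (\<gamma> t) a (B t ?u j0) r = (\<Sum>i<d ?h. fscale (D t ?u * C t a i j0) (B t ?h i)) r"
    proof (cases "r < d ?h")
      case True
      have "act d (\<gamma> t) a (B t ?u j0) r = (\<Sum>s<d ?u. (\<Sum>i<d ?h. \<Sum>j<d ?u. C t a i j * B t ?h i r * A t ?u $$ (j, s)) * B t ?u j0 s)"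
        using a True by (simp add: act_def \<gamma>_def)
      also have "\<dots> = (\<Sum>s<d ?u. \<Sum>i<d ?h. \<Sum>j<d ?u. C t a i j * B t ?h i r * (A t ?u $$ (j, s) * B t ?u j0 s))"
        by (simp add: sum_distrib_right mult.assoc)
      also have "\<dots> = (\<Sum>i<d ?h. \<Sum>j<d ?u. \<Sum>s<d ?u. C t a i j * B t ?h i r * (A t ?u $$ (j, s) * B t ?u j0 s))"
        by (subst sum.swap) (intro sum.cong[OF refl] sum.swap)
      also have "\<dots> = (\<Sum>i<d ?h. \<Sum>j<d ?u. C t a i j * B t ?h i r * (if j = j0 then D t ?u else 0))"
        using j0 by (intro sum.cong refl) (simp add: sum_distrib_left[symmetric] adj)
      also have "\<dots> = (\<Sum>i<d ?h. D t ?u * C t a i j0 * B t ?h i r)"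
        using j0 by (intro sum.cong refl) (simp add: if_distrib mult.commute mult.left_commute cong: if_cong)
      finally show ?thesis by (simp add: sum_fun_apply fscale_apply)
    next
      case False
      have "act d (\<gamma> t) a (B t ?u j0) r = 0" using False by (simp add: act_def)
      moreover have "B t ?h i r = 0" if "i < d ?h" for i
        using Bc[of ?h i t] a that False by (auto simp: cspace_def)
      ultimately show ?thesis by (simp add: sum_fun_apply fscale_apply)
    qed
  qed
  have \<gamma>0: "\<gamma> 0 = x"
  proof (rule tuple_eqI[OF \<gamma>t _ fr(1)])
    show "x \<in> tuples d" using x by (simp add: presents_def)
    fix a j assume a: "a \<in> arcs Q" "j < d (tail Q a)"
    have "D 0 (tail Q a) * C 0 a i j = c a i j" for i using D01[of "tail Q a"] a by (simp add: C_def)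
    then show "act d (\<gamma> 0) a (b (tail Q a) j) = act d x a (b (tail Q a) j)"
      using act\<gamma>[OF a, of 0] x a by (simp add: B01 presents_def)
  qed
  have C1: "D 1 (tail Q a) * C 1 a i j = c' a i j" if "a \<in> arcs Q" for a i j
    using D01[of "tail Q a"] that by (simp add: C_def)
  have \<gamma>1: "\<gamma> 1 = y"
  proof (rule tuple_eqI[OF \<gamma>t _ fr(2)])
    show "y \<in> tuples d" using y by (simp add: presents_def)
    fix a j assume a: "a \<in> arcs Q" "j < d (tail Q a)"
    then show "act d (\<gamma> 1) a (b' (tail Q a) j) = act d y a (b' (tail Q a) j)"
      using act\<gamma>[OF a, of 1] y a C1 by (simp add: B01 presents_def)
  qed
  let ?C = "\<lambda>t a i j. D t (tail Q a) * C t a i j"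
  have flag: "flagc (?C t)" for t
    using x(2) y(2) by (auto simp: flagc_def C_def)
  have evD: "eventually (\<lambda>t. \<forall>v\<in>verts Q. D t v \<noteq> 0) cofinite"
  proof (intro eventually_ball_finite finite_verts ballI)
    fix v assume "v \<in> verts Q"
    then show "eventually (\<lambda>t. D t v \<noteq> 0) cofinite" by (rule polyfun_cofinite[OF polyD D01(1)])
  qed
  have "eventually (\<lambda>t. \<forall>l\<in>{..L}. \<forall>v\<in>verts Q. \<exists>\<sigma>. selects l v \<sigma> \<and>
     det (mat (N (Suc l) v) (N (Suc l) v) (\<lambda>(i, k). ?C t (fst (\<sigma> k)) i (snd (\<sigma> k)))) \<noteq> 0) cofinite"
  proof (intro eventually_ball_finite finite_verts ballI finite_atMost)
    fix l v assume l: "l \<in> {..L}" and v: "v \<in> verts Q"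
    let ?r = "N (Suc l) v"
    obtain \<sigma> where \<sigma>: "selects l v \<sigma>" "det (mat ?r ?r (\<lambda>(i, k). c' (fst (\<sigma> k)) i (snd (\<sigma> k)))) \<noteq> 0"
      using y(3) l v by (auto simp: genc_def)
    have "mat ?r ?r (\<lambda>(i, k). c' (fst (\<sigma> k)) i (snd (\<sigma> k))) = mat ?r ?r (\<lambda>(i, k). ?C 1 (fst (\<sigma> k)) i (snd (\<sigma> k)))"
      using \<sigma>(1) by (intro cong_mat) (auto simp: C1 selects_def)
    \<comment> \<open>The minor is nonzero at parameter 1 because of \<open>y\<close>, hence at all
      but finitely many parameters.\<close>
    then have nz: "det (mat ?r ?r (\<lambda>(i, k). ?C 1 (fst (\<sigma> k)) i (snd (\<sigma> k)))) \<noteq> 0" using \<sigma>(2) by simp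
    have pf: "polyfun (\<lambda>t. det (mat ?r ?r (\<lambda>(i, k). ?C t (fst (\<sigma> k)) i (snd (\<sigma> k)))))"
      by (intro polyfun_det polyfun_mult polyD polyC)
    have "eventually (\<lambda>t. det (mat ?r ?r (\<lambda>(i, k). ?C t (fst (\<sigma> k)) i (snd (\<sigma> k)))) \<noteq> 0) cofinite"
      by (rule polyfun_cofinite[OF pf nz])
    then show "eventually (\<lambda>t. \<exists>\<sigma>. selects l v \<sigma> \<and>
       det (mat ?r ?r (\<lambda>(i, k). ?C t (fst (\<sigma> k)) i (snd (\<sigma> k)))) \<noteq> 0) cofinite"
      by eventually_elim (use \<sigma>(1) in blast)
  qed
  with evD have "eventually (\<lambda>t. \<exists>B C. presents (\<gamma> t) B C \<and> flagc C \<and> genc C) cofinite"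
  proof eventually_elim
    case (elim t)
    have "presents (\<gamma> t) (B t) (?C t)" using \<gamma>t act\<gamma> Bframe elim(1) by (auto simp: presents_def)
    moreover have "genc (?C t)" using elim(2) by (simp add: genc_def)
    ultimately show ?case using flag by blast
  qed
  with poly\<gamma> \<gamma>0 \<gamma>1 show ?thesis by blast
qed

end

section \<open>Specialisation of filtrations\<close>

lemma triangular_indep_fam:
  fixes m :: nat
  assumes one: "\<And>j. j < m \<Longrightarrow> \<phi> j (\<pi> j) = (1 :: 'k::field)"
    and zero: "\<And>j k. k < j \<Longrightarrow> j < m \<Longrightarrow> \<phi> j (\<pi> k) = 0"
  shows "indep_fam m \<phi>"
  unfolding indep_fam_def
proof (intro allI impI notI)
  fix j assume j: "j < m" "\<phi> j \<in> fs.span (\<phi> ` {..<j})"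
  then obtain \<gamma> where \<gamma>: "\<phi> j = (\<Sum>k<j. fscale (\<gamma> k) (\<phi> k))" using span_image_coeffs by blast
  have "\<gamma> k = 0" if "k < j" for k
    using that
  proof (induction k rule: less_induct)
    case (less k)
    have "0 = (\<Sum>i<j. \<gamma> i * \<phi> i (\<pi> k))"
      using zero[OF less.prems j(1)] \<gamma> by (simp add: sum_fun_apply fscale_apply)
    also have "\<dots> = (\<Sum>i\<in>{k}. \<gamma> i * \<phi> i (\<pi> k))"
    proof (rule sum.mono_neutral_right)
      show "\<forall>i\<in>{..<j} - {k}. \<gamma> i * \<phi> i (\<pi> k) = 0"
      proof
        fix i assume i: "i \<in> {..<j} - {k}"
        show "\<gamma> i * \<phi> i (\<pi> k) = 0"
        proof (cases "i < k")
          case True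
          then show ?thesis using less.IH[of i] less.prems by simp
        next
          case False
          then have "k < i" "i < m" using i j by auto
          then show ?thesis using zero[of k i] by simp
        qed
      qed
    qed (use less.prems in auto)
    finally show ?case using one[of k] less.prems j by simp
  qed
  then have "\<phi> j = 0" unfolding \<gamma> by (intro sum.neutral) auto
  then show False using one[OF j(1)] by (simp add: fun_apply)
qed

text \<open>Gaussian elimination in the order of the pivots: clearing a later one leaves the earlier
  ones alone, since \<open>e m\<close> vanishes there.\<close>

lemma triangular_eliminate:
  fixes m :: nat
  assumes one: "\<And>j. j < m \<Longrightarrow> e j (\<pi> j) = (1 :: 'k::field)"
    and zero: "\<And>j k. k < j \<Longrightarrow> j < m \<Longrightarrow> e j (\<pi> k) = 0"
  shows "\<exists>u\<in>fs.span (e ` {..<m}). \<forall>k<m. (w - u) (\<pi> k) = 0"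
  using assms
proof (induction m)
  case 0
  then show ?case by (intro bexI[of _ 0]) (auto simp: fs.span_zero)
next
  case (Suc m)
  have "\<exists>u\<in>fs.span (e ` {..<m}). \<forall>k<m. (w - u) (\<pi> k) = 0"
    by (rule Suc.IH) (use Suc.prems in auto)
  then obtain u where u: "u \<in> fs.span (e ` {..<m})" "\<forall>k<m. (w - u) (\<pi> k) = 0" by blast
  let ?u = "u + fscale ((w - u) (\<pi> m)) (e m)"
  have "fs.span (e ` {..<m}) \<subseteq> fs.span (e ` {..<Suc m})" by (intro fs.span_mono) auto
  then have "u \<in> fs.span (e ` {..<Suc m})" using u(1) by blast
  then have "?u \<in> fs.span (e ` {..<Suc m})"
    by (intro fs.span_add fs.span_scale) (auto intro: fs.span_base)
  moreover have "(w - ?u) (\<pi> k) = 0" if k: "k < Suc m" for k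
  proof (cases "k = m")
    case True
    then show ?thesis using Suc.prems(1)[of m] by (simp add: fun_apply fscale_apply)
  next
    case False
    then have "k < m" using k by simp
    then show ?thesis using u(2) Suc.prems(2)[of k m] by (simp add: fun_apply fscale_apply)
  qed
  ultimately show ?case by blast
qed

lemma span_insert_adjust:
  assumes "fs.span E = fs.span B" "u \<in> fs.span E" "\<kappa> \<noteq> (0::'k::field)" "e = fscale \<kappa> (b - u)"
  shows "fs.span (insert e E) = fs.span (insert b B)"
proof -
  have EB: "E \<subseteq> fs.span B" "B \<subseteq> fs.span E" using assms(1) fs.span_superset by blast+
  have mono: "fs.span B \<subseteq> fs.span (insert b B)" "fs.span E \<subseteq> fs.span (insert e E)"
    by (intro fs.span_mono, blast)+
  have "u \<in> fs.span (insert b B)" using assms(1,2) mono by blast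
  then have "e \<in> fs.span (insert b B)"
    unfolding assms(4) by (intro fs.span_scale fs.span_diff) (auto intro: fs.span_base)
  then have 1: "insert e E \<subseteq> fs.span (insert b B)" using EB mono by blast
  have "b = fscale (1 / \<kappa>) e + u" using assms(3,4) by simp
  moreover have "u \<in> fs.span (insert e E)" using assms(2) mono by blast
  then have "fscale (1 / \<kappa>) e + u \<in> fs.span (insert e E)"
    by (intro fs.span_add fs.span_scale) (auto intro: fs.span_base)
  ultimately have "b \<in> fs.span (insert e E)" by simp
  then have 2: "insert b B \<subseteq> fs.span (insert e E)" using EB mono by blast
  show ?thesis
    using fs.span_minimal[OF 1 fs.subspace_span] fs.span_minimal[OF 2 fs.subspace_span] by blast
qed

context place
begin

text \<open>
  Echelon form over the valuation ring of the place: every family of bases parametrised by \<open>z\<close>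
  is equivalent, initial segment by initial segment, to one whose entries are finite
  and which stays a basis after specialisation.
\<close>

lemma echelon_family:
  fixes b :: "nat \<Rightarrow> 'z \<Rightarrow> nat \<Rightarrow> 'k"
  assumes b: "eventually (\<lambda>z. frame n (\<lambda>j. b j z)) F"
  shows "m \<le> n \<Longrightarrow> \<exists>e \<pi> \<phi>.
    eventually (\<lambda>z. \<forall>k\<le>m. fs.span ((\<lambda>j. e j z) ` {..<k}) = fs.span ((\<lambda>j. b j z) ` {..<k})) F \<and>
    eventually (\<lambda>z. (\<forall>j<m. e j z (\<pi> j) = 1) \<and> (\<forall>j<m. \<forall>k<j. e j z (\<pi> k) = 0)) F \<and>
    (\<forall>j<m. \<pi> j < n \<and> \<phi> j \<in> cspace n \<and> (\<forall>i<n. (\<lambda>z. e j z i, \<phi> j i) \<in> G))"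
proof (induction m)
  case 0
  show ?case by (intro exI[of _ "\<lambda>_ _ _. 0"] exI[of _ "\<lambda>_. 0"]) simp
next
  case (Suc m)
  then obtain e \<pi> \<phi> where
    sp: "eventually (\<lambda>z. \<forall>k\<le>m. fs.span ((\<lambda>j. e j z) ` {..<k}) = fs.span ((\<lambda>j. b j z) ` {..<k})) F" and
    tri: "eventually (\<lambda>z. (\<forall>j<m. e j z (\<pi> j) = 1) \<and> (\<forall>j<m. \<forall>k<j. e j z (\<pi> k) = 0)) F" and
    fin: "\<And>j. j < m \<Longrightarrow> \<pi> j < n \<and> \<phi> j \<in> cspace n \<and> (\<forall>i<n. (\<lambda>z. e j z i, \<phi> j i) \<in> G)" by auto
  have m: "m < n" using Suc.prems by simp
  let ?tri = "\<lambda>z. (\<forall>j<m. e j z (\<pi> j) = 1) \<and> (\<forall>j<m. \<forall>k<j. e j z (\<pi> k) = 0)"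
  \<comment> \<open>Subtracting \<open>u\<close> clears the earlier pivots from the new vector and
    preserves the spans. It is chosen for each \<open>z\<close> separately, and its entries may well
    be infinite.\<close>
  have "\<exists>u. ?tri z \<longrightarrow> u \<in> fs.span ((\<lambda>j. e j z) ` {..<m}) \<and> (\<forall>k<m. (b m z - u) (\<pi> k) = 0)" for z
    using triangular_eliminate[of m "\<lambda>j. e j z" \<pi> "b m z"] by blast
  then obtain u where u: "\<And>z. ?tri z \<Longrightarrow> u z \<in> fs.span ((\<lambda>j. e j z) ` {..<m}) \<and> (\<forall>k<m. (b m z - u z) (\<pi> k) = 0)"
    by metis
  define w where "w = (\<lambda>z. b m z - u z)"
  have ev: "eventually (\<lambda>z. w z \<in> cspace n \<and> w z \<noteq> 0) F"
    using b sp tri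
  proof eventually_elim
    case (elim z)
    have span_eq: "fs.span ((\<lambda>j. e j z) ` {..<m}) = fs.span ((\<lambda>j. b j z) ` {..<m})" using elim(2) by blast
    have uz: "u z \<in> fs.span ((\<lambda>j. b j z) ` {..<m})" using u[OF elim(3)] span_eq by simp
    have "b m z \<notin> fs.span ((\<lambda>j. b j z) ` {..<m})"
      using elim(1) m by (auto simp: frame_def indep_fam_def)
    then have "w z \<noteq> 0" using uz by (auto simp: w_def)
    moreover have "fs.span ((\<lambda>j. b j z) ` {..<m}) \<subseteq> cspace n"
      using elim(1) m by (intro fs.span_minimal subspace_cspace) (auto simp: frame_def)
    then have "u z \<in> cspace n" using uz by blast
    then have "w z \<in> cspace n"
      unfolding w_def using elim(1) m by (intro fs.subspace_diff[OF subspace_cspace]) (auto simp: frame_def)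
    ultimately show ?case by blast
  qed
  have "eventually (\<lambda>z. \<exists>i<n. w z i \<noteq> 0) F"
    using ev by eventually_elim (force simp: cspace_def fun_eq_iff fun_apply not_le)
  \<comment> \<open>Dividing by an entry of least valuation makes all entries finite and this entry
    equal to 1. The latter keeps the family independent after specialisation.\<close>
  from pivot[of n "\<lambda>i z. w z i", OF this] obtain p where
    p: "p < n" "eventually (\<lambda>z. w z p \<noteq> 0) F" "\<forall>i<n. \<exists>c. (\<lambda>z. w z i / w z p, c) \<in> G" by blast
  obtain \<psi> where \<psi>: "\<And>i. i < n \<Longrightarrow> (\<lambda>z. w z i / w z p, \<psi> i) \<in> G" using p(3) by metis
  let ?e = "e(m := \<lambda>z. fscale (1 / w z p) (w z))"
  let ?\<pi> = "\<pi>(m := p)"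
  let ?\<phi> = "\<phi>(m := \<lambda>i. if i < n then \<psi> i else 0)"
  have im: "(\<lambda>j. ?e j z) ` {..<k} = (\<lambda>j. e j z) ` {..<k}" if "k \<le> m" for k z
    using that by (intro image_cong) auto
  have 1: "eventually (\<lambda>z. \<forall>k\<le>Suc m. fs.span ((\<lambda>j. ?e j z) ` {..<k}) = fs.span ((\<lambda>j. b j z) ` {..<k})) F"
    using sp tri p(2)
  proof eventually_elim
    case (elim z)
    have "fs.span (insert (fscale (1 / w z p) (w z)) ((\<lambda>j. e j z) ` {..<m})) =
        fs.span (insert (b m z) ((\<lambda>j. b j z) ` {..<m}))"
      by (rule span_insert_adjust[where u = "u z" and \<kappa> = "1 / w z p"])
        (use elim u in \<open>auto simp: w_def\<close>)
    then have "fs.span ((\<lambda>j. ?e j z) ` {..<Suc m}) = fs.span ((\<lambda>j. b j z) ` {..<Suc m})"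
      using im[of m z] by (simp add: lessThan_Suc)
    then show ?case using elim(1) im by (auto simp: le_Suc_eq)
  qed
  have 2: "eventually (\<lambda>z. (\<forall>j<Suc m. ?e j z (?\<pi> j) = 1) \<and> (\<forall>j<Suc m. \<forall>k<j. ?e j z (?\<pi> k) = 0)) F"
    using tri p(2)
  proof eventually_elim
    case (elim z)
    have "w z (\<pi> k) = 0" if "k < m" for k using u[OF elim(1)] that by (simp add: w_def)
    then show ?case using elim by (auto simp: less_Suc_eq fscale_apply)
  qed
  have 3: "\<forall>j<Suc m. ?\<pi> j < n \<and> ?\<phi> j \<in> cspace n \<and> (\<forall>i<n. (\<lambda>z. ?e j z i, ?\<phi> j i) \<in> G)"
    using fin p(1) \<psi> by (auto simp: less_Suc_eq fscale_apply cspace_def)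
  show ?case using 1 2 3 by blast
qed

text \<open>In an echelon family the coefficient of \<open>e k\<close> is read off at the pivot of
  \<open>k\<close>, where the later members vanish. It is therefore finite, and subtracting this
  term, together with its specialisation, leaves a shorter combination.\<close>

lemma specialize_span:
  fixes k m n :: nat
  assumes tri: "eventually (\<lambda>z. (\<forall>j<m. e j z (\<pi> j) = 1) \<and> (\<forall>j<m. \<forall>k<j. e j z (\<pi> k) = 0)) F"
    and fin: "\<And>j. j < m \<Longrightarrow> \<pi> j < n \<and> \<phi> j \<in> cspace n \<and> (\<forall>i<n. (\<lambda>z. e j z i, \<phi> j i) \<in> G)"
    and w: "eventually (\<lambda>z. w z \<in> fs.span ((\<lambda>j. e j z) ` {k..<m})) F"
      "\<And>i. i < n \<Longrightarrow> (\<lambda>z. w z i, \<omega> i) \<in> G" "\<omega> \<in> cspace n"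
  shows "\<omega> \<in> fs.span (\<phi> ` {..<m})"
  using w
proof (induction "m - k" arbitrary: k w \<omega>)
  case 0
  then have "eventually (\<lambda>z. w z = 0) F" by simp
  then have "eventually (\<lambda>z. w z i = 0) F" for i by eventually_elim (simp add: fun_apply)
  then have "\<omega> i = 0" if "i < n" for i using null 0(3)[OF that] by blast
  then have "\<omega> i = 0" for i using 0(4) by (cases "i < n") (auto simp: cspace_def)
  then have "\<omega> = 0" by (simp add: fun_eq_iff fun_apply)
  then show ?case by (simp add: fs.span_zero)
next
  case (Suc r)
  have k: "k < m" using Suc(2) by simp
  have \<pi>k: "\<pi> k < n" and \<phi>k: "\<phi> k \<in> cspace n" "\<And>i. i < n \<Longrightarrow> (\<lambda>z. e k z i, \<phi> k i) \<in> G" using fin[OF k] by auto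
  let ?w = "\<lambda>z. w z - fscale (w z (\<pi> k)) (e k z)"
  let ?\<omega> = "\<omega> - fscale (\<omega> (\<pi> k)) (\<phi> k)"
  have "eventually (\<lambda>z. ?w z \<in> fs.span ((\<lambda>j. e j z) ` {Suc k..<m})) F"
    using tri Suc(3)
  proof eventually_elim
    case (elim z)
    have "{k..<m} = insert k {Suc k..<m}" using k by auto
    then have "w z \<in> fs.span (insert (e k z) ((\<lambda>j. e j z) ` {Suc k..<m}))" using elim(2) by simp
    then obtain \<gamma> where \<gamma>: "w z - fscale \<gamma> (e k z) \<in> fs.span ((\<lambda>j. e j z) ` {Suc k..<m})"
      unfolding fs.span_insert by blast
    have "fs.span ((\<lambda>j. e j z) ` {Suc k..<m}) \<subseteq> {f. f (\<pi> k) = 0}"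
      using elim(1) by (intro fs.span_minimal) (auto simp: fs.subspace_def fun_apply fscale_apply)
    then have "(w z - fscale \<gamma> (e k z)) (\<pi> k) = 0" using \<gamma> by blast
    then have "\<gamma> = w z (\<pi> k)" using elim(1) k by (simp add: fun_apply fscale_apply)
    then show ?case using \<gamma> by simp
  qed
  moreover have "(\<lambda>z. ?w z i, ?\<omega> i) \<in> G" if "i < n" for i
    using diff[OF Suc(4)[OF that] mult[OF Suc(4)[OF \<pi>k] \<phi>k(2)[OF that]]]
    by (simp add: fun_apply fscale_apply)
  moreover have "?\<omega> \<in> cspace n"
    by (intro fs.subspace_diff[OF subspace_cspace] fs.subspace_scale[OF subspace_cspace] Suc(5) \<phi>k)
  ultimately have "?\<omega> \<in> fs.span (\<phi> ` {..<m})" using Suc(1)[of "Suc k"] Suc(2) by auto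
  moreover have "fscale (\<omega> (\<pi> k)) (\<phi> k) \<in> fs.span (\<phi> ` {..<m})"
    using k by (intro fs.span_scale fs.span_base) auto
  ultimately have "?\<omega> + fscale (\<omega> (\<pi> k)) (\<phi> k) \<in> fs.span (\<phi> ` {..<m})" by (rule fs.span_add)
  then show ?case by simp
qed

end

context flags
begin

text \<open>The arrow matrices specialise to those of \<open>x\<close> and the echelon bases to
  bases \<open>\<phi>\<close>, so the inclusions that the arrows satisfy on \<open>Z\<close> pass to
  \<open>x\<close>.\<close>

lemma flagged_closed:
  fixes Z :: "('a \<Rightarrow> 'k::alg_closed_field mat) set"
  assumes x: "x \<in> tuples d"
    and closure: "\<And>f. f \<in> polynomial_functions Q d \<Longrightarrow> f x \<noteq> 0 \<Longrightarrow> \<exists>z\<in>Z. f z \<noteq> 0"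
    and Z: "\<And>z. z \<in> Z \<Longrightarrow> \<exists>b c. presents z b c \<and> flagc c"
  shows "\<exists>W. flagged_by x W"
proof -
  let ?P = "polynomial_functions Q d :: (('a \<Rightarrow> 'k mat) \<Rightarrow> 'k) set"
  \<comment> \<open>Traces on \<open>Z\<close> of the basic open neighbourhoods of \<open>x\<close>.
    They generate a proper filter: products of polynomials give intersections, and by
    \<open>closure\<close> no trace is empty.\<close>
  define \<B> where "\<B> = (\<lambda>f. principal {z\<in>Z. f z \<noteq> 0}) ` {f\<in>?P. f x \<noteq> 0}"
  have "Inf \<B> \<noteq> bot"
  proof (rule Inf_filter_not_bot)
    fix X assume X: "X \<subseteq> \<B>" "finite X"
    obtain A where A: "A \<subseteq> {f\<in>?P. f x \<noteq> 0}" "finite A" "X = (\<lambda>f. principal {z\<in>Z. f z \<noteq> 0}) ` A"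
      using finite_subset_image[OF X(2) X(1)[unfolded \<B>_def]] by blast
    have "(\<lambda>z. \<Prod>f\<in>A. f z) \<in> ?P"
      using A(2,1) by (induction A rule: finite_induct) (auto intro: polynomial_functions.const polynomial_functions.mult)
    moreover have "(\<Prod>f\<in>A. f x) \<noteq> 0" using A by auto
    ultimately obtain z where z: "z \<in> Z" "(\<Prod>f\<in>A. f z) \<noteq> 0" using closure[of "\<lambda>z. \<Prod>f\<in>A. f z"] by blast
    have "principal {z} \<le> Inf X"
      using z A by (auto intro!: Inf_greatest simp: le_principal eventually_principal)
    then show "Inf X \<noteq> bot" using bot.extremum_uniqueI[of "principal {z}"] principal_eq_bot_iff[of "{z}"] by auto
  qed
  then obtain F where F: "F \<le> Inf \<B>" "ultrafilter F" using ultrafilter_exists by blast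
  have evF: "eventually (\<lambda>z. z \<in> Z \<and> f z \<noteq> 0) F" if "f \<in> ?P" "f x \<noteq> 0" for f
  proof -
    have "Inf \<B> \<le> principal {z\<in>Z. f z \<noteq> 0}" using that by (intro Inf_lower) (auto simp: \<B>_def)
    then have "F \<le> principal {z\<in>Z. f z \<noteq> 0}" using F(1) by (rule order_trans[rotated])
    then show ?thesis by (simp add: le_principal)
  qed
  have evZ: "eventually (\<lambda>z. z \<in> Z) F"
    using evF[of "\<lambda>_. 1"] polynomial_functions.const[of 1 Q d] by simp
  \<comment> \<open>Evaluation at \<open>x\<close>. A polynomial that vanishes modulo
    \<open>F\<close> vanishes at \<open>x\<close>, as otherwise its nonvanishing set would belong to
    the ultrafilter.\<close>
  have "pre_place F ((\<lambda>f. (f, f x)) ` ?P)"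
  proof (unfold_locales, goal_cases)
    case (1 c)
    show ?case using polynomial_functions.const[of c Q d] by (intro image_eqI[of _ _ "\<lambda>_. c"]) auto
  next
    case (2 f c g e)
    then show ?case by (auto intro!: image_eqI polynomial_functions.add)
  next
    case (3 f c g e)
    then show ?case by (auto intro!: image_eqI polynomial_functions.mult)
  next
    case (4 f c)
    then have f: "f \<in> ?P" "c = f x" by auto
    show ?case
    proof (rule ccontr)
      assume "c \<noteq> 0"
      then have "eventually (\<lambda>z. z \<in> Z \<and> f z \<noteq> 0) F" using evF f by blast
      with 4(2) have "eventually (\<lambda>z. False) F" by eventually_elim auto
      then show False using F(2) by (simp add: ultrafilter_def trivial_limit_def)
    qed
  qed
  then obtain G where G0: "(\<lambda>f. (f, f x)) ` ?P \<subseteq> G" and G: "place F G"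
    using place_exists[OF F(2)] by blast
  interpret G: place F G by (rule G)
  have poly: "(f, f x) \<in> G" if "f \<in> ?P" for f using G0 that by blast
  obtain b c where bc: "\<And>z. z \<in> Z \<Longrightarrow> presents z (b z) (c z) \<and> flagc (c z)" using Z by metis
  \<comment> \<open>Bundles the output of \<open>echelon_family\<close> at one vertex, so that one
    choice serves all vertices.\<close>
  define R where "R = (\<lambda>v (e, \<pi>, \<phi>).
    eventually (\<lambda>z. \<forall>k\<le>d v. fs.span ((\<lambda>j. e j z) ` {..<k}) = fs.span (b z v ` {..<k})) F \<and>
    eventually (\<lambda>z. (\<forall>j<d v. e j z (\<pi> j) = 1) \<and> (\<forall>j<d v. \<forall>k<j. e j z (\<pi> k) = 0)) F \<and>
    (\<forall>j<d v. \<pi> j < d v \<and> \<phi> j \<in> cspace (d v) \<and> (\<forall>i<d v. (\<lambda>z. e j z i, \<phi> j i) \<in> G)))"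
  have "\<exists>p. R v p" if "v \<in> verts Q" for v
  proof -
    have "eventually (\<lambda>z. frame (d v) (\<lambda>j. b z v j)) F"
      using evZ by eventually_elim (use bc that in \<open>auto simp: presents_def\<close>)
    from G.echelon_family[OF this, of "d v"] show ?thesis by (auto simp: R_def)
  qed
  then have "\<forall>v\<in>verts Q. \<exists>p. R v p" by blast
  then obtain p where p: "\<forall>v\<in>verts Q. R v (p v)" by (rule bchoice[THEN exE])
  define e \<pi> \<phi> where "e = (\<lambda>v. fst (p v))" and "\<pi> = (\<lambda>v. fst (snd (p v)))" and "\<phi> = (\<lambda>v. snd (snd (p v)))"
  have R: "R v (e v, \<pi> v, \<phi> v)" if "v \<in> verts Q" for v using p that by (simp add: e_def \<pi>_def \<phi>_def)
  have
    sp: "\<And>v. v \<in> verts Q \<Longrightarrow> eventually (\<lambda>z. \<forall>k\<le>d v. fs.span ((\<lambda>j. e v j z) ` {..<k}) = fs.span (b z v ` {..<k})) F" and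
    tri: "\<And>v. v \<in> verts Q \<Longrightarrow> eventually (\<lambda>z. (\<forall>j<d v. e v j z (\<pi> v j) = 1) \<and> (\<forall>j<d v. \<forall>k<j. e v j z (\<pi> v k) = 0)) F" and
    fin: "\<And>v j. v \<in> verts Q \<Longrightarrow> j < d v \<Longrightarrow> \<pi> v j < d v \<and> \<phi> v j \<in> cspace (d v) \<and> (\<forall>i<d v. (\<lambda>z. e v j z i, \<phi> v j i) \<in> G)"
    using R unfolding R_def prod.case by blast+
  have fr: "frame (d v) (\<phi> v)" if v: "v \<in> verts Q" for v
  proof -
    \<comment> \<open>The ones at the pivots and the prescribed zeros survive specialisation, so the
      limit family is still triangular and hence a basis.\<close>
    have "\<phi> v j (\<pi> v j) = 1" if j: "j < d v" for j
    proof (rule G.unique[OF _ G.const])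
      show "(\<lambda>z. e v j z (\<pi> v j), \<phi> v j (\<pi> v j)) \<in> G" using fin[OF v j] by simp
      show "eventually (\<lambda>z. e v j z (\<pi> v j) = 1) F" using tri[OF v] by eventually_elim (use j in simp)
    qed
    moreover have "\<phi> v j (\<pi> v k) = 0" if k: "k < j" and j: "j < d v" for j k
    proof (rule G.unique[OF _ G.const])
      have "\<pi> v k < d v" using fin[OF v, of k] k j by simp
      then show "(\<lambda>z. e v j z (\<pi> v k), \<phi> v j (\<pi> v k)) \<in> G" using fin[OF v j] by simp
      show "eventually (\<lambda>z. e v j z (\<pi> v k) = 0) F" using tri[OF v] by eventually_elim (use j k in simp)
    qed
    ultimately have "indep_fam (d v) (\<phi> v)" by (rule triangular_indep_fam)
    then show ?thesis using fin[OF v] by (simp add: frame_def)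
  qed
  have act: "act d x a (\<phi> (tail Q a) j) \<in> chain \<phi> (Suc l) (head Q a)"
    if a: "a \<in> arcs Q" and l: "l \<le> L" and j: "j < N l (tail Q a)" for a l j
  proof -
    have v: "tail Q a \<in> verts Q" "head Q a \<in> verts Q" using a by auto
    let ?m = "N (Suc l) (head Q a)"
    have m: "?m \<le> d (head Q a)" using N_le[OF v(2)] l by simp
    have jd: "N l (tail Q a) \<le> d (tail Q a)" using N_le[OF v(1)] l by simp
    show ?thesis
      unfolding chain_def
    proof (rule G.specialize_span[where w = "\<lambda>z. act d z a (e (tail Q a) j z)" and k = 0 and n = "d (head Q a)"])
      show "eventually (\<lambda>z. (\<forall>j<?m. e (head Q a) j z (\<pi> (head Q a) j) = 1) \<and>
          (\<forall>j<?m. \<forall>k<j. e (head Q a) j z (\<pi> (head Q a) k) = 0)) F"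
        using tri[OF v(2)] by eventually_elim (use m in auto)
      show "\<pi> (head Q a) j < d (head Q a) \<and> \<phi> (head Q a) j \<in> cspace (d (head Q a)) \<and>
          (\<forall>i<d (head Q a). (\<lambda>z. e (head Q a) j z i, \<phi> (head Q a) j i) \<in> G)" if "j < ?m" for j
        using fin[OF v(2)] that m by simp
      show "eventually (\<lambda>z. act d z a (e (tail Q a) j z) \<in> fs.span ((\<lambda>j. e (head Q a) j z) ` {0..<?m})) F"
        using sp[OF v(1)] sp[OF v(2)] evZ
      proof eventually_elim
        case (elim z)
        have "e (tail Q a) j z \<in> fs.span ((\<lambda>j. e (tail Q a) j z) ` {..<N l (tail Q a)})"
          using j by (intro fs.span_base) auto
        then have "e (tail Q a) j z \<in> chain (b z) l (tail Q a)"
          using elim(1) jd by (simp add: chain_def)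
        moreover have "flagged_by z (chain (b z))" using bc[OF elim(3)] presents_flagged by blast
        ultimately have "act d z a (e (tail Q a) j z) \<in> chain (b z) (Suc l) (head Q a)"
          using flagged_act l a by blast
        then show ?case using elim(2) m by (simp add: chain_def lessThan_atLeast0[symmetric])
      qed
      show "act d x a (\<phi> (tail Q a) j) \<in> cspace (d (head Q a))" by (rule act_in_cspace)
      fix i assume i: "i < d (head Q a)"
      have "(\<lambda>z. \<Sum>s<d (tail Q a). z a $$ (i, s) * e (tail Q a) j z s,
          \<Sum>s<d (tail Q a). x a $$ (i, s) * \<phi> (tail Q a) j s) \<in> G"
      proof (intro G.sum G.mult)
        fix s assume s: "s \<in> {..<d (tail Q a)}"
        show "(\<lambda>z. z a $$ (i, s), x a $$ (i, s)) \<in> G"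
          using s by (intro poly polynomial_functions.coordinate a i) simp
        show "(\<lambda>z. e (tail Q a) j z s, \<phi> (tail Q a) j s) \<in> G"
          using fin[OF v(1), of j] j jd s by simp
      qed
      then show "(\<lambda>z. act d z a (e (tail Q a) j z) i, act d x a (\<phi> (tail Q a) j) i) \<in> G"
        using i by (simp add: act_def)
    qed
  qed
  have "flagged_by x (chain \<phi>)"
    unfolding flagged_by_def
  proof (intro conjI ballI allI impI)
    fix v assume v: "v \<in> verts Q"
    show "chain \<phi> 0 v = cspace (d v)" using frame_span[OF fr[OF v]] N_0[OF v] by (simp add: chain_def)
    fix l
    show "fs.subspace (chain \<phi> l v)" by (simp add: chain_def)
    show "fs.dim (chain \<phi> l v) = N l v" if "l \<le> Suc L"
      using indep_fam_independent[OF indep_fam_mono[OF _ N_le[OF v that]]] fr[OF v]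
      unfolding frame_def chain_def by blast
    show "chain \<phi> (Suc l) v \<subseteq> chain \<phi> l v" if "l \<le> L"
      unfolding chain_def using N_Suc[OF v that] by (intro fs.span_mono image_mono) auto
  next
    fix l a assume l: "l \<le> L" and a: "a \<in> arcs Q"
    interpret A: Vector_Spaces.linear fscale fscale "act d x a" by (rule linear_act)
    have "act d x a ` (\<phi> (tail Q a) ` {..<N l (tail Q a)}) \<subseteq> chain \<phi> (Suc l) (head Q a)"
      using act[OF a l] by blast
    then have "fs.span (act d x a ` (\<phi> (tail Q a) ` {..<N l (tail Q a)})) \<subseteq> chain \<phi> (Suc l) (head Q a)"
      by (rule fs.span_minimal) (simp add: chain_def)
    then show "act d x a ` chain \<phi> l (tail Q a) \<subseteq> chain \<phi> (Suc l) (head Q a)"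
      unfolding chain_def A.span_image .
  qed
  then show ?thesis by blast
qed

end

section \<open>Components in the Zariski topology\<close>

lemma telescope_layers:
  fixes f S :: "nat \<Rightarrow> nat"
  assumes "\<And>l. l \<le> L \<Longrightarrow> f l = f (Suc l) + S l" "f (Suc L) = 0" "l \<le> Suc L"
  shows "f l = (\<Sum>k\<in>{l..L}. S k)"
  using assms(3)
proof (induction rule: inc_induct)
  case base
  then show ?case using assms(2) by simp
next
  case (step n)
  have "{n..L} = insert n {Suc n..L}" using step by auto
  then show ?case using step assms(1)[of n] by simp
qed

lemma dim_zero_subspace: "fs.dim {0 :: nat \<Rightarrow> 'k::field} = 0"
  using fs.dim_span_eq_card_independent[OF fs.independent_empty] by simp

lemma polyfun_polynomial_functions:
  assumes "f \<in> polynomial_functions Q d"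
    and "\<And>a i j. a \<in> arcs Q \<Longrightarrow> i < d (head Q a) \<Longrightarrow> j < d (tail Q a) \<Longrightarrow> polyfun (\<lambda>t. \<gamma> t a $$ (i, j))"
  shows "polyfun (\<lambda>t. f (\<gamma> t))"
  using assms(1)
proof induction
  case (const c)
  then show ?case by (rule polyfun_const)
next
  case (coordinate a i j)
  then show ?case by (rule assms(2))
next
  case (add f g)
  then show ?case by (intro polyfun_add)
next
  case (mult f g)
  then show ?case by (intro polyfun_mult)
qed

lemma openin_zariski: "openin (zariski Q L d) U \<longleftrightarrow> zariski_open Q L d U"
  unfolding zariski_def by (simp add: topology_inverse'[OF istopology_zariski_open])

lemma zariski_open_D:
  "f \<in> polynomial_functions Q d \<Longrightarrow> openin (zariski Q L d) {x \<in> rep_variety Q L d. f x \<noteq> 0}"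
  unfolding openin_zariski zariski_open_def by (intro exI[of _ "{f}"]) auto

lemma topspace_zariski: "topspace (zariski Q L d) = (rep_variety Q L d :: ('a \<Rightarrow> 'k::field mat) set)"
proof
  have "topspace (zariski Q L d :: ('a \<Rightarrow> 'k mat) topology) = \<Union>{U. zariski_open Q L d U}"
    unfolding topspace_def openin_zariski ..
  then show "topspace (zariski Q L d) \<subseteq> (rep_variety Q L d :: ('a \<Rightarrow> 'k mat) set)"
    by (auto simp: zariski_open_def)
  have "openin (zariski Q L d) {x \<in> rep_variety Q L d :: ('a \<Rightarrow> 'k mat) set. (\<lambda>_. 1 :: 'k) x \<noteq> 0}"
    by (rule zariski_open_D[OF polynomial_functions.const])
  then show "(rep_variety Q L d :: ('a \<Rightarrow> 'k mat) set) \<subseteq> topspace (zariski Q L d)"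
    by (auto dest: openin_subset)
qed

lemma openin_zariski_basis:
  assumes "openin (zariski Q L d) U" "x \<in> U"
  shows "\<exists>f\<in>polynomial_functions Q d. f x \<noteq> 0 \<and> (\<forall>y\<in>rep_variety Q L d. f y \<noteq> 0 \<longrightarrow> y \<in> U)"
  using assms unfolding openin_zariski zariski_open_def by auto

lemma in_zariski_closure:
  fixes Z :: "('a \<Rightarrow> 'k::field mat) set"
  assumes "Z \<subseteq> rep_variety Q L d"
  shows "x \<in> zariski Q L d closure_of Z \<longleftrightarrow>
    x \<in> rep_variety Q L d \<and> (\<forall>f\<in>polynomial_functions Q d. f x \<noteq> 0 \<longrightarrow> (\<exists>z\<in>Z. f z \<noteq> 0))"
proof
  assume x: "x \<in> zariski Q L d closure_of Z"
  then have xr: "x \<in> rep_variety Q L d" by (simp add: in_closure_of topspace_zariski)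
  moreover have "\<exists>z\<in>Z. f z \<noteq> 0" if "f \<in> polynomial_functions Q d" "f x \<noteq> 0" for f
  proof -
    have "\<forall>T. x \<in> T \<and> openin (zariski Q L d) T \<longrightarrow> (\<exists>y. y \<in> Z \<and> y \<in> T)"
      using x unfolding in_closure_of by (rule conjunct2)
    then have "x \<in> {x \<in> rep_variety Q L d. f x \<noteq> 0} \<and> openin (zariski Q L d) {x \<in> rep_variety Q L d. f x \<noteq> 0} \<longrightarrow>
        (\<exists>y. y \<in> Z \<and> y \<in> {x \<in> rep_variety Q L d. f x \<noteq> 0})" by (rule spec)
    then have "\<exists>y. y \<in> Z \<and> y \<in> {x \<in> rep_variety Q L d. f x \<noteq> 0}"
      using zariski_open_D[OF that(1), of L] xr that(2) by simp
    then show ?thesis by blast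
  qed
  ultimately show "x \<in> rep_variety Q L d \<and> (\<forall>f\<in>polynomial_functions Q d. f x \<noteq> 0 \<longrightarrow> (\<exists>z\<in>Z. f z \<noteq> 0))"
    by blast
next
  assume x: "x \<in> rep_variety Q L d \<and> (\<forall>f\<in>polynomial_functions Q d. f x \<noteq> 0 \<longrightarrow> (\<exists>z\<in>Z. f z \<noteq> 0))"
  show "x \<in> zariski Q L d closure_of Z"
    unfolding in_closure_of topspace_zariski
  proof (intro conjI allI impI)
    fix T assume "x \<in> T \<and> openin (zariski Q L d) T"
    then obtain f where f: "f \<in> polynomial_functions Q d" "f x \<noteq> 0" "\<forall>y\<in>rep_variety Q L d. f y \<noteq> 0 \<longrightarrow> y \<in> T"
      using openin_zariski_basis by blast
    then obtain z where "z \<in> Z" "f z \<noteq> 0" using x by blast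
    then show "\<exists>y. y \<in> Z \<and> y \<in> T" using f(3) assms by blast
  qed (use x in simp)
qed

text \<open>Irreducibility in the form that any two nonempty relatively open subsets meet, tested on
  basic open sets.\<close>

lemma irreducible_zariskiI:
  fixes Z :: "('a \<Rightarrow> 'k::field mat) set"
  assumes "Z \<noteq> {}" "Z \<subseteq> rep_variety Q L d"
    and common: "\<And>x y f g. x \<in> Z \<Longrightarrow> y \<in> Z \<Longrightarrow> f \<in> polynomial_functions Q d \<Longrightarrow> g \<in> polynomial_functions Q d \<Longrightarrow>
      f x \<noteq> 0 \<Longrightarrow> g y \<noteq> 0 \<Longrightarrow> \<exists>z\<in>Z. f z \<noteq> 0 \<and> g z \<noteq> 0"
  shows "irreducible_in (zariski Q L d) Z"
  unfolding irreducible_in_def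
proof (intro conjI allI impI)
  show "Z \<noteq> {}" "Z \<subseteq> topspace (zariski Q L d)" using assms by (simp_all add: topspace_zariski)
  fix A B assume AB: "closedin (zariski Q L d) A \<and> closedin (zariski Q L d) B \<and> Z \<subseteq> A \<union> B"
  show "Z \<subseteq> A \<or> Z \<subseteq> B"
  proof (rule ccontr)
    assume "\<not> (Z \<subseteq> A \<or> Z \<subseteq> B)"
    then obtain x y where xy: "x \<in> Z" "x \<notin> A" "y \<in> Z" "y \<notin> B" by blast
    have op: "openin (zariski Q L d) (rep_variety Q L d - A)" "openin (zariski Q L d) (rep_variety Q L d - B)"
      using AB unfolding closedin_def topspace_zariski by auto
    obtain f where f: "f \<in> polynomial_functions Q d" "f x \<noteq> 0"
        "\<forall>y\<in>rep_variety Q L d. f y \<noteq> 0 \<longrightarrow> y \<in> rep_variety Q L d - A"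
      using openin_zariski_basis[OF op(1), of x] xy assms(2) by blast
    obtain g where g: "g \<in> polynomial_functions Q d" "g y \<noteq> 0"
        "\<forall>y\<in>rep_variety Q L d. g y \<noteq> 0 \<longrightarrow> y \<in> rep_variety Q L d - B"
      using openin_zariski_basis[OF op(2), of y] xy assms(2) by blast
    obtain z where "z \<in> Z" "f z \<noteq> 0" "g z \<noteq> 0" using common[OF xy(1,3) f(1) g(1) f(2) g(2)] by blast
    then show False using AB f(3) g(3) assms(2) by blast
  qed
qed

lemma irreducible_closure:
  assumes "irreducible_in X S"
  shows "irreducible_in X (X closure_of S)"
  using assms closure_of_subset[of S X] closure_of_minimal[of S _ X] closure_of_subset_topspace[of X S]
  unfolding irreducible_in_def by (metis subset_empty order_trans)

lemma irreducible_finite_union: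
  assumes "irreducible_in X D" "finite I" "D \<subseteq> (\<Union>i\<in>I. C i)" "\<And>i. i \<in> I \<Longrightarrow> closedin X (C i)"
  shows "\<exists>i\<in>I. D \<subseteq> C i"
  using assms(2,3,4)
proof (induction I rule: finite_induct)
  case empty
  then show ?case using assms(1) by (auto simp: irreducible_in_def)
next
  case (insert i I)
  have "closedin X (\<Union>i\<in>I. C i)" using insert by (intro closedin_Union) auto
  moreover have "closedin X (C i)" "D \<subseteq> C i \<union> (\<Union>i\<in>I. C i)" using insert.prems by auto
  ultimately have "D \<subseteq> C i \<or> D \<subseteq> (\<Union>i\<in>I. C i)" using assms(1) unfolding irreducible_in_def by blast
  then show ?case using insert by blast
qed

context quiver
begin

text \<open>\<open>realizable\<close> quantifies over its own dimension vector, which may differ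
  from \<open>d\<close> away from the vertices; the congruences from here on bridge the two.\<close>

lemma act_cong:
  assumes "\<And>v. v \<in> verts Q \<Longrightarrow> d v = d' v" "a \<in> arcs Q"
  shows "act d x a = act d' x a"
proof -
  have "d (head Q a) = d' (head Q a)" "d (tail Q a) = d' (tail Q a)" using assms by auto
  then show ?thesis by (simp add: act_def fun_eq_iff)
qed

lemma pact_cong:
  assumes "\<And>v. v \<in> verts Q \<Longrightarrow> d v = d' v" "set p \<subseteq> arcs Q"
  shows "pact d x p f = pact d' x p f"
  using assms(2)
proof (induction p arbitrary: f)
  case (Cons a p)
  then show ?case using act_cong[of d d' a x, OF assms(1)] by (simp add: pact_Cons)
qed simp

lemma tuples_cong:
  assumes "\<And>v. v \<in> verts Q \<Longrightarrow> d v = d' v"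
  shows "tuples d = tuples d'"
  unfolding tuples_def by (intro PiE_cong) (auto simp: assms)

lemma rep_variety_cong:
  fixes x :: "'a \<Rightarrow> 'k::field mat"
  assumes "\<And>v. v \<in> verts Q \<Longrightarrow> d v = d' v"
  shows "x \<in> rep_variety Q L d \<longleftrightarrow> x \<in> rep_variety Q L d'"
proof -
  have "d u = d' u \<and> pact d x p f = pact d' x p f" if "awalk u p v" for u p v and f :: "nat \<Rightarrow> 'k"
    using that awalk_hd_in_verts[OF that] assms pact_cong[of d d' p x f] by (auto simp: awalk_def)
  then have "(\<forall>u p v f. awalk u p v \<and> length p = Suc L \<and> f \<in> cspace (d u) \<longrightarrow> pact d x p f = 0) \<longleftrightarrow>
      (\<forall>u p v f. awalk u p v \<and> length p = Suc L \<and> f \<in> cspace (d' u) \<longrightarrow> pact d' x p f = 0)"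
    by (intro all_cong1 imp_cong) auto
  moreover have "tuples d = (tuples d' :: ('a \<Rightarrow> 'k mat) set)" by (rule tuples_cong) (rule assms)
  ultimately show ?thesis unfolding rep_variety_iff by simp
qed

lemma rad_cong:
  assumes "\<And>v. v \<in> verts Q \<Longrightarrow> d v = d' v" "v \<in> verts Q"
  shows "rad d x l v = rad d' x l v"
  using assms(2)
proof (induction l arbitrary: v)
  case (Suc l)
  then have "(\<Union>a\<in>{a\<in>arcs Q. head Q a = v}. act d x a ` rad d x l (tail Q a)) =
      (\<Union>a\<in>{a\<in>arcs Q. head Q a = v}. act d' x a ` rad d' x l (tail Q a))"
    using act_cong[of d d' _ x, OF assms(1)] by (intro SUP_cong) auto
  then show ?case by simp
qed (use assms(1) in simp)

end

section \<open>Strata, governed filtrations and closures\<close>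

context trunc
begin

text \<open>The dimension at \<open>v\<close> of the \<open>l\<close>-th member of any filtration
  governed by \<open>S\<close>.\<close>

definition seq_dim :: "(nat \<Rightarrow> 'v \<Rightarrow> nat) \<Rightarrow> nat \<Rightarrow> 'v \<Rightarrow> nat" where
  "seq_dim S l v = (\<Sum>k\<in>{l..L}. S k v)"

lemma seq_dim_step: "l \<le> L \<Longrightarrow> seq_dim S l v = seq_dim S (Suc l) v + S l v"
proof -
  assume "l \<le> L"
  then have "{l..L} = insert l {Suc l..L}" by auto
  then show ?thesis by (simp add: seq_dim_def)
qed

lemma seq_dim_end: "seq_dim S (Suc L) v = 0"
  by (simp add: seq_dim_def)

lemma seq_dim_0: "seq_dim S 0 v = (\<Sum>l\<le>L. S l v)"
  by (simp add: seq_dim_def atMost_atLeast0)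

lemma flags_seq_dim:
  assumes "S \<in> semisimple_sequences Q L d"
  shows "flags Q L d (seq_dim S)"
proof unfold_locales
  fix v assume "v \<in> verts Q"
  then show "seq_dim S 0 v = d v" using assms by (simp add: seq_dim_0 semisimple_sequences_def)
qed (auto simp: seq_dim_step seq_dim_end)

lemma seq_eqI:
  assumes S: "S \<in> semisimple_sequences Q L d" "S' \<in> semisimple_sequences Q L d'"
    and eq: "\<And>l v. l \<le> Suc L \<Longrightarrow> v \<in> verts Q \<Longrightarrow> seq_dim S l v = seq_dim S' l v"
  shows "S = S'"
proof (rule PiE_ext)
  show SP: "S \<in> {..L} \<rightarrow>\<^sub>E (verts Q \<rightarrow>\<^sub>E UNIV)" "S' \<in> {..L} \<rightarrow>\<^sub>E (verts Q \<rightarrow>\<^sub>E UNIV)"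
    using S by (auto simp: semisimple_sequences_def)
  fix l assume l: "l \<in> {..L}"
  show "S l = S' l"
  proof (rule PiE_ext)
    show "S l \<in> verts Q \<rightarrow>\<^sub>E UNIV" "S' l \<in> verts Q \<rightarrow>\<^sub>E UNIV" using SP l by (auto dest: PiE_mem)
    fix v assume v: "v \<in> verts Q"
    show "S l v = S' l v" using eq[OF _ v, of l] eq[OF _ v, of "Suc l"] l seq_dim_step[of l S v] seq_dim_step[of l S' v] by simp
  qed
qed

lemma finite_semisimple_sequences: "finite (semisimple_sequences Q L d)"
proof -
  let ?B = "Max (d ` verts Q)"
  have "semisimple_sequences Q L d \<subseteq> {..L} \<rightarrow>\<^sub>E (verts Q \<rightarrow>\<^sub>E {..?B})"
  proof
    fix S assume S: "S \<in> semisimple_sequences Q L d"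
    have "S l v \<le> ?B" if "l \<le> L" "v \<in> verts Q" for l v
    proof -
      have "S l v \<le> (\<Sum>l\<le>L. S l v)" using that by (intro member_le_sum) auto
      also have "\<dots> = d v" using S that by (simp add: semisimple_sequences_def)
      also have "\<dots> \<le> ?B" using that by (intro Max_ge finite_imageI finite_verts) auto
      finally show ?thesis .
    qed
    then show "S \<in> {..L} \<rightarrow>\<^sub>E (verts Q \<rightarrow>\<^sub>E {..?B})"
      using S unfolding semisimple_sequences_def PiE_iff by (auto simp: PiE_iff)
  qed
  then show ?thesis by (rule finite_subset) (intro finite_PiE finite_verts finite_atMost)
qed

abbreviation layer :: "('v \<Rightarrow> nat) \<Rightarrow> (nat \<Rightarrow> 'v \<Rightarrow> nat) \<Rightarrow> ('a \<Rightarrow> 'k::alg_closed_field mat) set" where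
  "layer d S \<equiv> rep_layer Q L d S"

lemma rep_layer_iff:
  fixes x :: "'a \<Rightarrow> 'k::field mat"
  shows "x \<in> rep_layer Q L d S \<longleftrightarrow> x \<in> rep_variety Q L d \<and>
    (\<forall>l\<le>Suc L. \<forall>v\<in>verts Q. fs.dim (rad d x l v) = seq_dim S l v)"
proof (cases "x \<in> rep_variety Q L d")
  case True
  interpret rep Q L d x using True by unfold_locales
  have z: "fs.dim (rad d x (Suc L) v) = 0" if "v \<in> verts Q" for v
    using rad_Suc_L[OF that] by (simp add: dim_zero_subspace del: rad.simps)
  have "(\<forall>l\<le>L. \<forall>v\<in>verts Q. fs.dim (rad d x l v) = fs.dim (rad d x (Suc l) v) + S l v) \<longleftrightarrow>
    (\<forall>l\<le>Suc L. \<forall>v\<in>verts Q. fs.dim (rad d x l v) = seq_dim S l v)"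
  proof (intro iffI allI impI ballI)
    fix l v assume *: "\<forall>l\<le>L. \<forall>v\<in>verts Q. fs.dim (rad d x l v) = fs.dim (rad d x (Suc l) v) + S l v"
      "l \<le> Suc L" "v \<in> verts Q"
    show "fs.dim (rad d x l v) = seq_dim S l v"
      unfolding seq_dim_def
      by (rule telescope_layers[where f = "\<lambda>l. fs.dim (rad d x l v)" and S = "\<lambda>l. S l v"])
        (use * z in \<open>auto simp del: rad.simps\<close>)
  next
    fix l v assume *: "\<forall>l\<le>Suc L. \<forall>v\<in>verts Q. fs.dim (rad d x l v) = seq_dim S l v" "l \<le> L" "v \<in> verts Q"
    then show "fs.dim (rad d x l v) = fs.dim (rad d x (Suc l) v) + S l v"
      using seq_dim_step[of l S v] by (simp del: rad.simps)
  qed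
  then show ?thesis using True has_radical_layering_iff[of S] by (simp add: rep_layer_def del: rad.simps)
qed (simp add: rep_layer_def)

lemma rep_layer_subset: "rep_layer Q L d S \<subseteq> rep_variety Q L d"
  by (auto simp: rep_layer_def)

text \<open>The stratum in parameters: linear conditions on structure constants together with
  nonvanishing minors. The curves through the stratum are built on this description.\<close>

lemma rep_layer_presents:
  fixes x :: "'a \<Rightarrow> 'k::field mat"
  assumes S: "S \<in> semisimple_sequences Q L d"
  shows "x \<in> rep_layer Q L d S \<longleftrightarrow>
    (\<exists>b c. flags.presents Q d x b c \<and> flags.flagc Q L d (seq_dim S) c \<and> flags.genc Q L (seq_dim S) c)"
proof -
  interpret flags Q L d "seq_dim S" by (rule flags_seq_dim[OF S])
  show ?thesis
  proof
    assume "x \<in> rep_layer Q L d S"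
    then show "\<exists>b c. presents x b c \<and> flagc c \<and> genc c"
      unfolding rep_layer_iff by (intro rad_presents) auto
  next
    assume "\<exists>b c. presents x b c \<and> flagc c \<and> genc c"
    then obtain b c where P: "presents x b c" "flagc c" "genc c" by blast
    have fl: "flagged_by x (chain b)" by (rule presents_flagged[OF P(1,2)])
    have "x \<in> tuples d" using P by (simp add: presents_def)
    then have "x \<in> rep_variety Q L d" using fl by (rule flagged_rep_variety)
    moreover have "fs.dim (rad d x l v) = seq_dim S l v" if "l \<le> Suc L" "v \<in> verts Q" for l v
      using presents_rad[OF P that] fl that by (simp add: flagged_by_def del: rad.simps)
    ultimately show "x \<in> rep_layer Q L d S" unfolding rep_layer_iff by blast
  qed
qed

definition governs :: "('v \<Rightarrow> nat) \<Rightarrow> (nat \<Rightarrow> 'v \<Rightarrow> nat) \<Rightarrow> ('a \<Rightarrow> 'k::field mat) \<Rightarrow> bool" where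
  "governs d S x \<longleftrightarrow> (\<exists>U. governed_filtration Q L (rep_module Q d x) S U)"

lemma layered_dim:
  fixes x :: "'a \<Rightarrow> 'k::field mat"
  assumes "rep Q L d x" "rep.layered Q L d x S W" "l \<le> Suc L" "v \<in> verts Q"
  shows "fs.dim (W l v) = seq_dim S l v"
proof -
  interpret rep Q L d x by (rule assms(1))
  show ?thesis
    unfolding seq_dim_def
    by (rule telescope_layers[where f = "\<lambda>l. fs.dim (W l v)" and S = "\<lambda>l. S l v"])
      (use assms(2-) in \<open>auto simp: layered_def dim_zero_subspace\<close>)
qed

text \<open>The layers add up to the dimension of the module, so at the vertices the dimension
  vector of a governing sequence is forced, whichever vector witnessed its realizability.\<close>

lemma governs_sequence:
  fixes x :: "'a \<Rightarrow> 'k::field mat"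
  assumes x: "x \<in> rep_variety Q L d" and S: "S \<in> semisimple_sequences Q L d'" and g: "governs d S x"
  shows "S \<in> semisimple_sequences Q L d" "\<And>v. v \<in> verts Q \<Longrightarrow> d' v = d v"
proof -
  interpret rep Q L d x using x by unfold_locales
  obtain W where W: "layered S W" using g governed_filtration_iff unfolding governs_def by blast
  have eq: "(\<Sum>l\<le>L. S l v) = d v" if "v \<in> verts Q" for v
  proof -
    have "fs.dim (W 0 v) = seq_dim S 0 v" by (rule layered_dim[OF rep_axioms W _ that]) simp
    moreover have "W 0 v = cspace (d v)" using W that by (simp add: layered_def)
    ultimately show ?thesis by (simp add: dim_cspace seq_dim_0)
  qed
  then show "S \<in> semisimple_sequences Q L d" using S by (simp add: semisimple_sequences_def)
  show "d' v = d v" if "v \<in> verts Q" for v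
    using eq[OF that] S that by (simp add: semisimple_sequences_def)
qed

lemma layered_iff_flagged:
  fixes x :: "'a \<Rightarrow> 'k::field mat"
  assumes x: "x \<in> rep_variety Q L d" and S: "S \<in> semisimple_sequences Q L d"
  shows "rep.layered Q L d x S W \<longleftrightarrow> flags.flagged_by Q L d (seq_dim S) x W"
proof -
  interpret rep Q L d x using x by unfold_locales
  interpret flags Q L d "seq_dim S" by (rule flags_seq_dim[OF S])
  show ?thesis
  proof
    assume W: "layered S W"
    then show "flagged_by x W"
      using layered_dim[OF rep_axioms W] unfolding flagged_by_def layered_def graded_def by auto
  next
    assume W: "flagged_by x W"
    have sub: "W l v \<subseteq> cspace (d v)" if "l \<le> Suc L" "v \<in> verts Q" for l v
      using that(1)
    proof (induction l)
      case 0
      then show ?case using W that(2) by (simp add: flagged_by_def)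
    next
      case (Suc l)
      then have "W (Suc l) v \<subseteq> W l v" using W that(2) by (simp add: flagged_by_def)
      then show ?case using Suc by auto
    qed
    have "W (Suc L) v = {0}" if v: "v \<in> verts Q" for v
    proof -
      have W': "fs.subspace (W (Suc L) v)" "fs.dim (W (Suc L) v) = 0"
        using W v by (auto simp: flagged_by_def seq_dim_end)
      have "{0} \<subseteq> W (Suc L) v" using fs.subspace_0[OF W'(1)] by simp
      then have "{0} = W (Suc L) v"
        by (intro dim_cspace_le(2)[OF _ _ W'(1) sub[OF _ v]]) (simp_all add: W' dim_zero_subspace)
      then show ?thesis by simp
    qed
    moreover have "fs.dim (W l v) = fs.dim (W (Suc l) v) + S l v" if "l \<le> L" "v \<in> verts Q" for l v
      using W that seq_dim_step[of l S v] by (simp add: flagged_by_def)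
    ultimately show "layered S W"
      using W sub unfolding flagged_by_def layered_def graded_def by auto
  qed
qed

lemma governs_iff_flagged:
  fixes x :: "'a \<Rightarrow> 'k::field mat"
  assumes x: "x \<in> rep_variety Q L d" and S: "S \<in> semisimple_sequences Q L d"
  shows "governs d S x \<longleftrightarrow> (\<exists>W. flags.flagged_by Q L d (seq_dim S) x W)"
proof -
  interpret rep Q L d x using x by unfold_locales
  show ?thesis
    unfolding governs_def governed_filtration_iff layered_iff_flagged[OF x S]
  proof
    assume "\<exists>W. flags.flagged_by Q L d (seq_dim S) x W"
    then obtain W where "flags.flagged_by Q L d (seq_dim S) x W" by blast
    then show "\<exists>U W. flags.flagged_by Q L d (seq_dim S) x W \<and> (\<forall>l\<le>Suc L. U l = sub (W l))"
      by (intro exI[of _ "\<lambda>l. sub (W l)"] exI[of _ W]) simp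
  qed blast
qed

lemma governs_self:
  assumes S: "S \<in> semisimple_sequences Q L d" and x: "x \<in> rep_layer Q L d S"
  shows "governs d S x"
proof -
  interpret flags Q L d "seq_dim S" by (rule flags_seq_dim[OF S])
  have xr: "x \<in> rep_variety Q L d" using x rep_layer_subset by blast
  have "flagged_by x (rad d x)"
    by (rule rad_flagged[OF xr]) (use x in \<open>simp add: rep_layer_iff\<close>)
  then show ?thesis unfolding governs_iff_flagged[OF xr S] by blast
qed

text \<open>The radical filtration descends fastest: each member of a layered filtration must
  contain the arrow images of the previous one, and the radical is spanned by such images.\<close>

lemma rad_subset_layered:
  assumes "rep Q L d x" "rep.layered Q L d x S W" "l \<le> Suc L" "v \<in> verts Q"
  shows "rad d x l v \<subseteq> W l v"
proof -
  interpret rep Q L d x by (rule assms(1))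
  show ?thesis
    using assms(3,4)
  proof (induction l arbitrary: v)
    case 0
    then show ?case using assms(2) by (simp add: layered_def)
  next
    case (Suc l)
    then have l: "l \<le> L" by simp
    have "act d x a ` rad d x l (tail Q a) \<subseteq> W (Suc l) v" if a: "a \<in> arcs Q" "head Q a = v" for a
    proof -
      have "act d x a ` rad d x l (tail Q a) \<subseteq> act d x a ` W l (tail Q a)"
        using Suc.IH[of "tail Q a"] l a by (intro image_mono) auto
      also have "\<dots> \<subseteq> W (Suc l) (head Q a)" using assms(2) l a(1) unfolding layered_def by blast
      finally show ?thesis using a by simp
    qed
    moreover have "fs.subspace (W (Suc l) v)"
      using assms(2) Suc.prems by (auto simp: layered_def graded_def)
    ultimately show ?case unfolding rad.simps by (intro fs.span_minimal) auto
  qed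
qed

text \<open>Orders the strata by dimensions of radical powers; applied in both directions it
  separates their closures in \<open>layer_unique\<close>.\<close>

lemma governs_seq_dim_le:
  assumes xS: "x \<in> rep_layer Q L d S" and g: "governs d S' x" and l: "l \<le> Suc L" "v \<in> verts Q"
  shows "seq_dim S l v \<le> seq_dim S' l v"
proof -
  have xr: "x \<in> rep_variety Q L d" using xS rep_layer_subset by blast
  interpret rep Q L d x using xr by unfold_locales
  obtain W where W: "layered S' W" using g governed_filtration_iff unfolding governs_def by blast
  have gr: "fs.subspace (W l v)" "W l v \<subseteq> cspace (d v)" using W l by (auto simp: layered_def graded_def)
  have "fs.dim (rad d x l v) \<le> fs.dim (W l v)"
    by (rule dim_cspace_le(1)[OF rad_subspace rad_subset_layered[OF rep_axioms W l] gr])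
  moreover have "fs.dim (rad d x l v) = seq_dim S l v" using xS l unfolding rep_layer_iff by blast
  ultimately show ?thesis using layered_dim[OF rep_axioms W l] by simp
qed

lemma rep_layer_cover:
  fixes x :: "'a \<Rightarrow> 'k::field mat"
  assumes x: "x \<in> rep_variety Q L d"
  shows "\<exists>S\<in>semisimple_sequences Q L d. x \<in> rep_layer Q L d S"
proof -
  interpret rep Q L d x using x by unfold_locales
  \<comment> \<open>Subtraction of natural numbers is exact here, because the radical powers
    decrease.\<close>
  define S where "S = (\<lambda>l\<in>{..L}. \<lambda>v\<in>verts Q. fs.dim (rad d x l v) - fs.dim (rad d x (Suc l) v))"
  have step: "fs.dim (rad d x l v) = fs.dim (rad d x (Suc l) v) + S l v" if "l \<le> L" "v \<in> verts Q" for l v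
    using dim_cspace_le(1)[OF rad_subspace rad_Suc_subset rad_subspace, of d x l v "d v"] rad_antimono[of 0 l d x v] that
    by (simp add: S_def del: rad.simps(2))
  have "fs.dim (rad d x (Suc L) v) = 0" if "v \<in> verts Q" for v
    using rad_Suc_L[OF that] by (simp add: dim_zero_subspace del: rad.simps)
  then have dims: "fs.dim (rad d x l v) = seq_dim S l v" if "l \<le> Suc L" "v \<in> verts Q" for l v
    unfolding seq_dim_def using that step
    by (intro telescope_layers[where f = "\<lambda>l. fs.dim (rad d x l v)" and S = "\<lambda>l. S l v"]) (auto simp del: rad.simps)
  have "(\<Sum>l\<le>L. S l v) = d v" if "v \<in> verts Q" for v
    using dims[of 0 v] that by (simp add: seq_dim_0 dim_cspace)
  then have "S \<in> semisimple_sequences Q L d" by (auto simp: semisimple_sequences_def S_def)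
  moreover have "x \<in> rep_layer Q L d S" unfolding rep_layer_iff using x dims by blast
  ultimately show ?thesis by blast
qed

lemma realizable_governs_iff:
  fixes x :: "'a \<Rightarrow> 'k::alg_closed_field mat"
  assumes x: "x \<in> rep_variety Q L d"
  shows "realizable TYPE('k) Q L S \<and> governs d S x \<longleftrightarrow>
    S \<in> semisimple_sequences Q L d \<and> layer d S \<noteq> ({} :: ('a \<Rightarrow> 'k mat) set) \<and> governs d S x"
proof
  assume *: "realizable TYPE('k) Q L S \<and> governs d S x"
  then obtain d' where d': "S \<in> semisimple_sequences Q L d'" "(rep_layer Q L d' S :: ('a \<Rightarrow> 'k mat) set) \<noteq> {}"
    by (auto simp: realizable_def)
  have S: "S \<in> semisimple_sequences Q L d" and eq: "\<And>v. v \<in> verts Q \<Longrightarrow> d' v = d v"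
    using governs_sequence[OF x d'(1)] * by blast+
  obtain y :: "'a \<Rightarrow> 'k mat" where y: "y \<in> rep_layer Q L d' S" using d'(2) by blast
  then have "y \<in> rep_layer Q L d S"
    unfolding rep_layer_iff using rep_variety_cong[of d' d y, OF eq] rad_cong[of d' d _ y, OF eq] by auto
  then show "S \<in> semisimple_sequences Q L d \<and> layer d S \<noteq> ({} :: ('a \<Rightarrow> 'k mat) set) \<and> governs d S x"
    using S * by blast
qed (auto simp: realizable_def)

lemma closure_layer_governs:
  fixes x :: "'a \<Rightarrow> 'k::alg_closed_field mat"
  assumes S: "S \<in> semisimple_sequences Q L d" and x: "x \<in> zariski Q L d closure_of layer d S"
  shows "governs d S x"
proof -
  interpret flags Q L d "seq_dim S" by (rule flags_seq_dim[OF S])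
  have xr: "x \<in> rep_variety Q L d" and cl: "\<And>f. f \<in> polynomial_functions Q d \<Longrightarrow> f x \<noteq> 0 \<Longrightarrow> \<exists>z\<in>layer d S. f z \<noteq> 0"
    using x unfolding in_zariski_closure[OF rep_layer_subset] by blast+
  have xt: "x \<in> tuples d" using xr rep_variety_iff by blast
  have "\<exists>W. flagged_by x W"
    by (rule flagged_closed[OF xt cl]) (use rep_layer_presents[OF S] in blast)+
  then show ?thesis unfolding governs_iff_flagged[OF xr S] .
qed

text \<open>\<open>x\<close> may be any point governed by \<open>S\<close>, inside the stratum or
  not. The same curve therefore serves density and irreducibility.\<close>

lemma layer_curve:
  fixes x y :: "'a \<Rightarrow> 'k::alg_closed_field mat"
  assumes S: "S \<in> semisimple_sequences Q L d" and x: "x \<in> rep_variety Q L d" "governs d S x" and y: "y \<in> layer d S"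
  shows "\<exists>\<gamma>. (\<forall>f\<in>polynomial_functions Q d. polyfun (\<lambda>t. f (\<gamma> t))) \<and> \<gamma> 0 = x \<and> \<gamma> 1 = y \<and>
    eventually (\<lambda>t. \<gamma> t \<in> layer d S) cofinite"
proof -
  interpret flags Q L d "seq_dim S" by (rule flags_seq_dim[OF S])
  have xt: "x \<in> tuples d" using x rep_variety_iff by blast
  obtain W where W: "flagged_by x W" using x(2) governs_iff_flagged[OF x(1) S] by blast
  obtain b c where bc: "presents x b c" "flagc c" using flagged_presents[OF xt W] by blast
  obtain b' c' where bc': "presents y b' c'" "flagc c'" "genc c'"
    using y rep_layer_presents[OF S] by blast
  obtain \<gamma> where \<gamma>: "\<forall>a i j. a \<in> arcs Q \<longrightarrow> i < d (head Q a) \<longrightarrow> j < d (tail Q a) \<longrightarrow> polyfun (\<lambda>t. \<gamma> t a $$ (i, j))"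
    "\<gamma> 0 = x" "\<gamma> 1 = y" "eventually (\<lambda>t. \<exists>B C. presents (\<gamma> t) B C \<and> flagc C \<and> genc C) cofinite"
    using polynomial_curve[OF bc bc'] by blast
  have "eventually (\<lambda>t. \<gamma> t \<in> layer d S) cofinite"
    unfolding rep_layer_presents[OF S] by (rule \<gamma>(4))
  moreover have "\<forall>f\<in>polynomial_functions Q d. polyfun (\<lambda>t. f (\<gamma> t))"
    using polyfun_polynomial_functions \<gamma>(1) by blast
  ultimately show ?thesis using \<gamma>(2,3) by blast
qed

lemma governs_closure_layer:
  fixes x :: "'a \<Rightarrow> 'k::alg_closed_field mat"
  assumes S: "S \<in> semisimple_sequences Q L d" and ne: "layer d S \<noteq> ({} :: ('a \<Rightarrow> 'k mat) set)"
    and x: "x \<in> rep_variety Q L d" "governs d S x"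
  shows "x \<in> zariski Q L d closure_of layer d S"
  unfolding in_zariski_closure[OF rep_layer_subset]
proof (intro conjI ballI impI x(1))
  fix f :: "('a \<Rightarrow> 'k mat) \<Rightarrow> 'k" assume f: "f \<in> polynomial_functions Q d" "f x \<noteq> 0"
  obtain y :: "'a \<Rightarrow> 'k mat" where y: "y \<in> layer d S" using ne by blast
  obtain \<gamma> where \<gamma>: "\<forall>f\<in>polynomial_functions Q d. polyfun (\<lambda>t. f (\<gamma> t))" "\<gamma> 0 = x"
    "eventually (\<lambda>t. \<gamma> t \<in> layer d S) cofinite"
    using layer_curve[OF S x y] by blast
  have "eventually (\<lambda>t. f (\<gamma> t) \<noteq> 0) cofinite"
    by (rule polyfun_cofinite[of _ 0]) (use \<gamma> f in auto)
  with \<gamma>(3) have "eventually (\<lambda>t. \<gamma> t \<in> layer d S \<and> f (\<gamma> t) \<noteq> 0) cofinite" by eventually_elim simp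
  then show "\<exists>z\<in>layer d S. f z \<noteq> 0"
    using eventually_happens'[OF cofinite_neq_bot] by blast
qed

lemma irreducible_layer:
  assumes S: "S \<in> semisimple_sequences Q L d" and ne: "layer d S \<noteq> ({} :: ('a \<Rightarrow> 'k::alg_closed_field mat) set)"
  shows "irreducible_in (zariski Q L d) (layer d S :: ('a \<Rightarrow> 'k mat) set)"
proof (rule irreducible_zariskiI[OF ne rep_layer_subset])
  fix x y :: "'a \<Rightarrow> 'k mat" and f g
  assume xy: "x \<in> layer d S" "y \<in> layer d S" and fg: "f \<in> polynomial_functions Q d" "g \<in> polynomial_functions Q d"
    "f x \<noteq> 0" "g y \<noteq> 0"
  have x: "x \<in> rep_variety Q L d" "governs d S x" using xy rep_layer_subset governs_self[OF S] by blast+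
  obtain \<gamma> where \<gamma>: "\<forall>f\<in>polynomial_functions Q d. polyfun (\<lambda>t. f (\<gamma> t))" "\<gamma> 0 = x" "\<gamma> 1 = y"
    "eventually (\<lambda>t. \<gamma> t \<in> layer d S) cofinite"
    using layer_curve[OF S x xy(2)] by blast
  have "eventually (\<lambda>t. f (\<gamma> t) \<noteq> 0) cofinite"
    by (rule polyfun_cofinite[of _ 0]) (use \<gamma> fg in auto)
  moreover have "eventually (\<lambda>t. g (\<gamma> t) \<noteq> 0) cofinite"
    by (rule polyfun_cofinite[of _ 1]) (use \<gamma> fg in auto)
  ultimately have "eventually (\<lambda>t. \<gamma> t \<in> layer d S \<and> f (\<gamma> t) \<noteq> 0 \<and> g (\<gamma> t) \<noteq> 0) cofinite"
    using \<gamma>(4) by eventually_elim simp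
  then show "\<exists>z\<in>layer d S. f z \<noteq> 0 \<and> g z \<noteq> 0"
    using eventually_happens'[OF cofinite_neq_bot] by blast
qed

section \<open>Irreducible components and the counting of governing sequences\<close>

definition governing :: "('v \<Rightarrow> nat) \<Rightarrow> ('a \<Rightarrow> 'k::alg_closed_field mat) \<Rightarrow> (nat \<Rightarrow> 'v \<Rightarrow> nat) set" where
  "governing d x = {S. realizable TYPE('k) Q L S \<and> governs d S x}"

lemma Gamma_eq: "Gamma Q L (rep_module Q d x) = card (governing d x)"
  by (simp add: Gamma_def governing_def governs_def)

lemma governing_iff:
  fixes x :: "'a \<Rightarrow> 'k::alg_closed_field mat"
  assumes x: "x \<in> rep_variety Q L d"
  shows "S \<in> governing d x \<longleftrightarrow> S \<in> semisimple_sequences Q L d \<and> x \<in> zariski Q L d closure_of layer d S"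
proof
  assume "S \<in> governing d x"
  then show "S \<in> semisimple_sequences Q L d \<and> x \<in> zariski Q L d closure_of layer d S"
    using realizable_governs_iff[OF x] governs_closure_layer[OF _ _ x] unfolding governing_def by blast
next
  assume *: "S \<in> semisimple_sequences Q L d \<and> x \<in> zariski Q L d closure_of layer d S"
  have "layer d S \<noteq> ({} :: ('a \<Rightarrow> 'k mat) set)"
  proof
    assume "layer d S = ({} :: ('a \<Rightarrow> 'k mat) set)"
    then have "zariski Q L d closure_of (layer d S :: ('a \<Rightarrow> 'k mat) set) = {}" by simp
    then show False using * by blast
  qed
  then show "S \<in> governing d x"
    using * closure_layer_governs realizable_governs_iff[OF x] unfolding governing_def by blast
qed

lemma layer_in_closure: "x \<in> layer d S \<Longrightarrow> x \<in> zariski Q L d closure_of layer d S"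
  unfolding in_zariski_closure[OF rep_layer_subset] using rep_layer_subset by blast

lemma layer_unique:
  fixes x :: "'a \<Rightarrow> 'k::alg_closed_field mat"
  assumes S: "S \<in> semisimple_sequences Q L d" "S' \<in> semisimple_sequences Q L d"
    and eq: "zariski Q L d closure_of layer d S = zariski Q L d closure_of (layer d S' :: ('a \<Rightarrow> 'k mat) set)"
    and ne: "layer d S \<noteq> ({} :: ('a \<Rightarrow> 'k mat) set)" "layer d S' \<noteq> ({} :: ('a \<Rightarrow> 'k mat) set)"
  shows "S = S'"
proof (rule seq_eqI[OF S])
  fix l v assume l: "l \<le> Suc L" "v \<in> verts Q"
  obtain x y :: "'a \<Rightarrow> 'k mat" where x: "x \<in> layer d S" and y: "y \<in> layer d S'" using ne by blast
  have "governs d S' x" by (rule closure_layer_governs[OF S(2)]) (use layer_in_closure[OF x] eq in simp)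
  moreover have "governs d S y" by (rule closure_layer_governs[OF S(1)]) (use layer_in_closure[OF y] eq in simp)
  ultimately show "seq_dim S l v = seq_dim S' l v"
    using governs_seq_dim_le[OF x _ l] governs_seq_dim_le[OF y _ l] by (simp add: le_antisym)
qed

lemma irreducible_in_layer_closure:
  fixes D :: "('a \<Rightarrow> 'k::alg_closed_field mat) set"
  assumes D: "irreducible_in (zariski Q L d) D"
  shows "\<exists>S\<in>semisimple_sequences Q L d. D \<subseteq> zariski Q L d closure_of layer d S"
proof (rule irreducible_finite_union[OF D finite_semisimple_sequences])
  show "D \<subseteq> (\<Union>S\<in>semisimple_sequences Q L d. zariski Q L d closure_of layer d S)"
  proof
    fix x assume "x \<in> D"
    then have "x \<in> rep_variety Q L d" using D by (auto simp: irreducible_in_def topspace_zariski)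
    then show "x \<in> (\<Union>S\<in>semisimple_sequences Q L d. zariski Q L d closure_of layer d S)"
      using rep_layer_cover layer_in_closure by blast
  qed
qed (rule closedin_closure_of)

lemma component_is_layer_closure:
  fixes C :: "('a \<Rightarrow> 'k::alg_closed_field mat) set"
  assumes C: "irreducible_component (zariski Q L d) C"
  shows "\<exists>S\<in>semisimple_sequences Q L d. C = zariski Q L d closure_of layer d S"
proof -
  have irr: "irreducible_in (zariski Q L d) C" using C by (simp add: irreducible_component_def)
  obtain S where S: "S \<in> semisimple_sequences Q L d" "C \<subseteq> zariski Q L d closure_of layer d S"
    using irreducible_in_layer_closure[OF irr] by blast
  have "layer d S \<noteq> ({} :: ('a \<Rightarrow> 'k mat) set)"
    using S(2) irr by (auto simp: irreducible_in_def)
  then have "irreducible_in (zariski Q L d) (zariski Q L d closure_of layer d S :: ('a \<Rightarrow> 'k mat) set)"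
    using irreducible_closure[OF irreducible_layer[OF S(1)]] by blast
  then show ?thesis using C S unfolding irreducible_component_def by blast
qed

text \<open>If the stratum lay in the union of the other closures, irreducibility would put it into
  one of them, and maximality would make two closures of distinct sequences equal; so some point
  avoids all the others. Conversely, an irreducible set containing the closure lies in the closure
  of some stratum, whose sequence then governs the given point and must be \<open>S\<close>.\<close>

lemma component_iff:
  assumes S: "S \<in> semisimple_sequences Q L d"
  shows "irreducible_component (zariski Q L d) (zariski Q L d closure_of (layer d S :: ('a \<Rightarrow> 'k::alg_closed_field mat) set)) \<longleftrightarrow>
    (\<exists>x\<in>layer d S :: ('a \<Rightarrow> 'k mat) set. governing d x = {S})"
proof
  let ?cl = "\<lambda>S. zariski Q L d closure_of (layer d S :: ('a \<Rightarrow> 'k mat) set)"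
  assume C: "irreducible_component (zariski Q L d) (?cl S)"
  then have irr: "irreducible_in (zariski Q L d) (?cl S)" by (simp add: irreducible_component_def)
  then have ne: "layer d S \<noteq> ({} :: ('a \<Rightarrow> 'k mat) set)" by (auto simp: irreducible_in_def)
  let ?I = "semisimple_sequences Q L d - {S}"
  have "\<not> layer d S \<subseteq> (\<Union>S'\<in>?I. ?cl S')"
  proof
    assume "layer d S \<subseteq> (\<Union>S'\<in>?I. ?cl S')"
    then obtain S' where S': "S' \<in> ?I" "layer d S \<subseteq> ?cl S'"
      using irreducible_finite_union[OF irreducible_layer[OF S ne], of ?I ?cl] finite_semisimple_sequences by auto
    have ne': "layer d S' \<noteq> ({} :: ('a \<Rightarrow> 'k mat) set)" using S'(2) ne by auto
    have "?cl S \<subseteq> ?cl S'" using S'(2) by (intro closure_of_minimal) auto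
    moreover have "irreducible_in (zariski Q L d) (?cl S')"
      using S'(1) by (intro irreducible_closure irreducible_layer ne') auto
    ultimately have "?cl S' = ?cl S" using C unfolding irreducible_component_def by blast
    then have "S = S'" using layer_unique[OF S _ _ ne ne'] S'(1) by auto
    then show False using S'(1) by simp
  qed
  then obtain x where x: "x \<in> layer d S" "\<And>S'. S' \<in> ?I \<Longrightarrow> x \<notin> ?cl S'" by blast
  have xr: "x \<in> rep_variety Q L d" using x(1) rep_layer_subset by blast
  have "governing d x = {S}"
    using x S layer_in_closure[OF x(1)] governing_iff[OF xr] by blast
  then show "\<exists>x\<in>layer d S :: ('a \<Rightarrow> 'k mat) set. governing d x = {S}" using x(1) by (rule bexI)
next
  let ?cl = "\<lambda>S. zariski Q L d closure_of (layer d S :: ('a \<Rightarrow> 'k mat) set)"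
  assume "\<exists>x\<in>layer d S :: ('a \<Rightarrow> 'k mat) set. governing d x = {S}"
  then obtain x :: "'a \<Rightarrow> 'k mat" where x: "x \<in> layer d S" "governing d x = {S}" by blast
  have xr: "x \<in> rep_variety Q L d" using x(1) rep_layer_subset by blast
  have ne: "layer d S \<noteq> ({} :: ('a \<Rightarrow> 'k mat) set)" using x by blast
  show "irreducible_component (zariski Q L d) (?cl S)"
    unfolding irreducible_component_def
  proof (intro conjI allI impI)
    show "irreducible_in (zariski Q L d) (?cl S)" by (rule irreducible_closure[OF irreducible_layer[OF S ne]])
    fix D assume D: "irreducible_in (zariski Q L d) D \<and> ?cl S \<subseteq> D"
    then obtain S' where S': "S' \<in> semisimple_sequences Q L d" "D \<subseteq> ?cl S'"
      using irreducible_in_layer_closure by blast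
    then have "x \<in> ?cl S'" using D layer_in_closure[OF x(1)] by blast
    then have "S' \<in> governing d x" using S'(1) governing_iff[OF xr] by blast
    then have "S' = S" using x(2) by simp
    then show "D = ?cl S" using D S'(2) by blast
  qed
qed

text \<open>The radical layering of \<open>x\<close> governs \<open>x\<close> as well, so it is the
  only governing sequence. This moves \<open>x\<close> from the closure into the stratum
  itself.\<close>

lemma governing_card_1:
  fixes x :: "'a \<Rightarrow> 'k::alg_closed_field mat"
  assumes S: "S \<in> semisimple_sequences Q L d" and x: "x \<in> zariski Q L d closure_of layer d S"
    and card: "card (governing d x) = 1"
  shows "x \<in> layer d S" "governing d x = {S}"
proof -
  have xr: "x \<in> rep_variety Q L d" using x unfolding in_zariski_closure[OF rep_layer_subset] by blast
  have "S \<in> governing d x" using S x governing_iff[OF xr] by blast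
  then show eq: "governing d x = {S}" using card by (auto simp: card_1_singleton_iff)
  obtain S0 where S0: "S0 \<in> semisimple_sequences Q L d" "x \<in> layer d S0" using rep_layer_cover[OF xr] by blast
  then have "S0 \<in> governing d x" using layer_in_closure governing_iff[OF xr] by blast
  then show "x \<in> layer d S" using eq S0 by simp
qed

text \<open>A filtration governed by \<open>S\<close> contains the radical one and has the same
  dimensions, so the two coincide; conversely a filtration determines its sequence by its
  dimensions. Filtrations are compared up to index \<open>Suc L\<close>, where they end.\<close>

lemma radical_filtration_unique_iff:
  fixes x :: "'a \<Rightarrow> 'k::alg_closed_field mat"
  assumes S: "S \<in> semisimple_sequences Q L d" and xS: "x \<in> layer d S"
  shows "governing d x = {S} \<longleftrightarrow>
    (\<forall>U. (\<exists>S'. realizable TYPE('k) Q L S' \<and> governed_filtration Q L (rep_module Q d x) S' U) \<longleftrightarrow>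
      (\<forall>l\<le>Suc L. U l = radical_power \<Lambda> (rep_module Q d x) l))"
proof -
  have xr: "x \<in> rep_variety Q L d" using xS rep_layer_subset by blast
  interpret rep Q L d x using xr by unfold_locales
  interpret flags Q L d "seq_dim S" by (rule flags_seq_dim[OF S])
  have SG: "S \<in> governing d x" using S layer_in_closure[OF xS] governing_iff[OF xr] by blast
  have rad_dim: "fs.dim (rad d x l v) = seq_dim S l v" if "l \<le> Suc L" "v \<in> verts Q" for l v
    using xS that unfolding rep_layer_iff by blast
  have layered_rad: "layered S (rad d x)"
    unfolding layered_iff_flagged[OF xr S] by (rule rad_flagged[OF xr rad_dim])
  have 1: "\<forall>l\<le>Suc L. U l = radical_power \<Lambda> M l"
    if eq: "governing d x = {S}" and ex: "\<exists>S'. realizable TYPE('k) Q L S' \<and> governed_filtration Q L M S' U" for U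
  proof -
    from ex obtain S' where S': "realizable TYPE('k) Q L S'" "governed_filtration Q L M S' U" by blast
    then have "S' \<in> governing d x" by (auto simp: governing_def governs_def)
    then have "S' = S" using eq by simp
    then have "governed_filtration Q L M S U" using S'(2) by simp
    then obtain W where W: "layered S W" "\<And>l. l \<le> Suc L \<Longrightarrow> U l = sub (W l)"
      unfolding governed_filtration_iff by (elim exE conjE) simp
    show "\<forall>l\<le>Suc L. U l = radical_power \<Lambda> M l"
    proof (intro allI impI)
      fix l assume l: "l \<le> Suc L"
      have gr: "graded d (W l)" using W(1) l by (simp add: layered_def)
      have "rad d x l v = W l v" if v: "v \<in> verts Q" for v
      proof (rule dim_cspace_le(2)[OF rad_subspace rad_subset_layered[OF rep_axioms W(1) l v]])
        show "fs.subspace (W l v)" "W l v \<subseteq> cspace (d v)" using gr v by (auto simp: graded_def)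
        show "fs.dim (rad d x l v) = fs.dim (W l v)"
          using rad_dim[OF l v] layered_dim[OF rep_axioms W(1) l v] by simp
      qed
      then have "sub (rad d x l) = sub (W l)" using sub_eq_iff[OF graded_rad gr] by blast
      then show "U l = radical_power \<Lambda> M l" using W(2)[OF l] radical_power_eq by simp
    qed
  qed
  have 2: "\<exists>S'. realizable TYPE('k) Q L S' \<and> governed_filtration Q L M S' U"
    if U: "\<forall>l\<le>Suc L. U l = radical_power \<Lambda> M l" for U
  proof -
    have "governed_filtration Q L M S U"
      unfolding governed_filtration_iff using layered_rad U radical_power_eq by blast
    then show ?thesis
      using SG by (auto simp: governing_def)
  qed
  show ?thesis
  proof
    assume eq: "governing d x = {S}"
    show "\<forall>U. (\<exists>S'. realizable TYPE('k) Q L S' \<and> governed_filtration Q L M S' U) \<longleftrightarrow>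
      (\<forall>l\<le>Suc L. U l = radical_power \<Lambda> M l)"
    proof (intro allI)
      fix U
      show "(\<exists>S'. realizable TYPE('k) Q L S' \<and> governed_filtration Q L M S' U) \<longleftrightarrow>
        (\<forall>l\<le>Suc L. U l = radical_power \<Lambda> M l)"
        by (rule iffI[OF 1[OF eq] 2])
    qed
  next
    assume *: "\<forall>U. (\<exists>S'. realizable TYPE('k) Q L S' \<and> governed_filtration Q L M S' U) \<longleftrightarrow>
      (\<forall>l\<le>Suc L. U l = radical_power \<Lambda> M l)"
    have "S' = S" if S': "S' \<in> governing d x" for S'
    proof -
      have S's: "S' \<in> semisimple_sequences Q L d" using S' governing_iff[OF xr] by blast
      obtain U where U: "realizable TYPE('k) Q L S'" "governed_filtration Q L M S' U"
        using S' by (auto simp: governing_def governs_def)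
      from U(2) obtain W where W: "layered S' W" "\<And>l. l \<le> Suc L \<Longrightarrow> U l = sub (W l)"
        unfolding governed_filtration_iff by (elim exE conjE) simp
      have "\<exists>S'. realizable TYPE('k) Q L S' \<and> governed_filtration Q L M S' U"
        using U by (intro exI[of _ S'] conjI)
      with spec[OF *, of U] have Ur: "\<forall>l\<le>Suc L. U l = radical_power \<Lambda> M l" by (rule iffD1)
      show ?thesis
      proof (rule seq_eqI[OF S's S])
        fix l v assume l: "l \<le> Suc L" and v: "v \<in> verts Q"
        have gr: "graded d (W l)" using W(1) l by (simp add: layered_def)
        have "sub (rad d x l) = sub (W l)" using W(2)[OF l] Ur l radical_power_eq by simp
        then have "rad d x l v = W l v" using sub_eq_iff[OF graded_rad gr] v by blast
        then show "seq_dim S' l v = seq_dim S l v"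
          using rad_dim[OF l v] layered_dim[OF rep_axioms W(1) l v] by simp
      qed
    qed
    then show "governing d x = {S}" using SG by blast
  qed
qed

end

theorem theoremC:
  fixes Q :: "('v, 'a) pre_digraph" and L :: nat and d :: "'v \<Rightarrow> nat"
  assumes "fin_digraph Q"
    and "\<exists>u p v. pre_digraph.awalk Q u p v \<and> length p = L"
  shows
    "{C :: ('a \<Rightarrow> 'k::alg_closed_field mat) set. irreducible_component (zariski Q L d) C} =
       {zariski Q L d closure_of rep_layer Q L d S | S.
          S \<in> semisimple_sequences Q L d \<and>
          (\<exists>x \<in> zariski Q L d closure_of (rep_layer Q L d S :: ('a \<Rightarrow> 'k mat) set).
             Gamma Q L (rep_module Q d x) = 1)} \<and>
     (\<forall>S \<in> semisimple_sequences Q L d.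
        irreducible_component (zariski Q L d)
          (zariski Q L d closure_of (rep_layer Q L d S :: ('a \<Rightarrow> 'k mat) set)) \<longleftrightarrow>
        (\<exists>x \<in> (rep_layer Q L d S :: ('a \<Rightarrow> 'k mat) set). \<forall>U.
           (\<exists>S'. realizable TYPE('k) Q L S' \<and>
                 governed_filtration Q L (rep_module Q d x) S' U) \<longleftrightarrow>
           (\<forall>l\<le>Suc L. U l =
              radical_power (truncated_path_algebra Q L) (rep_module Q d x) l)))"
proof -
  interpret fin_digraph Q by (rule assms(1))
  interpret trunc Q L by unfold_locales
  let ?cl = "\<lambda>S. zariski Q L d closure_of (layer d S :: ('a \<Rightarrow> 'k mat) set)"
  have comp_Gamma: "irreducible_component (zariski Q L d) (?cl S) \<longleftrightarrow>
      (\<exists>x\<in>?cl S. Gamma Q L (rep_module Q d x) = 1)" if S: "S \<in> semisimple_sequences Q L d" for S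
  proof
    assume "irreducible_component (zariski Q L d) (?cl S)"
    then obtain x :: "'a \<Rightarrow> 'k mat" where x: "x \<in> layer d S" "governing d x = {S}"
      unfolding component_iff[OF S] by (elim bexE)
    show "\<exists>x\<in>?cl S. Gamma Q L (rep_module Q d x) = 1"
    proof (rule bexI[of _ x])
      show "Gamma Q L (rep_module Q d x) = 1" by (simp add: Gamma_eq x(2))
    qed (rule layer_in_closure[OF x(1)])
  next
    assume "\<exists>x\<in>?cl S. Gamma Q L (rep_module Q d x) = 1"
    then obtain x :: "'a \<Rightarrow> 'k mat" where "x \<in> ?cl S" "card (governing d x) = 1"
      unfolding Gamma_eq by (elim bexE)
    note x = governing_card_1[OF S this]
    show "irreducible_component (zariski Q L d) (?cl S)"
      unfolding component_iff[OF S] by (rule bexI[of _ x]) (rule x)+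
  qed
  have "{C :: ('a \<Rightarrow> 'k mat) set. irreducible_component (zariski Q L d) C} =
      {?cl S | S. S \<in> semisimple_sequences Q L d \<and> (\<exists>x\<in>?cl S. Gamma Q L (rep_module Q d x) = 1)}"
  proof (intro equalityI subsetI)
    fix C :: "('a \<Rightarrow> 'k mat) set" assume "C \<in> {C. irreducible_component (zariski Q L d) C}"
    then have C: "irreducible_component (zariski Q L d) C" by simp
    then obtain S where "S \<in> semisimple_sequences Q L d" "C = ?cl S" using component_is_layer_closure by blast
    then show "C \<in> {?cl S | S. S \<in> semisimple_sequences Q L d \<and> (\<exists>x\<in>?cl S. Gamma Q L (rep_module Q d x) = 1)}"
      using C comp_Gamma by blast
  next
    fix C assume "C \<in> {?cl S | S. S \<in> semisimple_sequences Q L d \<and> (\<exists>x\<in>?cl S. Gamma Q L (rep_module Q d x) = 1)}"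
    then show "C \<in> {C. irreducible_component (zariski Q L d) C}" using comp_Gamma by blast
  qed
  moreover have "irreducible_component (zariski Q L d) (?cl S) \<longleftrightarrow>
        (\<exists>x \<in> (layer d S :: ('a \<Rightarrow> 'k mat) set). \<forall>U.
           (\<exists>S'. realizable TYPE('k) Q L S' \<and> governed_filtration Q L (rep_module Q d x) S' U) \<longleftrightarrow>
           (\<forall>l\<le>Suc L. U l = radical_power \<Lambda> (rep_module Q d x) l))"
    if S: "S \<in> semisimple_sequences Q L d" for S
    unfolding component_iff[OF S] using radical_filtration_unique_iff[OF S] by (intro bex_cong refl)
  ultimately show ?thesis by (intro conjI ballI)
qed

end
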